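(* Let $k$ be a commutative ring and $A$ a $k$-algebra. There is a bijection, given by the identity on elements, between the set of canonical $R$-matrices for $A$ and the set of all elements $R=R^1\otimes R^2\otimes R^3\in A^{(3)}$ satisfying $$R^1\otimes aR^2\otimes R^3=R^1\otimes R^2\otimes R^3a\quad\text{for all } a\in A$$ and the normalizing condition $$R^1R^2\otimes R^3=R^2\otimes R^3R^1=1\otimes 1.$$ Furthermore, every such $R$ is invariant under cyclic permutation of the tensor factors, $$R=R^2\otimes R^3\otimes R^1=R^3\otimes R^1\otimes R^2,$$ and satisfies the additional normalizing condition $$R^1\otimes R^2R^3=1\otimes 1.$$ In particular, every braiding on the monoidal category ${}_A\mathcal{M}_A$ of $A$-bimodules is a symmetry.
   Context: Algebras are associative and unital. $\otimes=\otimes_k$, and $A^{(n)}=A\otimes\cdots\otimes A$ ($n$ factors), with its tensor product algebra structure. An element $R\in A^{(3)}$ is written $R=R^1\otimes R^2\otimes R^3$ with summation implicitly understood. A canonical $R$-matrix for $A$ is an invertible element $R$ of the algebra $A^{(3)}$ such that, with $r=r^1\otimes r^2\otimes r^3$ a second copy of $R$, for all $a\in A$: $R^1\otimes R^2\otimes aR^3=R^1a\otimes R^2\otimes R^3$; $aR^1\otimes R^2\otimes R^3=R^1\otimes R^2a\otimes R^3$; $R^1\otimes aR^2\otimes R^3=R^1\otimes R^2\otimes R^3a$; $R^1\otimes R^2\otimes 1\otimes R^3=r^1R^1\otimes r^2\otimes r^3R^2\otimes R^3$; $R^1\otimes 1\otimes R^2\otimes R^3=R^1\otimes R^2r^1\otimes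 r^2\otimes R^3r^3$. ${}_A\mathcal{M}_A$ is the $k$-linear category of $A$-bimodules (left and right $k$-actions agree), monoidal with tensor product $\otimes_A$ and unit object $A$. A braiding on a monoidal category (treated as strict) is a natural isomorphism $c_{U,V}:U\otimes V\to V\otimes U$ such that $c_{U,V\otimes W}=(V\otimes c_{U,W})\circ(c_{U,V}\otimes W)$ and $c_{U\otimes V,W}=(c_{U,W}\otimes V)\circ(U\otimes c_{V,W})$ for all objects $U,V,W$, where an object also denotes its identity morphism. A braiding is a symmetry if $c_{U,V}^{-1}=c_{V,U}$ for all $U,V$. *)

theory Defs
  imports "HOL-Algebra.Free_Abelian_Groups" "HOL-Algebra.Module"
begin

section \<open>Algebras over a commutative ring\<close>

text \<open>The locale \<open>algebra\<close> of HOL-Algebra requires the algebra itself to be commutative.\<close>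

locale assoc_algebra = module k A + A: ring A
  for k :: "('k, 'r) ring_scheme" (structure) and A :: "('k, 'a, 's) module_scheme" (structure) +
  assumes smult_mult_left:
      "\<lbrakk>c \<in> carrier k; x \<in> carrier A; y \<in> carrier A\<rbrakk>
        \<Longrightarrow> (c \<odot>\<^bsub>A\<^esub> x) \<otimes>\<^bsub>A\<^esub> y = c \<odot>\<^bsub>A\<^esub> (x \<otimes>\<^bsub>A\<^esub> y)"
    and smult_mult_right:
      "\<lbrakk>c \<in> carrier k; x \<in> carrier A; y \<in> carrier A\<rbrakk>
        \<Longrightarrow> x \<otimes>\<^bsub>A\<^esub> (c \<odot>\<^bsub>A\<^esub> y) = c \<odot>\<^bsub>A\<^esub> (x \<otimes>\<^bsub>A\<^esub> y)"


section \<open>Abelian groups given by generators and relations\<close>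

text \<open>As for \<^const>\<open>free_Abelian_group\<close>, abelian groups that occur as targets or quotients
  are \<^const>\<open>monoid.mult\<close>-groups, i.e.\ their addition is written multiplicatively.\<close>

definition presented_group :: "'x set \<Rightarrow> ('x \<Rightarrow>\<^sub>0 int) set \<Rightarrow> ('x \<Rightarrow>\<^sub>0 int) set monoid" where
  "presented_group S rels = free_Abelian_group S Mod generate (free_Abelian_group S) rels"

definition presented_gen :: "'x set \<Rightarrow> ('x \<Rightarrow>\<^sub>0 int) set \<Rightarrow> 'x \<Rightarrow> ('x \<Rightarrow>\<^sub>0 int) set" where
  "presented_gen S rels s =
     generate (free_Abelian_group S) rels #>\<^bsub>free_Abelian_group S\<^esub> frag_of s"

text \<open>The homomorphism out of \<open>Q\<close> with prescribed values on the generators \<open>\<pi> s\<close>.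
  All maps out of tensor products below are given this way; their existence is the
  universal property \<open>presented_group_universal\<close>.\<close>

definition induced_hom ::
  "('q, 'm) monoid_scheme \<Rightarrow> ('g, 'n) monoid_scheme \<Rightarrow> 'x set \<Rightarrow> ('x \<Rightarrow> 'q) \<Rightarrow> ('x \<Rightarrow> 'g) \<Rightarrow> 'q \<Rightarrow> 'g"
where
  "induced_hom Q G S \<pi> f =
     (THE h. h \<in> hom Q G \<and> h \<in> extensional (carrier Q) \<and> (\<forall>s\<in>S. h (\<pi> s) = f s))"

lemma presented_group_universal:
  assumes G: "comm_group G" and f: "f \<in> S \<rightarrow> carrier G"
    and rels: "rels \<subseteq> carrier (free_Abelian_group S)"
    and kills: "\<And>h r. \<lbrakk>h \<in> hom (free_Abelian_group S) G; \<And>s. s \<in> S \<Longrightarrow> h (frag_of s) = f s; r \<in> rels\<rbrakk>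
                  \<Longrightarrow> h r = \<one>\<^bsub>G\<^esub>"
  shows "\<exists>!h. h \<in> hom (presented_group S rels) G \<and>
              h \<in> extensional (carrier (presented_group S rels)) \<and>
              (\<forall>s\<in>S. h (presented_gen S rels s) = f s)"
proof -
  let ?F = "free_Abelian_group S" and ?N = "generate (free_Abelian_group S) rels"
  interpret G: comm_group G by (fact G)
  interpret F: comm_group ?F by (rule abelian_free_Abelian_group)
  have sub: "subgroup ?N ?F" by (rule F.generate_is_subgroup[OF rels])
  have norm: "?N \<lhd> ?F" using sub by (simp add: F.normal_iff_subgroup)
  obtain h0 where h0: "h0 \<in> hom ?F G" "\<And>s. s \<in> S \<Longrightarrow> h0 (frag_of s) = f s"
    using G.free_Abelian_group_universal[of f S] f by blast
  interpret h0: group_hom ?F G h0 by unfold_locales (rule h0)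
  have ker: "rels \<subseteq> kernel ?F G h0"
    using kills[OF h0] rels unfolding kernel_def by blast
  have "?N \<subseteq> kernel ?F G h0"
    by (rule F.generate_subgroup_incl[OF ker h0.subgroup_kernel])
  then obtain g where g: "g \<in> hom (?F Mod ?N) G" "\<And>x. x \<in> carrier ?F \<Longrightarrow> g (?N #>\<^bsub>?F\<^esub> x) = h0 x"
    using h0.FactGroup_universal_kernel[OF norm] by blast
  have Q: "group (?F Mod ?N)" by (rule normal.factorgroup_is_group[OF norm])
  have cQ: "carrier (?F Mod ?N) = (\<lambda>x. ?N #>\<^bsub>?F\<^esub> x) ` carrier ?F"
    by (auto simp: FactGroup_def RCOSETS_def)
  let ?g = "restrict g (carrier (?F Mod ?N))"
  have gh: "?g \<in> hom (?F Mod ?N) G"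
  proof (rule homI)
    fix x y assume xy: "x \<in> carrier (?F Mod ?N)" "y \<in> carrier (?F Mod ?N)"
    then show "?g x \<in> carrier G" using g(1) by (auto simp: hom_def)
    have "x \<otimes>\<^bsub>?F Mod ?N\<^esub> y \<in> carrier (?F Mod ?N)"
      using xy Q by (simp only: group.is_monoid monoid.m_closed)
    then show "?g (x \<otimes>\<^bsub>?F Mod ?N\<^esub> y) = ?g x \<otimes>\<^bsub>G\<^esub> ?g y"
      using xy hom_mult[OF g(1) xy] by (simp only: restrict_apply if_True)
  qed
  show ?thesis
  proof (rule ex1I[of _ ?g])
    show "?g \<in> hom (presented_group S rels) G \<and> ?g \<in> extensional (carrier (presented_group S rels)) \<and>
              (\<forall>s\<in>S. ?g (presented_gen S rels s) = f s)"
      using gh by (auto simp: presented_group_def presented_gen_def cQ g(2) h0(2))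
  next
    fix h assume h: "h \<in> hom (presented_group S rels) G \<and> h \<in> extensional (carrier (presented_group S rels)) \<and>
              (\<forall>s\<in>S. h (presented_gen S rels s) = f s)"
    then have hh: "h \<in> hom (?F Mod ?N) G" by (simp add: presented_group_def)
    have pi: "(\<lambda>x. ?N #>\<^bsub>?F\<^esub> x) \<in> hom ?F (?F Mod ?N)"
      by (rule normal.r_coset_hom_Mod[OF norm])
    interpret h': group_hom ?F G "h \<circ> (\<lambda>x. ?N #>\<^bsub>?F\<^esub> x)"
      by unfold_locales (rule hom_compose[OF pi hh])
    have eq: "h (?N #>\<^bsub>?F\<^esub> x) = h0 x" if "Poly_Mapping.keys x \<subseteq> S" for x
    proof (rule free_Abelian_group_induct[OF that])
      show "h (?N #>\<^bsub>?F\<^esub> 0) = h0 0" using h'.hom_one h0.hom_one by simp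
    next
      fix x y assume xy: "Poly_Mapping.keys x \<subseteq> S" "Poly_Mapping.keys y \<subseteq> S"
        and IH: "h (?N #>\<^bsub>?F\<^esub> x) = h0 x" "h (?N #>\<^bsub>?F\<^esub> y) = h0 y"
      have diff: "k' (x - y) = k' x \<otimes>\<^bsub>G\<^esub> inv\<^bsub>G\<^esub> k' y" if k': "group_hom ?F G k'" for k'
        using group_hom.hom_mult[OF k', of x "inv\<^bsub>?F\<^esub> y"] group_hom.hom_inv[OF k', of y]
          F.inv_closed[of y] xy by simp
      from diff[OF h'.group_hom_axioms] diff[OF h0.group_hom_axioms] IH
      show "h (?N #>\<^bsub>?F\<^esub> (x - y)) = h0 (x - y)" by simp
    next
      fix s assume "s \<in> S"
      then show "h (?N #>\<^bsub>?F\<^esub> frag_of s) = h0 (frag_of s)"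
        using h h0(2) by (simp add: presented_gen_def)
    qed
    show "h = ?g"
    proof (rule extensionalityI[of _ "carrier (?F Mod ?N)"])
      show "h \<in> extensional (carrier (?F Mod ?N))" using h by (simp add: presented_group_def)
      show "?g \<in> extensional (carrier (?F Mod ?N))" by simp
      show "h x = ?g x" if "x \<in> carrier (?F Mod ?N)" for x
        using that g(2) eq unfolding cQ by auto
    qed
  qed
qed


section \<open>Tensor powers of an algebra\<close>

definition tuples :: "('a, 'm) partial_object_scheme \<Rightarrow> nat \<Rightarrow> 'a list set" where
  "tuples A n = {as. length as = n \<and> set as \<subseteq> carrier A}"

definition tpow_rels ::
  "('k, 'r) ring_scheme \<Rightarrow> ('k, 'a, 's) module_scheme \<Rightarrow> nat \<Rightarrow> ('a list \<Rightarrow>\<^sub>0 int) set"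
where
  "tpow_rels k A n =
     {frag_of (as[i := x \<oplus>\<^bsub>A\<^esub> y]) - frag_of (as[i := x]) - frag_of (as[i := y]) | as i x y.
        as \<in> tuples A n \<and> i < n \<and> x \<in> carrier A \<and> y \<in> carrier A} \<union>
     {frag_of (as[i := c \<odot>\<^bsub>A\<^esub> as ! i]) - frag_of (as[j := c \<odot>\<^bsub>A\<^esub> as ! j]) | as i j c.
        as \<in> tuples A n \<and> i < n \<and> j < n \<and> c \<in> carrier k}"

definition tpow_group ::
  "('k, 'r) ring_scheme \<Rightarrow> ('k, 'a, 's) module_scheme \<Rightarrow> nat \<Rightarrow> ('a list \<Rightarrow>\<^sub>0 int) set monoid"
where
  "tpow_group k A n = presented_group (tuples A n) (tpow_rels k A n)"

text \<open>\<open>pure k A [a\<^sub>1, \<dots>, a\<^sub>n]\<close> is \<open>a\<^sub>1 \<otimes> \<dots> \<otimes> a\<^sub>n\<close>.\<close>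

definition pure ::
  "('k, 'r) ring_scheme \<Rightarrow> ('k, 'a, 's) module_scheme \<Rightarrow> 'a list \<Rightarrow> ('a list \<Rightarrow>\<^sub>0 int) set"
where
  "pure k A as = presented_gen (tuples A (length as)) (tpow_rels k A (length as)) as"

definition tpow_lift ::
  "('k, 'r) ring_scheme \<Rightarrow> ('k, 'a, 's) module_scheme \<Rightarrow> nat \<Rightarrow> ('g, 'm) monoid_scheme \<Rightarrow>
   ('a list \<Rightarrow> 'g) \<Rightarrow> ('a list \<Rightarrow>\<^sub>0 int) set \<Rightarrow> 'g"
where
  "tpow_lift k A n G f = induced_hom (tpow_group k A n) G (tuples A n) (pure k A) f"

text \<open>The algebra \<open>A\<^sup>(\<^sup>n\<^sup>)\<close>, as a ring, for \<open>n \<ge> 1\<close>. (For \<open>n = 0\<close> the relations above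
  would yield the integers instead of \<open>k\<close>.)\<close>

definition tensor_power ::
  "('k, 'r) ring_scheme \<Rightarrow> ('k, 'a, 's) module_scheme \<Rightarrow> nat \<Rightarrow> ('a list \<Rightarrow>\<^sub>0 int) set ring"
where
  "tensor_power k A n =
     \<lparr>carrier = carrier (tpow_group k A n),
      monoid.mult = (\<lambda>X Y. tpow_lift k A n (tpow_group k A n)
        (\<lambda>as. tpow_lift k A n (tpow_group k A n)
          (\<lambda>bs. pure k A (map2 (\<lambda>a b. a \<otimes>\<^bsub>A\<^esub> b) as bs)) Y) X),
      one = pure k A (replicate n \<one>\<^bsub>A\<^esub>),
      zero = \<one>\<^bsub>tpow_group k A n\<^esub>,
      add = (\<lambda>X Y. X \<otimes>\<^bsub>tpow_group k A n\<^esub> Y)\<rparr>"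

text \<open>Sweedler notation. For \<open>R \<in> A\<^sup>(\<^sup>3\<^sup>)\<close>,
  \<open>sweedler k A m R (\<lambda>R1 R2 R3. [t\<^sub>1, \<dots>, t\<^sub>m])\<close> is the element \<open>t\<^sub>1 \<otimes> \<dots> \<otimes> t\<^sub>m\<close> of \<open>A\<^sup>(\<^sup>m\<^sup>)\<close>,
  summation over \<open>R = R\<^sup>1 \<otimes> R\<^sup>2 \<otimes> R\<^sup>3\<close> understood; \<open>sweedler2\<close> is the version with a second
  element \<open>r\<close>.\<close>

definition sweedler ::
  "('k, 'r) ring_scheme \<Rightarrow> ('k, 'a, 's) module_scheme \<Rightarrow> nat \<Rightarrow> ('a list \<Rightarrow>\<^sub>0 int) set \<Rightarrow>
   ('a \<Rightarrow> 'a \<Rightarrow> 'a \<Rightarrow> 'a list) \<Rightarrow> ('a list \<Rightarrow>\<^sub>0 int) set"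
where
  "sweedler k A m R F =
     tpow_lift k A 3 (tpow_group k A m) (\<lambda>as. pure k A (F (as ! 0) (as ! 1) (as ! 2))) R"

definition sweedler2 ::
  "('k, 'r) ring_scheme \<Rightarrow> ('k, 'a, 's) module_scheme \<Rightarrow> nat \<Rightarrow>
   ('a list \<Rightarrow>\<^sub>0 int) set \<Rightarrow> ('a list \<Rightarrow>\<^sub>0 int) set \<Rightarrow>
   ('a \<Rightarrow> 'a \<Rightarrow> 'a \<Rightarrow> 'a \<Rightarrow> 'a \<Rightarrow> 'a \<Rightarrow> 'a list) \<Rightarrow> ('a list \<Rightarrow>\<^sub>0 int) set"
where
  "sweedler2 k A m r R F =
     tpow_lift k A 3 (tpow_group k A m)
       (\<lambda>as. sweedler k A m R (F (as ! 0) (as ! 1) (as ! 2))) r"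

definition canonical_R_matrix ::
  "('k, 'r) ring_scheme \<Rightarrow> ('k, 'a, 's) module_scheme \<Rightarrow> ('a list \<Rightarrow>\<^sub>0 int) set \<Rightarrow> bool"
where
  "canonical_R_matrix k A R \<longleftrightarrow>
     R \<in> Units (tensor_power k A 3) \<and>
     (\<forall>a\<in>carrier A. sweedler k A 3 R (\<lambda>R1 R2 R3. [R1, R2, a \<otimes>\<^bsub>A\<^esub> R3]) =
                    sweedler k A 3 R (\<lambda>R1 R2 R3. [R1 \<otimes>\<^bsub>A\<^esub> a, R2, R3])) \<and>
     (\<forall>a\<in>carrier A. sweedler k A 3 R (\<lambda>R1 R2 R3. [a \<otimes>\<^bsub>A\<^esub> R1, R2, R3]) =
                    sweedler k A 3 R (\<lambda>R1 R2 R3. [R1, R2 \<otimes>\<^bsub>A\<^esub> a, R3])) \<and>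
     (\<forall>a\<in>carrier A. sweedler k A 3 R (\<lambda>R1 R2 R3. [R1, a \<otimes>\<^bsub>A\<^esub> R2, R3]) =
                    sweedler k A 3 R (\<lambda>R1 R2 R3. [R1, R2, R3 \<otimes>\<^bsub>A\<^esub> a])) \<and>
     sweedler k A 4 R (\<lambda>R1 R2 R3. [R1, R2, \<one>\<^bsub>A\<^esub>, R3]) =
       sweedler2 k A 4 R R
         (\<lambda>r1 r2 r3 R1 R2 R3. [r1 \<otimes>\<^bsub>A\<^esub> R1, r2, r3 \<otimes>\<^bsub>A\<^esub> R2, R3]) \<and>
     sweedler k A 4 R (\<lambda>R1 R2 R3. [R1, \<one>\<^bsub>A\<^esub>, R2, R3]) =
       sweedler2 k A 4 R R
         (\<lambda>r1 r2 r3 R1 R2 R3. [R1, R2 \<otimes>\<^bsub>A\<^esub> r1, r2, R3 \<otimes>\<^bsub>A\<^esub> r3])"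


definition normalized_elements ::
  "('k, 'r) ring_scheme \<Rightarrow> ('k, 'a, 's) module_scheme \<Rightarrow> ('a list \<Rightarrow>\<^sub>0 int) set set"
where
  "normalized_elements k A =
     {R \<in> carrier (tensor_power k A 3).
        (\<forall>a\<in>carrier A. sweedler k A 3 R (\<lambda>R1 R2 R3. [R1, a \<otimes>\<^bsub>A\<^esub> R2, R3]) =
                       sweedler k A 3 R (\<lambda>R1 R2 R3. [R1, R2, R3 \<otimes>\<^bsub>A\<^esub> a])) \<and>
        sweedler k A 2 R (\<lambda>R1 R2 R3. [R1 \<otimes>\<^bsub>A\<^esub> R2, R3]) = pure k A [\<one>\<^bsub>A\<^esub>, \<one>\<^bsub>A\<^esub>] \<and>
        sweedler k A 2 R (\<lambda>R1 R2 R3. [R2, R3 \<otimes>\<^bsub>A\<^esub> R1]) = pure k A [\<one>\<^bsub>A\<^esub>, \<one>\<^bsub>A\<^esub>]}"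


section \<open>The monoidal category of bimodules\<close>

text \<open>The additive group of a bimodule is the \<^const>\<open>monoid.mult\<close>-group of the record. The
  \<open>k\<close>-action is not separate data: it is \<open>c \<cdot> u = (c \<cdot> 1) u = u (c \<cdot> 1)\<close>.\<close>

record ('a, 'u) bimod = "'u monoid" +
  lact :: "'a \<Rightarrow> 'u \<Rightarrow> 'u"
  ract :: "'u \<Rightarrow> 'a \<Rightarrow> 'u"

definition bimodule ::
  "('k, 'r) ring_scheme \<Rightarrow> ('k, 'a, 's) module_scheme \<Rightarrow> ('a, 'u) bimod \<Rightarrow> bool"
where
  "bimodule k A U \<longleftrightarrow>
     comm_group U \<and>
     (\<forall>a\<in>carrier A. lact U a \<in> hom U U) \<and>
     (\<forall>a\<in>carrier A. (\<lambda>u. ract U u a) \<in> hom U U) \<and>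
     (\<forall>u\<in>carrier U. lact U \<one>\<^bsub>A\<^esub> u = u \<and> ract U u \<one>\<^bsub>A\<^esub> = u) \<and>
     (\<forall>a\<in>carrier A. \<forall>b\<in>carrier A. \<forall>u\<in>carrier U.
        lact U (a \<oplus>\<^bsub>A\<^esub> b) u = lact U a u \<otimes>\<^bsub>U\<^esub> lact U b u \<and>
        ract U u (a \<oplus>\<^bsub>A\<^esub> b) = ract U u a \<otimes>\<^bsub>U\<^esub> ract U u b \<and>
        lact U (a \<otimes>\<^bsub>A\<^esub> b) u = lact U a (lact U b u) \<and>
        ract U u (a \<otimes>\<^bsub>A\<^esub> b) = ract U (ract U u a) b \<and>
        ract U (lact U a u) b = lact U a (ract U u b)) \<and>
     (\<forall>c\<in>carrier k. \<forall>u\<in>carrier U. lact U (c \<odot>\<^bsub>A\<^esub> \<one>\<^bsub>A\<^esub>) u = ract U u (c \<odot>\<^bsub>A\<^esub> \<one>\<^bsub>A\<^esub>))"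

text \<open>Morphisms are compared on the carrier of their domain only.\<close>

definition bimod_hom ::
  "('k, 'a, 's) module_scheme \<Rightarrow> ('a, 'u) bimod \<Rightarrow> ('a, 'u) bimod \<Rightarrow> ('u \<Rightarrow> 'u) set"
where
  "bimod_hom A U V =
     {f \<in> hom U V. \<forall>a\<in>carrier A. \<forall>u\<in>carrier U.
        f (lact U a u) = lact V a (f u) \<and> f (ract U u a) = ract V (f u) a}"

definition balanced_rels ::
  "('k, 'a, 's) module_scheme \<Rightarrow> ('a, 'u) bimod \<Rightarrow> ('a, 'u) bimod \<Rightarrow> ('u \<times> 'u \<Rightarrow>\<^sub>0 int) set"
where
  "balanced_rels A U V =
     {frag_of (u \<otimes>\<^bsub>U\<^esub> u', v) - frag_of (u, v) - frag_of (u', v) | u u' v.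
        u \<in> carrier U \<and> u' \<in> carrier U \<and> v \<in> carrier V} \<union>
     {frag_of (u, v \<otimes>\<^bsub>V\<^esub> v') - frag_of (u, v) - frag_of (u, v') | u v v'.
        u \<in> carrier U \<and> v \<in> carrier V \<and> v' \<in> carrier V} \<union>
     {frag_of (ract U u a, v) - frag_of (u, lact V a v) | u a v.
        u \<in> carrier U \<and> a \<in> carrier A \<and> v \<in> carrier V}"

text \<open>Bimodules are taken with carrier in a type \<open>'u\<close>. If \<open>'u\<close> is infinite, then the usual
  quotient of the free abelian group on \<open>U \<times> V\<close> embeds into \<open>'u\<close> (see
  \<open>inj_on_tensor_embedding\<close>), and \<open>U \<otimes>\<^sub>A V\<close> is the image of this quotient under a fixed
  embedding. Hence for infinite \<open>'u\<close> into which \<open>A\<close> embeds one obtains the monoidal category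
  of all \<open>A\<close>-bimodules of cardinality at most that of \<open>'u\<close>.\<close>

definition tensor_quotient ::
  "('k, 'a, 's) module_scheme \<Rightarrow> ('a, 'u) bimod \<Rightarrow> ('a, 'u) bimod \<Rightarrow>
   ('u \<times> 'u \<Rightarrow>\<^sub>0 int) set monoid"
where
  "tensor_quotient A U V = presented_group (carrier U \<times> carrier V) (balanced_rels A U V)"

definition tensor_embedding ::
  "('k, 'a, 's) module_scheme \<Rightarrow> ('a, 'u) bimod \<Rightarrow> ('a, 'u) bimod \<Rightarrow>
   ('u \<times> 'u \<Rightarrow>\<^sub>0 int) set \<Rightarrow> 'u"
where
  "tensor_embedding A U V = (SOME e. inj_on e (carrier (tensor_quotient A U V)))"

lemma inj_on_tensor_embedding:
  fixes U V :: "('a, 'u) bimod"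
  assumes inf: "infinite (UNIV :: 'u set)"
  shows "inj_on (tensor_embedding A U V) (carrier (tensor_quotient A U V))"
proof -
  let ?S = "carrier U \<times> carrier V"
  let ?N = "generate (free_Abelian_group ?S) (balanced_rels A U V)"
  have "carrier (tensor_quotient A U V)
          = (\<lambda>x. ?N #>\<^bsub>free_Abelian_group ?S\<^esub> x) ` carrier (free_Abelian_group ?S)"
    by (auto simp: tensor_quotient_def presented_group_def FactGroup_def RCOSETS_def)
  then have "carrier (tensor_quotient A U V) \<lesssim> carrier (free_Abelian_group ?S)"
    by (simp only: image_lepoll)
  also have "\<dots> \<lesssim> carrier (free_Abelian_group (UNIV :: ('u \<times> 'u) set))"
    by (rule subset_imp_lepoll) auto
  also have "\<dots> \<lesssim> (UNIV :: ('u \<times> 'u) set)"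
    using inf by (intro eqpoll_imp_lepoll eqpoll_free_Abelian_group_infinite)
                 (simp add: finite_prod)
  also have "\<dots> \<lesssim> (UNIV :: 'u set)"
    using card_of_Times_same_infinite[OF inf]
    by (simp add: eqpoll_iff_card_of_ordIso eqpoll_imp_lepoll)
  finally have "\<exists>e :: _ \<Rightarrow> 'u. inj_on e (carrier (tensor_quotient A U V))"
    by (auto simp: lepoll_def)
  then show ?thesis
    unfolding tensor_embedding_def by (rule someI_ex)
qed

definition tensor_group ::
  "('k, 'a, 's) module_scheme \<Rightarrow> ('a, 'u) bimod \<Rightarrow> ('a, 'u) bimod \<Rightarrow> 'u monoid"
where
  "tensor_group A U V = flatten (tensor_quotient A U V) (tensor_embedding A U V)"

definition ptensor ::
  "('k, 'a, 's) module_scheme \<Rightarrow> ('a, 'u) bimod \<Rightarrow> ('a, 'u) bimod \<Rightarrow> 'u \<Rightarrow> 'u \<Rightarrow> 'u"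
where
  "ptensor A U V u v =
     tensor_embedding A U V
       (presented_gen (carrier U \<times> carrier V) (balanced_rels A U V) (u, v))"

definition tensor_lift ::
  "('k, 'a, 's) module_scheme \<Rightarrow> ('a, 'u) bimod \<Rightarrow> ('a, 'u) bimod \<Rightarrow>
   ('g, 'm) monoid_scheme \<Rightarrow> ('u \<Rightarrow> 'u \<Rightarrow> 'g) \<Rightarrow> 'u \<Rightarrow> 'g"
where
  "tensor_lift A U V G f =
     induced_hom (tensor_group A U V) G (carrier U \<times> carrier V)
       (\<lambda>(u, v). ptensor A U V u v) (\<lambda>(u, v). f u v)"

definition bimod_tensor ::
  "('k, 'a, 's) module_scheme \<Rightarrow> ('a, 'u) bimod \<Rightarrow> ('a, 'u) bimod \<Rightarrow> ('a, 'u) bimod"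
where
  "bimod_tensor A U V =
     monoid.extend (tensor_group A U V)
       \<lparr>lact = (\<lambda>a. tensor_lift A U V (tensor_group A U V) (\<lambda>u v. ptensor A U V (lact U a u) v)),
        ract = (\<lambda>t a. tensor_lift A U V (tensor_group A U V) (\<lambda>u v. ptensor A U V u (ract V v a)) t)\<rparr>"

text \<open>\<open>f \<otimes>\<^sub>A g : U \<otimes>\<^sub>A V \<rightarrow> U' \<otimes>\<^sub>A V'\<close>\<close>

definition tensor_map ::
  "('k, 'a, 's) module_scheme \<Rightarrow> ('a, 'u) bimod \<Rightarrow> ('a, 'u) bimod \<Rightarrow>
   ('a, 'u) bimod \<Rightarrow> ('a, 'u) bimod \<Rightarrow> ('u \<Rightarrow> 'u) \<Rightarrow> ('u \<Rightarrow> 'u) \<Rightarrow> 'u \<Rightarrow> 'u"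
where
  "tensor_map A U V U' V' f g =
     tensor_lift A U V (bimod_tensor A U' V') (\<lambda>u v. ptensor A U' V' (f u) (g v))"

text \<open>\<open>(U \<otimes>\<^sub>A V) \<otimes>\<^sub>A W \<rightarrow> U \<otimes>\<^sub>A (V \<otimes>\<^sub>A W)\<close> and its inverse\<close>

definition associator ::
  "('k, 'a, 's) module_scheme \<Rightarrow> ('a, 'u) bimod \<Rightarrow> ('a, 'u) bimod \<Rightarrow> ('a, 'u) bimod \<Rightarrow> 'u \<Rightarrow> 'u"
where
  "associator A U V W =
     tensor_lift A (bimod_tensor A U V) W (bimod_tensor A U (bimod_tensor A V W))
       (\<lambda>t w. tensor_lift A U V (bimod_tensor A U (bimod_tensor A V W))
          (\<lambda>u v. ptensor A U (bimod_tensor A V W) u (ptensor A V W v w)) t)"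

definition associator_inv ::
  "('k, 'a, 's) module_scheme \<Rightarrow> ('a, 'u) bimod \<Rightarrow> ('a, 'u) bimod \<Rightarrow> ('a, 'u) bimod \<Rightarrow> 'u \<Rightarrow> 'u"
where
  "associator_inv A U V W =
     inv_into (carrier (bimod_tensor A (bimod_tensor A U V) W)) (associator A U V W)"

text \<open>In the two hexagon axioms the associators, suppressed in the strict case, are written out
  (the axioms do not involve the unit object). The first is an identity of maps \<open>(U \<otimes> V) \<otimes> W \<rightarrow> V \<otimes> (W \<otimes> U)\<close>, the second of maps
  \<open>U \<otimes> (V \<otimes> W) \<rightarrow> (W \<otimes> U) \<otimes> V\<close>.\<close>

definition braiding ::
  "('k, 'r) ring_scheme \<Rightarrow> ('k, 'a, 's) module_scheme \<Rightarrow>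
   (('a, 'u) bimod \<Rightarrow> ('a, 'u) bimod \<Rightarrow> 'u \<Rightarrow> 'u) \<Rightarrow> bool"
where
  "braiding k A c \<longleftrightarrow>
     (\<forall>U V. bimodule k A U \<and> bimodule k A V \<longrightarrow>
        c U V \<in> bimod_hom A (bimod_tensor A U V) (bimod_tensor A V U) \<and>
        bij_betw (c U V) (carrier (bimod_tensor A U V)) (carrier (bimod_tensor A V U))) \<and>
     (\<forall>U V U' V' f g.
        bimodule k A U \<and> bimodule k A V \<and> bimodule k A U' \<and> bimodule k A V' \<and>
        f \<in> bimod_hom A U U' \<and> g \<in> bimod_hom A V V' \<longrightarrow>
        (\<forall>x\<in>carrier (bimod_tensor A U V).
           c U' V' (tensor_map A U V U' V' f g x) = tensor_map A V U V' U' g f (c U V x))) \<and>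
     (\<forall>U V W. bimodule k A U \<and> bimodule k A V \<and> bimodule k A W \<longrightarrow>
        (\<forall>x\<in>carrier (bimod_tensor A (bimod_tensor A U V) W).
           associator A V W U (c U (bimod_tensor A V W) (associator A U V W x)) =
           tensor_map A V (bimod_tensor A U W) V (bimod_tensor A W U) (\<lambda>v. v) (c U W)
             (associator A V U W
               (tensor_map A (bimod_tensor A U V) W (bimod_tensor A V U) W (c U V) (\<lambda>w. w) x)))) \<and>
     (\<forall>U V W. bimodule k A U \<and> bimodule k A V \<and> bimodule k A W \<longrightarrow>
        (\<forall>x\<in>carrier (bimod_tensor A U (bimod_tensor A V W)).
           associator_inv A W U V (c (bimod_tensor A U V) W (associator_inv A U V W x)) =
           tensor_map A (bimod_tensor A U W) V (bimod_tensor A W U) V (c U W) (\<lambda>v. v)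
             (associator_inv A U W V
               (tensor_map A U (bimod_tensor A V W) U (bimod_tensor A W V) (\<lambda>u. u) (c V W) x))))"

definition symmetry ::
  "('k, 'r) ring_scheme \<Rightarrow> ('k, 'a, 's) module_scheme \<Rightarrow>
   (('a, 'u) bimod \<Rightarrow> ('a, 'u) bimod \<Rightarrow> 'u \<Rightarrow> 'u) \<Rightarrow> bool"
where
  "symmetry k A c \<longleftrightarrow>
     braiding k A c \<and>
     (\<forall>U V. bimodule k A U \<and> bimodule k A V \<longrightarrow>
        (\<forall>y\<in>carrier (bimod_tensor A V U).
           inv_into (carrier (bimod_tensor A U V)) (c U V) y = c V U y))"

end

theory Submission
  imports Defs
begin

text \<open>
  \<^bold>\<open>R-matrices.\<close> Let \<open>R\<close> satisfy \<open>R\<^sup>1 \<otimes> a R\<^sup>2 \<otimes> R\<^sup>3 = R\<^sup>1 \<otimes> R\<^sup>2 \<otimes> R\<^sup>3 a\<close> and let \<open>r\<close> be a second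
  copy of \<open>R\<close>. Moving \<open>a\<close> past \<open>R\<close> and then normalizing gives the two sandwich formulas
  \<open>r\<^sup>1 a r\<^sup>2 \<otimes> r\<^sup>3 = 1 \<otimes> a\<close> (from \<open>R\<^sup>1 R\<^sup>2 \<otimes> R\<^sup>3 = 1 \<otimes> 1\<close>) and \<open>r\<^sup>2 \<otimes> r\<^sup>3 a r\<^sup>1 = a \<otimes> 1\<close>
  (from \<open>R\<^sup>2 \<otimes> R\<^sup>3 R\<^sup>1 = 1 \<otimes> 1\<close>): \<open>contract_sandwich12\<close> and \<open>contract_sandwich31\<close>. Applying the one
  to \<open>r\<close> and the other to \<open>R\<close> in \<open>R\<^sup>3 r\<^sup>1 R\<^sup>1 r\<^sup>2 \<otimes> R\<^sup>2 \<otimes> r\<^sup>3\<close> evaluates this element as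
  \<open>R\<^sup>3 \<otimes> R\<^sup>2 \<otimes> R\<^sup>1\<close> and as \<open>r\<^sup>2 \<otimes> r\<^sup>1 \<otimes> r\<^sup>3\<close>. Hence a normalized element is cyclically invariant
  (\<open>contract_cyclic\<close>), and rotating the given conditions yields the other two exchange rules and the
  third normalization. The two four-fold identities are then rewritings by these rules, and
  \<open>R\<^sup>2 \<otimes> R\<^sup>1 \<otimes> R\<^sup>3\<close> is an inverse of \<open>R\<close> (\<open>flip_mult\<close>, \<open>mult_flip\<close>).

  Conversely, multiplying the two middle factors of the four-fold identities of a canonical R-matrix
  gives \<open>R = (R\<^sup>1 \<otimes> R\<^sup>2 R\<^sup>3 \<otimes> 1) R\<close> and \<open>R = R (1 \<otimes> R\<^sup>1 R\<^sup>2 \<otimes> R\<^sup>3)\<close>. Cancelling \<open>R\<close> gives two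
  of the normalizations. They make \<open>R\<^sup>2 \<otimes> R\<^sup>1 \<otimes> R\<^sup>3\<close> a left inverse of \<open>R\<close>; it is therefore also a
  right inverse, and the product in that order is \<open>1 \<otimes> R\<^sup>2 \<otimes> R\<^sup>3 R\<^sup>1\<close>, which is the remaining one.

  \<^bold>\<open>Braidings.\<close> Let \<open>e = 1 \<otimes> 1\<close> be the generator of the free bimodule \<open>F = A \<otimes> A\<close> and write
  \<open>c(e \<otimes> e)\<close> in \<open>F \<otimes>\<^sub>A F\<close> as a finite sum of terms \<open>x e \<otimes> y e z\<close>. By naturality
  \<open>c(u \<otimes> v) = \<Sum> x v \<otimes> y u z\<close> for all bimodules. The first hexagon with two factors \<open>A\<close> shows that
  \<open>c\<^bsub>U,A\<^esub>\<close> is idempotent after identifying \<open>U \<otimes>\<^sub>A A\<close> and \<open>A \<otimes>\<^sub>A U\<close> with \<open>U\<close>; being injective, it is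
  the canonical map (\<open>c_unit\<close>). Evaluated at \<open>u a \<otimes> 1 = u \<otimes> a\<close> this reads \<open>\<Sum> x a y u z = u a\<close>.
  With a second copy \<open>x', y', z'\<close> of the sum, \<open>c\<^sup>2(u \<otimes> v) = \<Sum> x x' y u z \<otimes> y' v z'
  = \<Sum> u x' \<otimes> y' v z' = u \<otimes> \<Sum> x' y' v z' = u \<otimes> v\<close>, so \<open>c\<close> is a symmetry.
\<close>


section \<open>Groups given by generators and relations\<close>

lemma hom_eq_on_generators:
  assumes h: "group_hom Q G h" and h': "group_hom Q G h'" and T: "T \<subseteq> carrier Q"
    and eq: "\<And>t. t \<in> T \<Longrightarrow> h t = h' t" and x: "x \<in> generate Q T"
  shows "h x = h' x"
proof -
  interpret h: group_hom Q G h by fact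
  interpret h': group_hom Q G h' by fact
  note incl = h.G.generate_in_carrier[OF T]
  show ?thesis using x
    by (induction rule: generate.induct) (use T eq in \<open>auto simp: subset_iff incl\<close>)
qed

lemma hom_free_Abelian_group_minus:
  assumes G: "group G" and h: "h \<in> hom (free_Abelian_group S) G"
    and x: "Poly_Mapping.keys x \<subseteq> S" and y: "Poly_Mapping.keys y \<subseteq> S"
  shows "h (x - y) = h x \<otimes>\<^bsub>G\<^esub> inv\<^bsub>G\<^esub> h y"
proof -
  interpret h: group_hom "free_Abelian_group S" G h
    using G h by (simp add: group_hom_def group_hom_axioms_def)
  show ?thesis
    using h.hom_mult[of x "inv\<^bsub>free_Abelian_group S\<^esub> y"] h.hom_inv[of y]
      h.G.inv_closed[of y] x y by simp
qed

lemma relation_group: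
  "comm_group (presented_group S rels)"
  "s \<in> S \<Longrightarrow> presented_gen S rels s \<in> carrier (presented_group S rels)"
  "generate (presented_group S rels) (presented_gen S rels ` S) = carrier (presented_group S rels)"
  if rels: "rels \<subseteq> carrier (free_Abelian_group S)"
proof -
  let ?F = "free_Abelian_group S" and ?N = "generate (free_Abelian_group S) rels"
  interpret F: comm_group ?F by (rule abelian_free_Abelian_group)
  have sub: "subgroup ?N ?F" by (rule F.generate_is_subgroup[OF rels])
  have norm: "?N \<lhd> ?F" using sub by (simp add: F.normal_iff_subgroup)
  show cg: "comm_group (presented_group S rels)"
    unfolding presented_group_def by (rule F.abelian_FactGroup[OF sub])
  let ?Q = "presented_group S rels" and ?p = "\<lambda>x. ?N #>\<^bsub>?F\<^esub> x"
  interpret Q: comm_group ?Q by (rule cg)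
  have p: "?p \<in> hom ?F ?Q"
    unfolding presented_group_def by (rule normal.r_coset_hom_Mod[OF norm])
  interpret p: group_hom ?F ?Q ?p by unfold_locales (rule p)
  have cQ: "carrier ?Q = ?p ` carrier ?F"
    by (auto simp: presented_group_def FactGroup_def RCOSETS_def)
  show gen: "presented_gen S rels s \<in> carrier ?Q" if "s \<in> S" for s
    unfolding presented_gen_def using that by (intro p.hom_closed) simp
  have T: "presented_gen S rels ` S \<subseteq> carrier ?Q" using gen by blast
  have "?p x \<in> generate ?Q (presented_gen S rels ` S)" if "Poly_Mapping.keys x \<subseteq> S" for x
  proof (rule free_Abelian_group_induct[OF that])
    show "?p 0 \<in> generate ?Q (presented_gen S rels ` S)"
      using p.hom_one generate.one[of ?Q] by simp
  next
    fix x y assume xy: "Poly_Mapping.keys x \<subseteq> S" "Poly_Mapping.keys y \<subseteq> S"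
      and IH: "?p x \<in> generate ?Q (presented_gen S rels ` S)"
        "?p y \<in> generate ?Q (presented_gen S rels ` S)"
    show "?p (x - y) \<in> generate ?Q (presented_gen S rels ` S)"
      unfolding hom_free_Abelian_group_minus[OF Q.group_axioms p xy]
      by (rule generate.eng[OF IH(1) Q.generate_m_inv_closed[OF T IH(2)]])
  next
    fix s assume "s \<in> S"
    then show "?p (frag_of s) \<in> generate ?Q (presented_gen S rels ` S)"
      by (intro generate.incl) (auto simp: presented_gen_def)
  qed
  then show "generate ?Q (presented_gen S rels ` S) = carrier ?Q"
    using Q.generate_incl[OF T] cQ by (auto 0 3)
qed

text \<open>A relation \<open>x - y\<close> may also be read as an equation between two cosets, which is how the bilinearity
  and balancing relations of tensor products are used.\<close>

lemma relation_holds: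
  assumes rels: "rels \<subseteq> carrier (free_Abelian_group S)"
    and x: "Poly_Mapping.keys x \<subseteq> S" and y: "Poly_Mapping.keys y \<subseteq> S" and r: "x - y \<in> rels"
  shows "generate (free_Abelian_group S) rels #>\<^bsub>free_Abelian_group S\<^esub> x =
    generate (free_Abelian_group S) rels #>\<^bsub>free_Abelian_group S\<^esub> y"
proof -
  let ?F = "free_Abelian_group S" and ?N = "generate (free_Abelian_group S) rels"
  interpret F: comm_group ?F by (rule abelian_free_Abelian_group)
  have sub: "subgroup ?N ?F" by (rule F.generate_is_subgroup[OF rels])
  have "x \<otimes>\<^bsub>?F\<^esub> inv\<^bsub>?F\<^esub> y \<in> ?N" using y generate.incl[OF r, of ?F] by simp
  then have "x \<in> ?N #>\<^bsub>?F\<^esub> y"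
    unfolding r_coset_def by (auto intro!: bexI[of _ "x - y"] simp: y)
  then show ?thesis using F.repr_independence[OF _ _ sub] y by auto
qed

lemma relation_mult:
  assumes rels: "rels \<subseteq> carrier (free_Abelian_group S)" and "s \<in> S" "t \<in> S"
  shows "presented_gen S rels s \<otimes>\<^bsub>presented_group S rels\<^esub> presented_gen S rels t =
    generate (free_Abelian_group S) rels #>\<^bsub>free_Abelian_group S\<^esub> (frag_of s + frag_of t)"
proof -
  interpret F: comm_group "free_Abelian_group S" by (rule abelian_free_Abelian_group)
  have norm: "generate (free_Abelian_group S) rels \<lhd> free_Abelian_group S"
    using F.generate_is_subgroup[OF rels] by (simp add: F.normal_iff_subgroup)
  show ?thesis
    using hom_mult[OF normal.r_coset_hom_Mod[OF norm], of "frag_of s" "frag_of t"] assms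
    by (simp add: presented_group_def presented_gen_def)
qed

text \<open>The universal property, for groups that are only isomorphic (by \<open>j\<close>) to a presented group: tensor
  products of bimodules are moved into the ambient type by an embedding, so their generators are
  images under \<open>j\<close> of the generators of the presentation.\<close>

lemma induced_hom:
  assumes rels: "rels \<subseteq> carrier (free_Abelian_group S)"
    and j: "j \<in> iso (presented_group S rels) Q" and Q: "comm_group Q"
    and \<pi>: "\<And>s. s \<in> S \<Longrightarrow> \<pi> s = j (presented_gen S rels s)"
    and G: "comm_group G" and f: "f \<in> S \<rightarrow> carrier G"
    and kills: "\<And>h r. \<lbrakk>h \<in> hom (free_Abelian_group S) G; \<And>s. s \<in> S \<Longrightarrow> h (frag_of s) = f s; r \<in> rels\<rbrakk>
                  \<Longrightarrow> h r = \<one>\<^bsub>G\<^esub>"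
  shows "induced_hom Q G S \<pi> f \<in> hom Q G" (is ?A)
    and "\<And>s. s \<in> S \<Longrightarrow> induced_hom Q G S \<pi> f (\<pi> s) = f s" (is "PROP ?B")
proof -
  let ?P = "presented_group S rels"
  interpret P: comm_group ?P by (rule relation_group[OF rels])
  interpret Q: comm_group Q by (rule Q)
  interpret G: comm_group G by (rule G)
  interpret j: group_hom ?P Q j using j by unfold_locales (simp add: iso_def)
  obtain h0 where h0: "h0 \<in> hom ?P G" "\<And>s. s \<in> S \<Longrightarrow> h0 (presented_gen S rels s) = f s"
    using ex1_implies_ex[OF presented_group_universal[of G f S rels]] G f rels kills by blast
  let ?i = "inv_into (carrier ?P) j"
  have i: "?i \<in> iso Q ?P" by (rule P.iso_set_sym[OF j])
  have bij: "bij_betw j (carrier ?P) (carrier Q)" using j by (simp add: iso_def)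
  define h1 where "h1 = restrict (h0 \<circ> ?i) (carrier Q)"
  have h1: "h1 \<in> hom Q G"
  proof -
    have "h0 \<circ> ?i \<in> hom Q G" using i h0(1) by (intro hom_compose[of _ _ ?P]) (auto simp: iso_def)
    then show ?thesis unfolding h1_def by (auto simp: hom_def)
  qed
  have \<pi>c: "\<pi> s \<in> carrier Q" if "s \<in> S" for s
    using that relation_group(2)[OF rels] by (simp add: \<pi>)
  have h1v: "h1 (\<pi> s) = f s" if "s \<in> S" for s
    using that \<pi>c[OF that] h0(2)[OF that] relation_group(2)[OF rels that] bij
    by (simp add: h1_def \<pi> bij_betw_inv_into_left)
  have span: "generate Q (\<pi> ` S) = carrier Q"
  proof -
    have "\<pi> ` S = j ` (presented_gen S rels ` S)" using \<pi> by (auto simp: image_iff)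
    then show ?thesis
      using j.generate_img[of "presented_gen S rels ` S"] relation_group(2,3)[OF rels] bij
      by (auto simp: bij_betw_def)
  qed
  have "\<exists>!h. h \<in> hom Q G \<and> h \<in> extensional (carrier Q) \<and> (\<forall>s\<in>S. h (\<pi> s) = f s)"
  proof (rule ex1I[of _ h1])
    show "h1 \<in> hom Q G \<and> h1 \<in> extensional (carrier Q) \<and> (\<forall>s\<in>S. h1 (\<pi> s) = f s)"
      using h1 h1v by (simp add: h1_def)
  next
    fix h assume h: "h \<in> hom Q G \<and> h \<in> extensional (carrier Q) \<and> (\<forall>s\<in>S. h (\<pi> s) = f s)"
    show "h = h1"
    proof (rule extensionalityI[of _ "carrier Q"])
      show "h x = h1 x" if "x \<in> carrier Q" for x
        by (rule hom_eq_on_generators[of Q G h h1 "\<pi> ` S"])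
           (use that h h1 h1v \<pi>c span in \<open>auto simp: group_hom_def group_hom_axioms_def
             Q.group_axioms G.group_axioms\<close>)
    qed (use h in \<open>auto simp: h1_def\<close>)
  qed
  from theI'[OF this] show ?A "PROP ?B"
    unfolding induced_hom_def by blast+
qed

section \<open>Multilinear maps and tensor powers\<close>

context assoc_algebra
begin

abbreviation T :: "nat \<Rightarrow> ('a list \<Rightarrow>\<^sub>0 int) set monoid" where
  "T n \<equiv> tpow_group k A n"

text \<open>The last clause moves a scalar from factor \<open>i\<close> to factor \<open>j\<close>. It replaces \<open>k\<close>-linearity because the
  target \<open>G\<close> is only an abelian group.\<close>

definition multilinear :: "nat \<Rightarrow> ('g, 'n) monoid_scheme \<Rightarrow> ('a list \<Rightarrow> 'g) \<Rightarrow> bool" where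
  "multilinear n G f \<longleftrightarrow> f \<in> tuples A n \<rightarrow> carrier G \<and>
     (\<forall>as\<in>tuples A n. \<forall>i<n. \<forall>x\<in>carrier A. \<forall>y\<in>carrier A.
        f (as[i := x \<oplus>\<^bsub>A\<^esub> y]) = f (as[i := x]) \<otimes>\<^bsub>G\<^esub> f (as[i := y])) \<and>
     (\<forall>as\<in>tuples A n. \<forall>i<n. \<forall>j<n. \<forall>c\<in>carrier k.
        f (as[i := c \<odot>\<^bsub>A\<^esub> as ! i]) = f (as[j := c \<odot>\<^bsub>A\<^esub> as ! j]))"

lemma tuples_update: "as \<in> tuples A n \<Longrightarrow> x \<in> carrier A \<Longrightarrow> as[i := x] \<in> tuples A n"
  by (auto simp: tuples_def dest!: set_update_subset_insert[THEN subsetD])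

lemma tuples_nth: "as \<in> tuples A n \<Longrightarrow> i < n \<Longrightarrow> as ! i \<in> carrier A"
  by (auto simp: tuples_def)

lemma tpow_rels_closed: "tpow_rels k A n \<subseteq> carrier (free_Abelian_group (tuples A n))"
  unfolding tpow_rels_def
  by (rule subsetI; elim UnE CollectE exE conjE; hypsubst;
      unfold carrier_free_Abelian_group_iff; intro order_trans[OF keys_diff] Un_least)
     (simp_all add: tuples_update tuples_nth M.a_closed)

lemma comm_group_T: "comm_group (T n)"
  unfolding tpow_group_def by (rule relation_group(1)[OF tpow_rels_closed])

lemma pure_eq: "as \<in> tuples A n \<Longrightarrow> pure k A as = presented_gen (tuples A n) (tpow_rels k A n) as"
  by (simp add: pure_def tuples_def)

lemma pure_closed: "as \<in> tuples A n \<Longrightarrow> pure k A as \<in> carrier (T n)"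
  unfolding tpow_group_def by (simp add: pure_eq relation_group(2)[OF tpow_rels_closed])

lemma T_spanned: "generate (T n) (pure k A ` tuples A n) = carrier (T n)"
  using relation_group(3)[OF tpow_rels_closed, of n] pure_eq[of _ n]
  by (simp add: tpow_group_def cong: image_cong)

lemma multilinear_pure: "multilinear n (T n) (pure k A)"
proof -
  have add: "pure k A (as[i := x \<oplus>\<^bsub>A\<^esub> y]) = pure k A (as[i := x]) \<otimes>\<^bsub>T n\<^esub> pure k A (as[i := y])"
    if as: "as \<in> tuples A n" and i: "i < n" and xy: "x \<in> carrier A" "y \<in> carrier A" for as i x y
  proof -
    note u = tuples_update[OF as]
    have rel: "frag_of (as[i := x \<oplus>\<^bsub>A\<^esub> y]) - frag_of (as[i := x]) - frag_of (as[i := y]) \<in> tpow_rels k A n"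
      unfolding tpow_rels_def using as i xy by blast
    have keys: "Poly_Mapping.keys (frag_of (as[i := x]) + frag_of (as[i := y])) \<subseteq> tuples A n"
      by (intro order_trans[OF keys_add] Un_least) (simp_all add: u xy)
    have "pure k A (as[i := x \<oplus>\<^bsub>A\<^esub> y]) = generate (free_Abelian_group (tuples A n)) (tpow_rels k A n)
        #>\<^bsub>free_Abelian_group (tuples A n)\<^esub> (frag_of (as[i := x]) + frag_of (as[i := y]))"
      unfolding pure_eq[OF u[OF M.a_closed[OF xy]]] presented_gen_def
      by (rule relation_holds[OF tpow_rels_closed])
         (use rel u xy keys in \<open>simp_all add: diff_diff_add M.a_closed\<close>)
    then show ?thesis
      using relation_mult[OF tpow_rels_closed u[OF xy(1)] u[OF xy(2)]]
      by (simp add: tpow_group_def pure_eq[OF u[OF xy(1)]] pure_eq[OF u[OF xy(2)]])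
  qed
  have smult: "pure k A (as[i := c \<odot>\<^bsub>A\<^esub> as ! i]) = pure k A (as[j := c \<odot>\<^bsub>A\<^esub> as ! j])"
    if as: "as \<in> tuples A n" and ij: "i < n" "j < n" and c: "c \<in> carrier k" for as i j c
  proof -
    note u = tuples_update[OF as smult_closed[OF c tuples_nth[OF as]]]
    have rel: "frag_of (as[i := c \<odot>\<^bsub>A\<^esub> as ! i]) - frag_of (as[j := c \<odot>\<^bsub>A\<^esub> as ! j]) \<in> tpow_rels k A n"
      unfolding tpow_rels_def using as ij c by blast
    show ?thesis
      unfolding pure_eq[OF u[OF ij(1)]] pure_eq[OF u[OF ij(2)]] presented_gen_def
      by (rule relation_holds[OF tpow_rels_closed _ _ rel]) (use u[OF ij(1)] u[OF ij(2)] in \<open>auto simp: keys_frag_of\<close>)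
  qed
  show ?thesis
    unfolding multilinear_def
    by (intro conjI ballI allI impI funcsetI pure_closed add smult)
qed

lemma tpow_lift:
  assumes G: "comm_group G" and f: "multilinear n G f"
  shows "tpow_lift k A n G f \<in> hom (T n) G"
    and "as \<in> tuples A n \<Longrightarrow> tpow_lift k A n G f (pure k A as) = f as"
proof -
  interpret G: comm_group G by fact
  have id: "(\<lambda>x. x) \<in> iso (presented_group (tuples A n) (tpow_rels k A n)) (T n)"
    by (auto simp: iso_def hom_def tpow_group_def bij_betw_def)
  have fc: "f as \<in> carrier G" if "as \<in> tuples A n" for as using f that by (auto simp: multilinear_def)
  have kill: "h r = \<one>\<^bsub>G\<^esub>"
    if h: "h \<in> hom (free_Abelian_group (tuples A n)) G" "\<And>s. s \<in> tuples A n \<Longrightarrow> h (frag_of s) = f s"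
      and r: "r \<in> tpow_rels k A n" for h r
  proof -
    note minus = hom_free_Abelian_group_minus[OF G.group_axioms h(1)]
    consider (add) as i x y where "as \<in> tuples A n" "i < n" "x \<in> carrier A" "y \<in> carrier A"
        "r = frag_of (as[i := x \<oplus>\<^bsub>A\<^esub> y]) - frag_of (as[i := x]) - frag_of (as[i := y])"
      | (smult) as i j c where "as \<in> tuples A n" "i < n" "j < n" "c \<in> carrier k"
        "r = frag_of (as[i := c \<odot>\<^bsub>A\<^esub> as ! i]) - frag_of (as[j := c \<odot>\<^bsub>A\<^esub> as ! j])"
      using r unfolding tpow_rels_def by blast
    then show ?thesis
    proof cases
      case add
      note u = tuples_update[OF add(1)]
      have "Poly_Mapping.keys (frag_of (as[i := x \<oplus>\<^bsub>A\<^esub> y]) - frag_of (as[i := x])) \<subseteq> tuples A n"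
        using keys_diff[of "frag_of (as[i := x \<oplus>\<^bsub>A\<^esub> y])" "frag_of (as[i := x])"] u add(3,4)
        by (auto dest: subsetD)
      then show ?thesis
        using f add u by (simp add: minus h(2) multilinear_def fc G.m_comm G.m_assoc[symmetric] G.inv_mult)
    next
      case smult
      note u = tuples_update[OF smult(1)]
      have "h r = f (as[i := c \<odot>\<^bsub>A\<^esub> as ! i]) \<otimes>\<^bsub>G\<^esub> inv\<^bsub>G\<^esub> f (as[j := c \<odot>\<^bsub>A\<^esub> as ! j])"
        using smult u by (simp add: minus h(2) tuples_nth)
      also have "f (as[i := c \<odot>\<^bsub>A\<^esub> as ! i]) = f (as[j := c \<odot>\<^bsub>A\<^esub> as ! j])"
        using f smult unfolding multilinear_def by blast
      finally show ?thesis using smult u by (simp add: fc tuples_nth)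
    qed
  qed
  have fS: "f \<in> tuples A n \<rightarrow> carrier G" using fc by blast
  note * = induced_hom[OF tpow_rels_closed id comm_group_T pure_eq G]
  show "tpow_lift k A n G f \<in> hom (T n) G"
    unfolding tpow_lift_def by (rule *(1)) (assumption, rule fS, erule kill, blast, assumption)
  show "tpow_lift k A n G f (pure k A as) = f as" if "as \<in> tuples A n"
    unfolding tpow_lift_def
    by (rule *(2)) (assumption, rule fS, erule kill, blast, assumption, rule that)
qed

lemma tpow_lift_cong:
  assumes "\<And>as. as \<in> tuples A n \<Longrightarrow> f as = g as"
  shows "tpow_lift k A n G f = tpow_lift k A n G g"
  unfolding tpow_lift_def induced_hom_def using assms by (simp cong: ball_cong)

lemma T_hom_eq:
  assumes "comm_group G" "h \<in> hom (T n) G" "h' \<in> hom (T n) G"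
    and "\<And>as. as \<in> tuples A n \<Longrightarrow> h (pure k A as) = h' (pure k A as)" and "X \<in> carrier (T n)"
  shows "h X = h' X"
proof (rule hom_eq_on_generators[of "T n" G h h' "pure k A ` tuples A n"])
  show "group_hom (T n) G h" "group_hom (T n) G h'"
    using assms(1-3) comm_group_T[of n]
    by (auto simp: group_hom_def group_hom_axioms_def comm_group_def)
qed (use assms pure_closed T_spanned in auto)


section \<open>Sweedler notation\<close>

text \<open>In the curried forms a scalar is always moved to the first factor, so that the clauses terminate as
  rewrite rules.\<close>

definition bilinear :: "('g, 'n) monoid_scheme \<Rightarrow> ('a \<Rightarrow> 'a \<Rightarrow> 'g) \<Rightarrow> bool" where
  "bilinear G f \<longleftrightarrow>
     (\<forall>x\<in>carrier A. \<forall>y\<in>carrier A. f x y \<in> carrier G) \<and>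
     (\<forall>x\<in>carrier A. \<forall>x'\<in>carrier A. \<forall>y\<in>carrier A.
        f (x \<oplus>\<^bsub>A\<^esub> x') y = f x y \<otimes>\<^bsub>G\<^esub> f x' y \<and> f y (x \<oplus>\<^bsub>A\<^esub> x') = f y x \<otimes>\<^bsub>G\<^esub> f y x') \<and>
     (\<forall>c\<in>carrier k. \<forall>x\<in>carrier A. \<forall>y\<in>carrier A. f x (c \<odot>\<^bsub>A\<^esub> y) = f (c \<odot>\<^bsub>A\<^esub> x) y)"

definition trilinear :: "('g, 'n) monoid_scheme \<Rightarrow> ('a \<Rightarrow> 'a \<Rightarrow> 'a \<Rightarrow> 'g) \<Rightarrow> bool" where
  "trilinear G f \<longleftrightarrow> (\<forall>a\<in>carrier A. bilinear G (f a) \<and>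
     bilinear G (\<lambda>x y. f x a y) \<and> bilinear G (\<lambda>x y. f x y a))"

lemma bilinearI:
  assumes "\<And>x y. \<lbrakk>x \<in> carrier A; y \<in> carrier A\<rbrakk> \<Longrightarrow> f x y \<in> carrier G"
    and "\<And>x x' y. \<lbrakk>x \<in> carrier A; x' \<in> carrier A; y \<in> carrier A\<rbrakk>
           \<Longrightarrow> f (x \<oplus>\<^bsub>A\<^esub> x') y = f x y \<otimes>\<^bsub>G\<^esub> f x' y"
    and "\<And>x x' y. \<lbrakk>x \<in> carrier A; x' \<in> carrier A; y \<in> carrier A\<rbrakk>
           \<Longrightarrow> f y (x \<oplus>\<^bsub>A\<^esub> x') = f y x \<otimes>\<^bsub>G\<^esub> f y x'"
    and "\<And>c x y. \<lbrakk>c \<in> carrier k; x \<in> carrier A; y \<in> carrier A\<rbrakk>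
           \<Longrightarrow> f x (c \<odot>\<^bsub>A\<^esub> y) = f (c \<odot>\<^bsub>A\<^esub> x) y"
  shows "bilinear G f"
  unfolding bilinear_def by (intro conjI ballI assms)

lemma bilinearD:
  assumes "bilinear G f"
  shows "\<And>x y. \<lbrakk>x \<in> carrier A; y \<in> carrier A\<rbrakk> \<Longrightarrow> f x y \<in> carrier G"
    and "\<And>x x' y. \<lbrakk>x \<in> carrier A; x' \<in> carrier A; y \<in> carrier A\<rbrakk>
           \<Longrightarrow> f (x \<oplus>\<^bsub>A\<^esub> x') y = f x y \<otimes>\<^bsub>G\<^esub> f x' y"
    and "\<And>x x' y. \<lbrakk>x \<in> carrier A; x' \<in> carrier A; y \<in> carrier A\<rbrakk>
           \<Longrightarrow> f y (x \<oplus>\<^bsub>A\<^esub> x') = f y x \<otimes>\<^bsub>G\<^esub> f y x'"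
    and "\<And>c x y. \<lbrakk>c \<in> carrier k; x \<in> carrier A; y \<in> carrier A\<rbrakk>
           \<Longrightarrow> f x (c \<odot>\<^bsub>A\<^esub> y) = f (c \<odot>\<^bsub>A\<^esub> x) y"
  using assms unfolding bilinear_def by blast+

lemma trilinearI:
  assumes "\<And>x y z. \<lbrakk>x \<in> carrier A; y \<in> carrier A; z \<in> carrier A\<rbrakk> \<Longrightarrow> f x y z \<in> carrier G"
    and "\<And>x x' y z. \<lbrakk>x \<in> carrier A; x' \<in> carrier A; y \<in> carrier A; z \<in> carrier A\<rbrakk>
           \<Longrightarrow> f (x \<oplus>\<^bsub>A\<^esub> x') y z = f x y z \<otimes>\<^bsub>G\<^esub> f x' y z"
    and "\<And>x y y' z. \<lbrakk>x \<in> carrier A; y \<in> carrier A; y' \<in> carrier A; z \<in> carrier A\<rbrakk>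
           \<Longrightarrow> f x (y \<oplus>\<^bsub>A\<^esub> y') z = f x y z \<otimes>\<^bsub>G\<^esub> f x y' z"
    and "\<And>x y z z'. \<lbrakk>x \<in> carrier A; y \<in> carrier A; z \<in> carrier A; z' \<in> carrier A\<rbrakk>
           \<Longrightarrow> f x y (z \<oplus>\<^bsub>A\<^esub> z') = f x y z \<otimes>\<^bsub>G\<^esub> f x y z'"
    and "\<And>c x y z. \<lbrakk>c \<in> carrier k; x \<in> carrier A; y \<in> carrier A; z \<in> carrier A\<rbrakk>
           \<Longrightarrow> f x (c \<odot>\<^bsub>A\<^esub> y) z = f (c \<odot>\<^bsub>A\<^esub> x) y z"
    and "\<And>c x y z. \<lbrakk>c \<in> carrier k; x \<in> carrier A; y \<in> carrier A; z \<in> carrier A\<rbrakk>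
           \<Longrightarrow> f x y (c \<odot>\<^bsub>A\<^esub> z) = f (c \<odot>\<^bsub>A\<^esub> x) y z"
  shows "trilinear G f"
  unfolding trilinear_def by (auto intro!: bilinearI simp: assms)

lemma trilinearD:
  assumes "trilinear G f"
  shows "\<And>x y z. \<lbrakk>x \<in> carrier A; y \<in> carrier A; z \<in> carrier A\<rbrakk> \<Longrightarrow> f x y z \<in> carrier G"
    and "\<And>x x' y z. \<lbrakk>x \<in> carrier A; x' \<in> carrier A; y \<in> carrier A; z \<in> carrier A\<rbrakk>
           \<Longrightarrow> f (x \<oplus>\<^bsub>A\<^esub> x') y z = f x y z \<otimes>\<^bsub>G\<^esub> f x' y z"
    and "\<And>x y y' z. \<lbrakk>x \<in> carrier A; y \<in> carrier A; y' \<in> carrier A; z \<in> carrier A\<rbrakk>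
           \<Longrightarrow> f x (y \<oplus>\<^bsub>A\<^esub> y') z = f x y z \<otimes>\<^bsub>G\<^esub> f x y' z"
    and "\<And>x y z z'. \<lbrakk>x \<in> carrier A; y \<in> carrier A; z \<in> carrier A; z' \<in> carrier A\<rbrakk>
           \<Longrightarrow> f x y (z \<oplus>\<^bsub>A\<^esub> z') = f x y z \<otimes>\<^bsub>G\<^esub> f x y z'"
    and "\<And>c x y z. \<lbrakk>c \<in> carrier k; x \<in> carrier A; y \<in> carrier A; z \<in> carrier A\<rbrakk>
           \<Longrightarrow> f x (c \<odot>\<^bsub>A\<^esub> y) z = f (c \<odot>\<^bsub>A\<^esub> x) y z"
    and "\<And>c x y z. \<lbrakk>c \<in> carrier k; x \<in> carrier A; y \<in> carrier A; z \<in> carrier A\<rbrakk>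
           \<Longrightarrow> f x y (c \<odot>\<^bsub>A\<^esub> z) = f (c \<odot>\<^bsub>A\<^esub> x) y z"
  using assms unfolding trilinear_def bilinear_def by blast+

lemma tuples_Suc: "as \<in> tuples A (Suc n) \<longleftrightarrow> (\<exists>a\<in>carrier A. \<exists>bs\<in>tuples A n. as = a # bs)"
  by (auto simp: tuples_def length_Suc_conv)

lemma tuples_0: "as \<in> tuples A 0 \<longleftrightarrow> as = []"
  by (auto simp: tuples_def)

lemmas tuples_simps = tuples_Suc tuples_0 numeral_eq_Suc

lemma multilinear_curry2:
  assumes "bilinear G f" shows "multilinear 2 G (\<lambda>as. f (as ! 0) (as ! 1))"
  unfolding multilinear_def
  by (auto simp: tuples_simps less_Suc_eq bilinearD[OF assms] smult_closed)

lemma multilinear_curry3: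
  assumes "trilinear G f" shows "multilinear 3 G (\<lambda>as. f (as ! 0) (as ! 1) (as ! 2))"
  unfolding multilinear_def
  by (auto simp: tuples_simps less_Suc_eq trilinearD[OF assms] smult_closed)

lemma pure2:
  assumes "x \<in> carrier A" "y \<in> carrier A"
  shows "pure k A [x, y] \<in> carrier (T 2)"
    and "x' \<in> carrier A \<Longrightarrow> pure k A [x \<oplus>\<^bsub>A\<^esub> x', y] = pure k A [x, y] \<otimes>\<^bsub>T 2\<^esub> pure k A [x', y]"
    and "y' \<in> carrier A \<Longrightarrow> pure k A [x, y \<oplus>\<^bsub>A\<^esub> y'] = pure k A [x, y] \<otimes>\<^bsub>T 2\<^esub> pure k A [x, y']"
    and "c \<in> carrier k \<Longrightarrow> pure k A [x, c \<odot>\<^bsub>A\<^esub> y] = pure k A [c \<odot>\<^bsub>A\<^esub> x, y]"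
proof -
  have as: "[x, y] \<in> tuples A 2" using assms by (simp add: tuples_simps)
  then show "pure k A [x, y] \<in> carrier (T 2)" by (rule pure_closed)
  note m = multilinear_pure[of 2, unfolded multilinear_def]
  note add = m[THEN conjunct2, THEN conjunct1, THEN bspec, OF as, rule_format]
  note smult = m[THEN conjunct2, THEN conjunct2, THEN bspec, OF as, rule_format]
  show "pure k A [x \<oplus>\<^bsub>A\<^esub> x', y] = pure k A [x, y] \<otimes>\<^bsub>T 2\<^esub> pure k A [x', y]" if "x' \<in> carrier A"
    using add[of 0 x x'] that assms by simp
  show "pure k A [x, y \<oplus>\<^bsub>A\<^esub> y'] = pure k A [x, y] \<otimes>\<^bsub>T 2\<^esub> pure k A [x, y']" if "y' \<in> carrier A"
    using add[of 1 y y'] that assms by simp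
  show "pure k A [x, c \<odot>\<^bsub>A\<^esub> y] = pure k A [c \<odot>\<^bsub>A\<^esub> x, y]" if "c \<in> carrier k"
    using smult[of 1 0 c] that assms by simp
qed

lemma pure3:
  assumes "x \<in> carrier A" "y \<in> carrier A" "z \<in> carrier A"
  shows "pure k A [x, y, z] \<in> carrier (T 3)"
    and "x' \<in> carrier A \<Longrightarrow> pure k A [x \<oplus>\<^bsub>A\<^esub> x', y, z] = pure k A [x, y, z] \<otimes>\<^bsub>T 3\<^esub> pure k A [x', y, z]"
    and "y' \<in> carrier A \<Longrightarrow> pure k A [x, y \<oplus>\<^bsub>A\<^esub> y', z] = pure k A [x, y, z] \<otimes>\<^bsub>T 3\<^esub> pure k A [x, y', z]"
    and "z' \<in> carrier A \<Longrightarrow> pure k A [x, y, z \<oplus>\<^bsub>A\<^esub> z'] = pure k A [x, y, z] \<otimes>\<^bsub>T 3\<^esub> pure k A [x, y, z']"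
    and "c \<in> carrier k \<Longrightarrow> pure k A [x, c \<odot>\<^bsub>A\<^esub> y, z] = pure k A [c \<odot>\<^bsub>A\<^esub> x, y, z]"
    and "c \<in> carrier k \<Longrightarrow> pure k A [x, y, c \<odot>\<^bsub>A\<^esub> z] = pure k A [c \<odot>\<^bsub>A\<^esub> x, y, z]"
proof -
  have as: "[x, y, z] \<in> tuples A 3" using assms by (simp add: tuples_simps)
  then show "pure k A [x, y, z] \<in> carrier (T 3)" by (rule pure_closed)
  note m = multilinear_pure[of 3, unfolded multilinear_def]
  note add = m[THEN conjunct2, THEN conjunct1, THEN bspec, OF as, rule_format]
  note smult = m[THEN conjunct2, THEN conjunct2, THEN bspec, OF as, rule_format]
  show "pure k A [x \<oplus>\<^bsub>A\<^esub> x', y, z] = pure k A [x, y, z] \<otimes>\<^bsub>T 3\<^esub> pure k A [x', y, z]" if "x' \<in> carrier A"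
    using add[of 0 x x'] that assms by simp
  show "pure k A [x, y \<oplus>\<^bsub>A\<^esub> y', z] = pure k A [x, y, z] \<otimes>\<^bsub>T 3\<^esub> pure k A [x, y', z]" if "y' \<in> carrier A"
    using add[of 1 y y'] that assms by simp
  show "pure k A [x, y, z \<oplus>\<^bsub>A\<^esub> z'] = pure k A [x, y, z] \<otimes>\<^bsub>T 3\<^esub> pure k A [x, y, z']" if "z' \<in> carrier A"
    using add[of 2 z z'] that assms by (simp add: numeral_2_eq_2)
  show "pure k A [x, c \<odot>\<^bsub>A\<^esub> y, z] = pure k A [c \<odot>\<^bsub>A\<^esub> x, y, z]" if "c \<in> carrier k"
    using smult[of 1 0 c] that assms by simp
  show "pure k A [x, y, c \<odot>\<^bsub>A\<^esub> z] = pure k A [c \<odot>\<^bsub>A\<^esub> x, y, z]" if "c \<in> carrier k"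
    using smult[of 2 0 c] that assms by (simp add: numeral_2_eq_2)
qed

lemma pure4:
  assumes "x \<in> carrier A" "y \<in> carrier A" "z \<in> carrier A" "w \<in> carrier A"
  shows "pure k A [x, y, z, w] \<in> carrier (T 4)"
    and "x' \<in> carrier A \<Longrightarrow> pure k A [x \<oplus>\<^bsub>A\<^esub> x', y, z, w] = pure k A [x, y, z, w] \<otimes>\<^bsub>T 4\<^esub> pure k A [x', y, z, w]"
    and "y' \<in> carrier A \<Longrightarrow> pure k A [x, y \<oplus>\<^bsub>A\<^esub> y', z, w] = pure k A [x, y, z, w] \<otimes>\<^bsub>T 4\<^esub> pure k A [x, y', z, w]"
    and "z' \<in> carrier A \<Longrightarrow> pure k A [x, y, z \<oplus>\<^bsub>A\<^esub> z', w] = pure k A [x, y, z, w] \<otimes>\<^bsub>T 4\<^esub> pure k A [x, y, z', w]"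
    and "w' \<in> carrier A \<Longrightarrow> pure k A [x, y, z, w \<oplus>\<^bsub>A\<^esub> w'] = pure k A [x, y, z, w] \<otimes>\<^bsub>T 4\<^esub> pure k A [x, y, z, w']"
    and "c \<in> carrier k \<Longrightarrow> pure k A [x, c \<odot>\<^bsub>A\<^esub> y, z, w] = pure k A [c \<odot>\<^bsub>A\<^esub> x, y, z, w]"
    and "c \<in> carrier k \<Longrightarrow> pure k A [x, y, c \<odot>\<^bsub>A\<^esub> z, w] = pure k A [c \<odot>\<^bsub>A\<^esub> x, y, z, w]"
    and "c \<in> carrier k \<Longrightarrow> pure k A [x, y, z, c \<odot>\<^bsub>A\<^esub> w] = pure k A [c \<odot>\<^bsub>A\<^esub> x, y, z, w]"
proof -
  have as: "[x, y, z, w] \<in> tuples A 4" using assms by (simp add: tuples_simps)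
  then show "pure k A [x, y, z, w] \<in> carrier (T 4)" by (rule pure_closed)
  note m = multilinear_pure[of 4, unfolded multilinear_def]
  note add = m[THEN conjunct2, THEN conjunct1, THEN bspec, OF as, rule_format]
  note smult = m[THEN conjunct2, THEN conjunct2, THEN bspec, OF as, rule_format]
  show "pure k A [x \<oplus>\<^bsub>A\<^esub> x', y, z, w] = pure k A [x, y, z, w] \<otimes>\<^bsub>T 4\<^esub> pure k A [x', y, z, w]" if "x' \<in> carrier A"
    using add[of 0 x x'] that assms by simp
  show "pure k A [x, y \<oplus>\<^bsub>A\<^esub> y', z, w] = pure k A [x, y, z, w] \<otimes>\<^bsub>T 4\<^esub> pure k A [x, y', z, w]" if "y' \<in> carrier A"
    using add[of 1 y y'] that assms by simp
  show "pure k A [x, y, z \<oplus>\<^bsub>A\<^esub> z', w] = pure k A [x, y, z, w] \<otimes>\<^bsub>T 4\<^esub> pure k A [x, y, z', w]" if "z' \<in> carrier A"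
    using add[of 2 z z'] that assms by (simp add: numeral_2_eq_2)
  show "pure k A [x, y, z, w \<oplus>\<^bsub>A\<^esub> w'] = pure k A [x, y, z, w] \<otimes>\<^bsub>T 4\<^esub> pure k A [x, y, z, w']" if "w' \<in> carrier A"
    using add[of 3 w w'] that assms by (simp add: numeral_3_eq_3)
  show "pure k A [x, c \<odot>\<^bsub>A\<^esub> y, z, w] = pure k A [c \<odot>\<^bsub>A\<^esub> x, y, z, w]" if "c \<in> carrier k"
    using smult[of 1 0 c] that assms by simp
  show "pure k A [x, y, c \<odot>\<^bsub>A\<^esub> z, w] = pure k A [c \<odot>\<^bsub>A\<^esub> x, y, z, w]" if "c \<in> carrier k"
    using smult[of 2 0 c] that assms by (simp add: numeral_2_eq_2)
  show "pure k A [x, y, z, c \<odot>\<^bsub>A\<^esub> w] = pure k A [c \<odot>\<^bsub>A\<^esub> x, y, z, w]" if "c \<in> carrier k"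
    using smult[of 3 0 c] that assms by (simp add: numeral_3_eq_3)
qed

lemmas linear_simps = A.l_distr A.r_distr smult_mult_left smult_mult_right A.m_assoc
  pure2 pure3 pure4

lemma trilinear_pure: "trilinear (T 3) (\<lambda>x y z. pure k A [x, y, z])"
  by (rule trilinearI) (simp_all add: pure3)

text \<open>\<open>contract G f R\<close> is \<open>f R\<^sup>1 R\<^sup>2 R\<^sup>3\<close> in Sweedler notation, summed in \<open>G\<close>. Both Sweedler operators are
  instances, and nested contractions model expressions in several copies of \<open>R\<close>.\<close>

definition contract ::
  "('g, 'n) monoid_scheme \<Rightarrow> ('a \<Rightarrow> 'a \<Rightarrow> 'a \<Rightarrow> 'g) \<Rightarrow> ('a list \<Rightarrow>\<^sub>0 int) set \<Rightarrow> 'g" where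
  "contract G f R = tpow_lift k A 3 G (\<lambda>as. f (as ! 0) (as ! 1) (as ! 2)) R"

lemma sweedler_eq_contract:
  "sweedler k A m R F = contract (T m) (\<lambda>x y z. pure k A (F x y z)) R"
  "sweedler2 k A m r R F' =
     contract (T m) (\<lambda>x y z. contract (T m) (\<lambda>x' y' z'. pure k A (F' x y z x' y' z')) R) r"
  by (simp_all add: sweedler_def sweedler2_def contract_def)

lemma contract_cong:
  assumes "\<And>x y z. \<lbrakk>x \<in> carrier A; y \<in> carrier A; z \<in> carrier A\<rbrakk> \<Longrightarrow> f x y z = g x y z"
  shows "contract G f R = contract G g R"
  unfolding contract_def
  by (rule fun_cong[OF tpow_lift_cong]) (use assms in \<open>auto simp: tuples_simps\<close>)

lemma contract_hom: "comm_group G \<Longrightarrow> trilinear G f \<Longrightarrow> contract G f \<in> hom (T 3) G"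
  unfolding contract_def[abs_def] by (intro tpow_lift multilinear_curry3)

lemma contract_closed:
  "comm_group G \<Longrightarrow> trilinear G f \<Longrightarrow> R \<in> carrier (T 3) \<Longrightarrow> contract G f R \<in> carrier G"
  using contract_hom by (rule hom_in_carrier)

lemma contract_pure:
  assumes "comm_group G" "trilinear G f" "x \<in> carrier A" "y \<in> carrier A" "z \<in> carrier A"
  shows "contract G f (pure k A [x, y, z]) = f x y z"
  unfolding contract_def
  by (subst tpow_lift(2)[OF assms(1) multilinear_curry3[OF assms(2)]]) (use assms in \<open>simp_all add: tuples_simps\<close>)

lemma T3_hom_eq:
  assumes "comm_group G" "h \<in> hom (T 3) G" "h' \<in> hom (T 3) G"
    and "\<And>x y z. \<lbrakk>x \<in> carrier A; y \<in> carrier A; z \<in> carrier A\<rbrakk>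
           \<Longrightarrow> h (pure k A [x, y, z]) = h' (pure k A [x, y, z])" and "X \<in> carrier (T 3)"
  shows "h X = h' X"
  by (rule T_hom_eq[OF assms(1-3) _ assms(5)]) (use assms(4) in \<open>auto simp: tuples_simps\<close>)

text \<open>Homomorphisms may be applied inside a Sweedler sum. This turns an equation between elements of a
  tensor power into an equation between the contractions with any multilinear map.\<close>

lemma contract_comp:
  assumes G: "comm_group G" and H: "comm_group H" and h: "h \<in> hom G H" and f: "trilinear G f"
    and g: "\<And>x y z. \<lbrakk>x \<in> carrier A; y \<in> carrier A; z \<in> carrier A\<rbrakk> \<Longrightarrow> h (f x y z) = g x y z"
    and R: "R \<in> carrier (T 3)"
  shows "h (contract G f R) = contract H g R"
proof -
  have hf: "trilinear H (\<lambda>x y z. h (f x y z))"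
    using h by (intro trilinearI)
      (simp_all add: trilinearD[OF f] hom_in_carrier[OF h] hom_mult[OF h])
  have "h (contract G f R) = contract H (\<lambda>x y z. h (f x y z)) R"
    using T3_hom_eq[OF H hom_compose[OF contract_hom[OF G f] h] contract_hom[OF H hf] _ R]
    by (simp add: contract_pure[OF G f] contract_pure[OF H hf])
  also have "\<dots> = contract H g R" by (rule contract_cong) (rule g)
  finally show ?thesis .
qed

lemma contract_mult:
  assumes G: "comm_group G" and f: "trilinear G f" and g: "trilinear G g" and R: "R \<in> carrier (T 3)"
  shows "contract G (\<lambda>x y z. f x y z \<otimes>\<^bsub>G\<^esub> g x y z) R = contract G f R \<otimes>\<^bsub>G\<^esub> contract G g R"
proof -
  interpret G: comm_group G by fact
  interpret T: comm_group "T 3" by (rule comm_group_T)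
  note [simp] = hom_in_carrier[OF contract_hom[OF G f]] hom_in_carrier[OF contract_hom[OF G g]]
    hom_mult[OF contract_hom[OF G f]] hom_mult[OF contract_hom[OF G g]]
  have h: "(\<lambda>X. contract G f X \<otimes>\<^bsub>G\<^esub> contract G g X) \<in> hom (T 3) G"
    by (rule homI) (simp_all add: G.m_ac)
  have fg: "trilinear G (\<lambda>x y z. f x y z \<otimes>\<^bsub>G\<^esub> g x y z)"
    by (rule trilinearI) (simp_all add: trilinearD[OF f] trilinearD[OF g] G.m_ac)
  show ?thesis
    by (rule T3_hom_eq[OF G contract_hom[OF G fg] h _ R])
       (simp add: contract_pure[OF G f] contract_pure[OF G g] contract_pure[OF G fg])
qed

lemma trilinear_contract:
  assumes G: "comm_group G"
    and f: "\<And>x y z. \<lbrakk>x \<in> carrier A; y \<in> carrier A; z \<in> carrier A\<rbrakk> \<Longrightarrow> trilinear G (f x y z)"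
    and f': "\<And>x y z. \<lbrakk>x \<in> carrier A; y \<in> carrier A; z \<in> carrier A\<rbrakk>
               \<Longrightarrow> trilinear G (\<lambda>x' y' z'. f x' y' z' x y z)"
    and R: "R \<in> carrier (T 3)"
  shows "trilinear G (\<lambda>x y z. contract G (f x y z) R)"
  by (rule trilinearI)
     (simp_all add: contract_closed[OF G f R] contract_mult[OF G f f R, symmetric]
       trilinearD(2-)[OF f'] cong: contract_cong)

text \<open>Summations over \<open>R\<close> and \<open>r\<close> commute: both sides are additive in \<open>R\<close>, and for a pure tensor \<open>R\<close>
  they coincide. A rule about one copy can thus be applied with the other copy held fixed.\<close>

lemma contract_swap:
  assumes G: "comm_group G"
    and f: "\<And>x y z. \<lbrakk>x \<in> carrier A; y \<in> carrier A; z \<in> carrier A\<rbrakk> \<Longrightarrow> trilinear G (f x y z)"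
    and f': "\<And>x y z. \<lbrakk>x \<in> carrier A; y \<in> carrier A; z \<in> carrier A\<rbrakk>
               \<Longrightarrow> trilinear G (\<lambda>x' y' z'. f x' y' z' x y z)"
    and R: "R \<in> carrier (T 3)" and r: "r \<in> carrier (T 3)"
  shows "contract G (\<lambda>x y z. contract G (f x y z) r) R =
         contract G (\<lambda>x' y' z'. contract G (\<lambda>x y z. f x y z x' y' z') R) r"
proof -
  note tri = trilinear_contract[OF G f f' r]
  note tri' = trilinear_contract[OF G f' f]
  have hom: "(\<lambda>R. contract G (\<lambda>x' y' z'. contract G (\<lambda>x y z. f x y z x' y' z') R) r) \<in> hom (T 3) G"
    by (rule homI)
       (simp_all add: contract_closed[OF G tri' r] contract_mult[OF G tri' tri' r, symmetric]
         hom_mult[OF contract_hom[OF G f']] cong: contract_cong)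
  show ?thesis
    by (rule T3_hom_eq[OF G contract_hom[OF G tri] hom _ R])
       (simp_all add: contract_pure[OF G tri] contract_pure[OF G f'] cong: contract_cong)
qed

lemma contract_id:
  assumes R: "R \<in> carrier (T 3)"
  shows "contract (T 3) (\<lambda>x y z. pure k A [x, y, z]) R = R"
proof -
  have "(\<lambda>X. X) \<in> hom (T 3) (T 3)" by (simp add: hom_def)
  from T3_hom_eq[OF comm_group_T contract_hom[OF comm_group_T trilinear_pure] this _ R]
  show ?thesis by (simp add: contract_pure[OF comm_group_T trilinear_pure])
qed

lemma contract_contract:
  assumes G: "comm_group G" and g: "trilinear G g" and R: "R \<in> carrier (T 3)"
    and abc: "trilinear (T 3) (\<lambda>x y z. pure k A [a x y z, b x y z, c x y z])"
    and cl: "\<And>x y z. \<lbrakk>x \<in> carrier A; y \<in> carrier A; z \<in> carrier A\<rbrakk>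
           \<Longrightarrow> a x y z \<in> carrier A \<and> b x y z \<in> carrier A \<and> c x y z \<in> carrier A"
  shows "contract G g (contract (T 3) (\<lambda>x y z. pure k A [a x y z, b x y z, c x y z]) R) =
    contract G (\<lambda>x y z. g (a x y z) (b x y z) (c x y z)) R"
  by (rule contract_comp[OF comm_group_T G contract_hom[OF G g] abc _ R])
     (simp add: contract_pure[OF G g] cl)

section \<open>The conditions on an R-matrix as rewriting rules\<close>

abbreviation mult_A (infixl "\<cdot>" 70) where "x \<cdot> y \<equiv> x \<otimes>\<^bsub>A\<^esub> y"

text \<open>The exchange rules move an element of \<open>A\<close> between two factors, the normalizations evaluate the
  product of two factors. The two digits name the factors that are involved.\<close>

definition exchange31 :: "('a list \<Rightarrow>\<^sub>0 int) set \<Rightarrow> bool" where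
  "exchange31 R \<longleftrightarrow> (\<forall>a\<in>carrier A. sweedler k A 3 R (\<lambda>x y z. [x, y, a \<cdot> z]) =
                                  sweedler k A 3 R (\<lambda>x y z. [x \<cdot> a, y, z]))"

definition exchange12 :: "('a list \<Rightarrow>\<^sub>0 int) set \<Rightarrow> bool" where
  "exchange12 R \<longleftrightarrow> (\<forall>a\<in>carrier A. sweedler k A 3 R (\<lambda>x y z. [a \<cdot> x, y, z]) =
                                  sweedler k A 3 R (\<lambda>x y z. [x, y \<cdot> a, z]))"

definition exchange23 :: "('a list \<Rightarrow>\<^sub>0 int) set \<Rightarrow> bool" where
  "exchange23 R \<longleftrightarrow> (\<forall>a\<in>carrier A. sweedler k A 3 R (\<lambda>x y z. [x, a \<cdot> y, z]) =
                                  sweedler k A 3 R (\<lambda>x y z. [x, y, z \<cdot> a]))"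

definition normal12 :: "('a list \<Rightarrow>\<^sub>0 int) set \<Rightarrow> bool" where
  "normal12 R \<longleftrightarrow> sweedler k A 2 R (\<lambda>x y z. [x \<cdot> y, z]) = pure k A [\<one>\<^bsub>A\<^esub>, \<one>\<^bsub>A\<^esub>]"

definition normal31 :: "('a list \<Rightarrow>\<^sub>0 int) set \<Rightarrow> bool" where
  "normal31 R \<longleftrightarrow> sweedler k A 2 R (\<lambda>x y z. [y, z \<cdot> x]) = pure k A [\<one>\<^bsub>A\<^esub>, \<one>\<^bsub>A\<^esub>]"

definition normal23 :: "('a list \<Rightarrow>\<^sub>0 int) set \<Rightarrow> bool" where
  "normal23 R \<longleftrightarrow> sweedler k A 2 R (\<lambda>x y z. [x, y \<cdot> z]) = pure k A [\<one>\<^bsub>A\<^esub>, \<one>\<^bsub>A\<^esub>]"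

lemma
  assumes G: "comm_group G" and f: "trilinear G f" and a: "a \<in> carrier A" and R: "R \<in> carrier (T 3)"
  shows contract_exchange12: "exchange12 R \<Longrightarrow>
      contract G (\<lambda>x y z. f (a \<cdot> x) y z) R = contract G (\<lambda>x y z. f x (y \<cdot> a) z) R"
    and contract_exchange23: "exchange23 R \<Longrightarrow>
      contract G (\<lambda>x y z. f x (a \<cdot> y) z) R = contract G (\<lambda>x y z. f x y (z \<cdot> a)) R"
proof -
  have tri: "trilinear (T 3) (\<lambda>x y z. pure k A [x, a \<cdot> y, z])"
    "trilinear (T 3) (\<lambda>x y z. pure k A [a \<cdot> x, y, z])"
    "trilinear (T 3) (\<lambda>x y z. pure k A [x, y, z \<cdot> a])"
    "trilinear (T 3) (\<lambda>x y z. pure k A [x, y \<cdot> a, z])"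
    using a by (auto intro!: trilinearI simp: linear_simps)
  note c = contract_contract[OF G f R, symmetric]
  show "exchange12 R \<Longrightarrow>
      contract G (\<lambda>x y z. f (a \<cdot> x) y z) R = contract G (\<lambda>x y z. f x (y \<cdot> a) z) R"
    using a by (simp add: c[OF tri(2)] c[OF tri(4)] exchange12_def sweedler_eq_contract)
  show "exchange23 R \<Longrightarrow>
      contract G (\<lambda>x y z. f x (a \<cdot> y) z) R = contract G (\<lambda>x y z. f x y (z \<cdot> a)) R"
    using a by (simp add: c[OF tri(1)] c[OF tri(3)] exchange23_def sweedler_eq_contract)
qed

lemma
  assumes G: "comm_group G" and g: "bilinear G g" and R: "R \<in> carrier (T 3)"
  shows contract_normal12: "normal12 R \<Longrightarrow> contract G (\<lambda>x y z. g (x \<cdot> y) z) R = g \<one>\<^bsub>A\<^esub> \<one>\<^bsub>A\<^esub>"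
    and contract_normal31: "normal31 R \<Longrightarrow> contract G (\<lambda>x y z. g y (z \<cdot> x)) R = g \<one>\<^bsub>A\<^esub> \<one>\<^bsub>A\<^esub>"
    and contract_normal23: "normal23 R \<Longrightarrow> contract G (\<lambda>x y z. g x (y \<cdot> z)) R = g \<one>\<^bsub>A\<^esub> \<one>\<^bsub>A\<^esub>"
proof -
  define h where "h = tpow_lift k A 2 G (\<lambda>as. g (as ! 0) (as ! 1))"
  have h: "h \<in> hom (T 2) G" "\<And>x y. x \<in> carrier A \<Longrightarrow> y \<in> carrier A \<Longrightarrow> h (pure k A [x, y]) = g x y"
    unfolding h_def using tpow_lift[OF G multilinear_curry2[OF g]] by (simp_all add: tuples_simps)
  have tri: "trilinear (T 2) (\<lambda>x y z. pure k A [x \<cdot> y, z])"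
    "trilinear (T 2) (\<lambda>x y z. pure k A [y, z \<cdot> x])"
    "trilinear (T 2) (\<lambda>x y z. pure k A [x, y \<cdot> z])"
    by (auto intro!: trilinearI simp: linear_simps)
  note c = contract_comp[OF comm_group_T G h(1) _ _ R]
  show "normal12 R \<Longrightarrow> contract G (\<lambda>x y z. g (x \<cdot> y) z) R = g \<one>\<^bsub>A\<^esub> \<one>\<^bsub>A\<^esub>"
    using c[OF tri(1), of "\<lambda>x y z. g (x \<cdot> y) z"] by (simp add: h(2) normal12_def sweedler_eq_contract)
  show "normal31 R \<Longrightarrow> contract G (\<lambda>x y z. g y (z \<cdot> x)) R = g \<one>\<^bsub>A\<^esub> \<one>\<^bsub>A\<^esub>"
    using c[OF tri(2), of "\<lambda>x y z. g y (z \<cdot> x)"] by (simp add: h(2) normal31_def sweedler_eq_contract)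
  show "normal23 R \<Longrightarrow> contract G (\<lambda>x y z. g x (y \<cdot> z)) R = g \<one>\<^bsub>A\<^esub> \<one>\<^bsub>A\<^esub>"
    using c[OF tri(3), of "\<lambda>x y z. g x (y \<cdot> z)"] by (simp add: h(2) normal23_def sweedler_eq_contract)
qed

text \<open>Exchange takes \<open>a\<close> out of the product \<open>x a y\<close>, which the normalization then evaluates.\<close>

lemma contract_sandwich12:
  assumes G: "comm_group G" and g: "bilinear G g" and R: "R \<in> carrier (T 3)"
    and "exchange23 R" "normal12 R" and a: "a \<in> carrier A"
  shows "contract G (\<lambda>x y z. g (x \<cdot> a \<cdot> y) z) R = g \<one>\<^bsub>A\<^esub> a"
proof -
  have tri: "trilinear G (\<lambda>x y z. g (x \<cdot> y) z)"
    by (rule trilinearI) (simp_all add: linear_simps bilinearD[OF g])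
  have bi: "bilinear G (\<lambda>x y. g x (y \<cdot> a))"
    by (rule bilinearI) (simp_all add: linear_simps bilinearD[OF g] a)
  have "contract G (\<lambda>x y z. g (x \<cdot> a \<cdot> y) z) R = contract G (\<lambda>x y z. g (x \<cdot> (a \<cdot> y)) z) R"
    by (rule contract_cong) (simp add: A.m_assoc a)
  also have "\<dots> = contract G (\<lambda>x y z. g (x \<cdot> y) (z \<cdot> a)) R"
    by (rule contract_exchange23[OF G tri a R]) fact
  also have "\<dots> = g \<one>\<^bsub>A\<^esub> (\<one>\<^bsub>A\<^esub> \<cdot> a)"
    by (rule contract_normal12[OF G bi R]) fact
  finally show ?thesis using a by simp
qed

lemma contract_sandwich31:
  assumes G: "comm_group G" and g: "bilinear G g" and R: "R \<in> carrier (T 3)"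
    and "exchange23 R" "normal31 R" and a: "a \<in> carrier A"
  shows "contract G (\<lambda>x y z. g y (z \<cdot> a \<cdot> x)) R = g a \<one>\<^bsub>A\<^esub>"
proof -
  have tri: "trilinear G (\<lambda>x y z. g y (z \<cdot> x))"
    by (rule trilinearI) (simp_all add: linear_simps bilinearD[OF g])
  have bi: "bilinear G (\<lambda>x y. g (a \<cdot> x) y)"
    by (rule bilinearI) (simp_all add: linear_simps bilinearD[OF g] a)
  have "contract G (\<lambda>x y z. g y (z \<cdot> a \<cdot> x)) R = contract G (\<lambda>x y z. g (a \<cdot> y) (z \<cdot> x)) R"
    by (rule contract_exchange23[OF G tri a R, symmetric]) fact
  also have "\<dots> = g (a \<cdot> \<one>\<^bsub>A\<^esub>) \<one>\<^bsub>A\<^esub>"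
    by (rule contract_normal31[OF G bi R]) fact
  finally show ?thesis using a by simp
qed


section \<open>Cyclic invariance\<close>

text \<open>The heart of the first part. With a second copy of \<open>R\<close>, written in lower case, the element
  \<open>Y \<otimes> Z x X y \<otimes> z\<close> is a sandwich of \<open>X\<close> for the second copy and a sandwich of \<open>x\<close> for the first one.
  The two evaluations differ by a cyclic permutation.\<close>

lemma contract_cyclic:
  assumes G: "comm_group G" and f: "trilinear G f" and R: "R \<in> carrier (T 3)"
    and e: "exchange23 R" and n: "normal12 R" "normal31 R"
  shows "contract G (\<lambda>x y z. f y z x) R = contract G f R"
proof -
  note D = linear_simps trilinearD[OF f]
  have "contract G (\<lambda>x y z. f y z x) R =
      contract G (\<lambda>X Y Z. contract G (\<lambda>x y z. f Y (Z \<cdot> (x \<cdot> X \<cdot> y)) z) R) R"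
  proof (rule contract_cong)
    fix X Y Z assume [simp]: "X \<in> carrier A" "Y \<in> carrier A" "Z \<in> carrier A"
    have "bilinear G (\<lambda>p q. f Y (Z \<cdot> p) q)" by (rule bilinearI) (simp_all add: D)
    from contract_sandwich12[OF G this R e n(1), of X]
    show "f Y Z X = contract G (\<lambda>x y z. f Y (Z \<cdot> (x \<cdot> X \<cdot> y)) z) R" by simp
  qed
  also have "\<dots> = contract G (\<lambda>x y z. contract G (\<lambda>X Y Z. f Y (Z \<cdot> (x \<cdot> X \<cdot> y)) z) R) R"
    by (rule contract_swap[OF G _ _ R R]; rule trilinearI) (simp_all add: D)
  also have "\<dots> = contract G f R"
  proof (rule contract_cong)
    fix x y z assume [simp]: "x \<in> carrier A" "y \<in> carrier A" "z \<in> carrier A"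
    have "bilinear G (\<lambda>p q. f p (q \<cdot> y) z)" by (rule bilinearI) (simp_all add: D)
    from contract_sandwich31[OF G this R e n(2), of x]
    show "contract G (\<lambda>X Y Z. f Y (Z \<cdot> (x \<cdot> X \<cdot> y)) z) R = f x y z"
      by (simp add: A.m_assoc cong: contract_cong)
  qed
  finally show ?thesis .
qed

lemma trilinear_rotate: "trilinear G f \<Longrightarrow> trilinear G (\<lambda>x y z. f y z x)"
  by (rule trilinearI) (simp_all add: trilinearD)

lemma bilinear_flip: "bilinear G g \<Longrightarrow> bilinear G (\<lambda>x y. g y x)"
  by (rule bilinearI) (simp_all add: bilinearD)

lemma bilinear_pure: "bilinear (T 2) (\<lambda>x y. pure k A [x, y])"
  by (rule bilinearI) (simp_all add: pure2)

lemma contract_cyclic':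
  assumes G: "comm_group G" and f: "trilinear G f" and R: "R \<in> carrier (T 3)"
    and e: "exchange23 R" and n: "normal12 R" "normal31 R"
  shows "contract G (\<lambda>x y z. f z x y) R = contract G f R"
  using contract_cyclic[OF G trilinear_rotate[OF trilinear_rotate[OF f]] R e n] by simp

text \<open>Rotating the rule \<open>exchange23\<close> and the rule \<open>normal12\<close> gives the remaining ones.\<close>

lemma normalized_exchange:
  assumes R: "R \<in> carrier (T 3)" and e: "exchange23 R" and n: "normal12 R" "normal31 R"
  shows "exchange31 R" "exchange12 R" "normal23 R"
proof -
  note cyc = contract_cyclic[OF comm_group_T _ R e n]
  note cyc' = contract_cyclic'[OF comm_group_T _ R e n]
  note e23 = contract_exchange23[OF comm_group_T _ _ R e]
  show "exchange31 R"
    unfolding exchange31_def sweedler_eq_contract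
  proof
    fix a assume a [simp]: "a \<in> carrier A"
    have "contract (T 3) (\<lambda>x y z. pure k A [x, y, a \<cdot> z]) R =
        contract (T 3) (\<lambda>x y z. pure k A [z, x, a \<cdot> y]) R"
      by (rule cyc'[symmetric], rule trilinearI) (simp_all add: linear_simps)
    also have "\<dots> = contract (T 3) (\<lambda>x y z. pure k A [z \<cdot> a, x, y]) R"
      by (rule e23[OF _ a], rule trilinearI) (simp_all add: linear_simps)
    also have "\<dots> = contract (T 3) (\<lambda>x y z. pure k A [x \<cdot> a, y, z]) R"
      by (rule cyc', rule trilinearI) (simp_all add: linear_simps)
    finally show "contract (T 3) (\<lambda>x y z. pure k A [x, y, a \<cdot> z]) R =
        contract (T 3) (\<lambda>x y z. pure k A [x \<cdot> a, y, z]) R" .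
  qed
  show "exchange12 R"
    unfolding exchange12_def sweedler_eq_contract
  proof
    fix a assume a [simp]: "a \<in> carrier A"
    have "contract (T 3) (\<lambda>x y z. pure k A [a \<cdot> x, y, z]) R =
        contract (T 3) (\<lambda>x y z. pure k A [a \<cdot> y, z, x]) R"
      by (rule cyc[symmetric], rule trilinearI) (simp_all add: linear_simps)
    also have "\<dots> = contract (T 3) (\<lambda>x y z. pure k A [y, z \<cdot> a, x]) R"
      by (rule e23[OF _ a], rule trilinearI) (simp_all add: linear_simps)
    also have "\<dots> = contract (T 3) (\<lambda>x y z. pure k A [x, y \<cdot> a, z]) R"
      by (rule cyc, rule trilinearI) (simp_all add: linear_simps)
    finally show "contract (T 3) (\<lambda>x y z. pure k A [a \<cdot> x, y, z]) R =
        contract (T 3) (\<lambda>x y z. pure k A [x, y \<cdot> a, z]) R" .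
  qed
  have "contract (T 2) (\<lambda>x y z. pure k A [x, y \<cdot> z]) R =
      contract (T 2) (\<lambda>x y z. pure k A [z, x \<cdot> y]) R"
    by (rule cyc'[symmetric], rule trilinearI) (simp_all add: linear_simps)
  also have "\<dots> = pure k A [\<one>\<^bsub>A\<^esub>, \<one>\<^bsub>A\<^esub>]"
    by (rule contract_normal12[OF comm_group_T bilinear_flip[OF bilinear_pure] R n(1)])
  finally show "normal23 R" unfolding normal23_def sweedler_eq_contract .
qed

lemma normalized_invariant:
  assumes R: "R \<in> carrier (T 3)" and e: "exchange23 R" and n: "normal12 R" "normal31 R"
  shows "sweedler k A 3 R (\<lambda>x y z. [y, z, x]) = R" "sweedler k A 3 R (\<lambda>x y z. [z, x, y]) = R"
  unfolding sweedler_eq_contract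
  using contract_cyclic[OF comm_group_T trilinear_pure R e n]
    contract_cyclic'[OF comm_group_T trilinear_pure R e n] contract_id[OF R] by simp_all


section \<open>Invertibility\<close>

abbreviation T3_ring :: "('a list \<Rightarrow>\<^sub>0 int) set ring" where "T3_ring \<equiv> tensor_power k A 3"

lemma T3_ring_simps:
  "carrier T3_ring = carrier (T 3)"
  "\<one>\<^bsub>T3_ring\<^esub> = pure k A [\<one>\<^bsub>A\<^esub>, \<one>\<^bsub>A\<^esub>, \<one>\<^bsub>A\<^esub>]"
  "X \<otimes>\<^bsub>T3_ring\<^esub> Y = contract (T 3) (\<lambda>x y z.
     contract (T 3) (\<lambda>x' y' z'. pure k A [x \<cdot> x', y \<cdot> y', z \<cdot> z']) Y) X"
proof -
  have inner: "tpow_lift k A 3 (T 3) (\<lambda>bs. pure k A (map2 (\<lambda>a b. a \<cdot> b) as bs)) Y =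
      contract (T 3) (\<lambda>x' y' z'. pure k A [as ! 0 \<cdot> x', as ! 1 \<cdot> y', as ! 2 \<cdot> z']) Y"
    if "as \<in> tuples A 3" for as
    unfolding contract_def
    by (rule fun_cong[OF tpow_lift_cong]) (use that in \<open>auto simp: tuples_simps\<close>)
  show "X \<otimes>\<^bsub>T3_ring\<^esub> Y = contract (T 3) (\<lambda>x y z.
     contract (T 3) (\<lambda>x' y' z'. pure k A [x \<cdot> x', y \<cdot> y', z \<cdot> z']) Y) X"
    by (simp add: tensor_power_def contract_def[of _ _ X] inner cong: tpow_lift_cong)
qed (simp_all add: tensor_power_def numeral_3_eq_3)

lemma T3_mult_closed: "X \<in> carrier (T 3) \<Longrightarrow> Y \<in> carrier (T 3) \<Longrightarrow> X \<otimes>\<^bsub>T3_ring\<^esub> Y \<in> carrier (T 3)"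
  unfolding T3_ring_simps
  by (rule contract_closed[OF comm_group_T trilinear_contract[OF comm_group_T]])
     (auto intro!: trilinearI simp: linear_simps)

text \<open>Contractions unfold products, so associativity and the unit laws of \<open>A\<^sup>(\<^sup>3\<^sup>)\<close> become those of \<open>A\<close> inside a
  nested contraction.\<close>

lemma contract_T3_mult:
  assumes G: "comm_group G" and f: "trilinear G f" and X: "X \<in> carrier (T 3)" and Y: "Y \<in> carrier (T 3)"
  shows "contract G f (X \<otimes>\<^bsub>T3_ring\<^esub> Y) =
    contract G (\<lambda>x y z. contract G (\<lambda>x' y' z'. f (x \<cdot> x') (y \<cdot> y') (z \<cdot> z')) Y) X"
proof -
  have tri: "trilinear (T 3) (\<lambda>x' y' z'. pure k A [x \<cdot> x', y \<cdot> y', z \<cdot> z'])"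
    "trilinear (T 3) (\<lambda>x' y' z'. pure k A [x' \<cdot> x, y' \<cdot> y, z' \<cdot> z])"
    if "x \<in> carrier A" "y \<in> carrier A" "z \<in> carrier A" for x y z
    using that by (auto intro!: trilinearI simp: linear_simps)
  show ?thesis
    unfolding T3_ring_simps
    by (rule contract_comp[OF comm_group_T G contract_hom[OF G f] _ _ X])
       (simp_all add: trilinear_contract[OF comm_group_T tri Y] contract_contract[OF G f Y tri(1)])
qed

lemma monoid_T3_ring: "monoid T3_ring"
proof (rule monoidI)
  fix X Y Z assume "X \<in> carrier T3_ring" "Y \<in> carrier T3_ring" "Z \<in> carrier T3_ring"
  then have [simp]: "X \<in> carrier (T 3)" "Y \<in> carrier (T 3)" "Z \<in> carrier (T 3)"
    by (simp_all add: T3_ring_simps(1))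
  have tri: "trilinear (T 3) (\<lambda>x' y' z'. pure k A [x \<cdot> x', y \<cdot> y', z \<cdot> z'])"
    "trilinear (T 3) (\<lambda>x' y' z'. pure k A [x' \<cdot> x, y' \<cdot> y, z' \<cdot> z])"
    if "x \<in> carrier A" "y \<in> carrier A" "z \<in> carrier A" for x y z
    using that by (auto intro!: trilinearI simp: linear_simps)
  have "X \<otimes>\<^bsub>T3_ring\<^esub> Y \<otimes>\<^bsub>T3_ring\<^esub> Z = contract (T 3) (\<lambda>x y z. contract (T 3) (\<lambda>x' y' z'.
      contract (T 3) (\<lambda>x'' y'' z''. pure k A [x \<cdot> x' \<cdot> x'', y \<cdot> y' \<cdot> y'', z \<cdot> z' \<cdot> z'']) Z) Y) X"
    unfolding T3_ring_simps(3)[of "X \<otimes>\<^bsub>T3_ring\<^esub> Y" Z]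
    by (rule contract_T3_mult[OF comm_group_T trilinear_contract[OF comm_group_T tri]]) simp_all
  also have "\<dots> = X \<otimes>\<^bsub>T3_ring\<^esub> (Y \<otimes>\<^bsub>T3_ring\<^esub> Z)"
    unfolding T3_ring_simps(3)[of X]
    by (simp add: contract_T3_mult[OF comm_group_T tri(1)] A.m_assoc cong: contract_cong)
  finally show "X \<otimes>\<^bsub>T3_ring\<^esub> Y \<otimes>\<^bsub>T3_ring\<^esub> Z = X \<otimes>\<^bsub>T3_ring\<^esub> (Y \<otimes>\<^bsub>T3_ring\<^esub> Z)" .
next
  fix X assume "X \<in> carrier T3_ring"
  then have X: "X \<in> carrier (T 3)" by (simp add: T3_ring_simps(1))
  have tri: "trilinear (T 3) (\<lambda>x y z. contract (T 3) (\<lambda>x' y' z'. pure k A [x \<cdot> x', y \<cdot> y', z \<cdot> z']) Y)"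
    if "Y \<in> carrier (T 3)" for Y
    by (rule trilinear_contract[OF comm_group_T _ _ that]; rule trilinearI) (simp_all add: linear_simps)
  show "\<one>\<^bsub>T3_ring\<^esub> \<otimes>\<^bsub>T3_ring\<^esub> X = X"
    unfolding T3_ring_simps
    by (simp add: contract_pure[OF comm_group_T tri[OF X]] contract_id[OF X] cong: contract_cong)
  show "X \<otimes>\<^bsub>T3_ring\<^esub> \<one>\<^bsub>T3_ring\<^esub> = X"
  proof -
    have "trilinear (T 3) (\<lambda>x' y' z'. pure k A [x \<cdot> x', y \<cdot> y', z \<cdot> z'])"
      if "x \<in> carrier A" "y \<in> carrier A" "z \<in> carrier A" for x y z
      using that by (auto intro!: trilinearI simp: linear_simps)
    then show ?thesis
      unfolding T3_ring_simps
      by (simp add: contract_pure[OF comm_group_T] contract_id[OF X] cong: contract_cong)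
  qed
qed (simp_all add: T3_ring_simps(1,2) T3_mult_closed pure3)

text \<open>The candidate for the inverse: \<open>flip R = R\<^sup>2 \<otimes> R\<^sup>1 \<otimes> R\<^sup>3\<close>.\<close>

definition flip :: "('a list \<Rightarrow>\<^sub>0 int) set \<Rightarrow> ('a list \<Rightarrow>\<^sub>0 int) set" where
  "flip R = contract (T 3) (\<lambda>x y z. pure k A [y, x, z]) R"

lemma trilinear_flip: "trilinear (T 3) (\<lambda>x y z. pure k A [y, x, z])"
  by (rule trilinearI) (simp_all add: linear_simps)

lemma flip_closed: "R \<in> carrier (T 3) \<Longrightarrow> flip R \<in> carrier (T 3)"
  unfolding flip_def by (rule contract_closed[OF comm_group_T trilinear_flip])

text \<open>Exchanging \<open>y\<close> in \<open>y X \<otimes> x Y \<otimes> z Z\<close> produces the sandwich \<open>x Y y\<close>.\<close>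

lemma flip_mult:
  assumes R: "R \<in> carrier (T 3)" and e: "exchange12 R" "exchange23 R" and n: "normal12 R" "normal23 R"
  shows "flip R \<otimes>\<^bsub>T3_ring\<^esub> R = \<one>\<^bsub>T3_ring\<^esub>"
proof -
  let ?c = "\<lambda>f. contract (T 3) f R"
  have "flip R \<otimes>\<^bsub>T3_ring\<^esub> R = ?c (\<lambda>x y z. ?c (\<lambda>X Y Z. pure k A [y \<cdot> X, x \<cdot> Y, z \<cdot> Z]))"
    unfolding T3_ring_simps flip_def
    by (rule contract_contract[OF comm_group_T trilinear_contract[OF comm_group_T _ _ R] R trilinear_flip];
        (rule trilinearI)?) (simp_all add: linear_simps)
  also have "\<dots> = ?c (\<lambda>x y z. ?c (\<lambda>X Y Z. pure k A [X, x \<cdot> (Y \<cdot> y), z \<cdot> Z]))"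
    by (rule contract_cong, rule contract_exchange12[OF comm_group_T _ _ R e(1)], rule trilinearI)
       (simp_all add: linear_simps)
  also have "\<dots> = ?c (\<lambda>X Y Z. ?c (\<lambda>x y z. pure k A [X, x \<cdot> (Y \<cdot> y), z \<cdot> Z]))"
    by (rule contract_swap[OF comm_group_T _ _ R R]; rule trilinearI) (simp_all add: linear_simps)
  also have "\<dots> = ?c (\<lambda>X Y Z. pure k A [X, \<one>\<^bsub>A\<^esub>, Y \<cdot> Z])"
  proof (rule contract_cong)
    fix X Y Z assume [simp]: "X \<in> carrier A" "Y \<in> carrier A" "Z \<in> carrier A"
    have "bilinear (T 3) (\<lambda>p q. pure k A [X, p, q \<cdot> Z])"
      by (rule bilinearI) (simp_all add: linear_simps)
    from contract_sandwich12[OF comm_group_T this R e(2) n(1), of Y]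
    show "?c (\<lambda>x y z. pure k A [X, x \<cdot> (Y \<cdot> y), z \<cdot> Z]) = pure k A [X, \<one>\<^bsub>A\<^esub>, Y \<cdot> Z]"
      by (simp add: A.m_assoc cong: contract_cong)
  qed
  also have "\<dots> = pure k A [\<one>\<^bsub>A\<^esub>, \<one>\<^bsub>A\<^esub>, \<one>\<^bsub>A\<^esub>]"
    by (rule contract_normal23[OF comm_group_T _ R n(2)], rule bilinearI) (simp_all add: linear_simps)
  finally show ?thesis by (simp add: T3_ring_simps)
qed

text \<open>The same exchange, applied in the other direction, produces the sandwich \<open>x X y\<close>; here the last
  normalization is left open, and its value decides whether \<open>flip R\<close> is a right inverse.\<close>

lemma mult_flip:
  assumes R: "R \<in> carrier (T 3)" and e: "exchange12 R" "exchange23 R" and n: "normal12 R"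
  shows "R \<otimes>\<^bsub>T3_ring\<^esub> flip R = contract (T 3) (\<lambda>x y z. pure k A [\<one>\<^bsub>A\<^esub>, y, z \<cdot> x]) R"
proof -
  let ?c = "\<lambda>f. contract (T 3) f R"
  have "R \<otimes>\<^bsub>T3_ring\<^esub> flip R = ?c (\<lambda>X Y Z. ?c (\<lambda>x y z. pure k A [X \<cdot> y, Y \<cdot> x, Z \<cdot> z]))"
    unfolding T3_ring_simps flip_def
    by (rule contract_cong, rule contract_contract[OF comm_group_T _ R trilinear_flip]; (rule trilinearI)?)
       (simp_all add: linear_simps)
  also have "\<dots> = ?c (\<lambda>x y z. ?c (\<lambda>X Y Z. pure k A [X \<cdot> y, Y \<cdot> x, Z \<cdot> z]))"
    by (rule contract_swap[OF comm_group_T _ _ R R]; rule trilinearI) (simp_all add: linear_simps)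
  also have "\<dots> = ?c (\<lambda>x y z. ?c (\<lambda>X Y Z. pure k A [x \<cdot> X \<cdot> y, Y, Z \<cdot> z]))"
    by (rule contract_cong, rule contract_exchange12[OF comm_group_T _ _ R e(1), symmetric], rule trilinearI)
       (simp_all add: linear_simps)
  also have "\<dots> = ?c (\<lambda>X Y Z. ?c (\<lambda>x y z. pure k A [x \<cdot> X \<cdot> y, Y, Z \<cdot> z]))"
    by (rule contract_swap[OF comm_group_T _ _ R R]; rule trilinearI) (simp_all add: linear_simps)
  also have "\<dots> = ?c (\<lambda>X Y Z. pure k A [\<one>\<^bsub>A\<^esub>, Y, Z \<cdot> X])"
  proof (rule contract_cong)
    fix X Y Z assume [simp]: "X \<in> carrier A" "Y \<in> carrier A" "Z \<in> carrier A"
    have "bilinear (T 3) (\<lambda>p q. pure k A [p, Y, Z \<cdot> q])"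
      by (rule bilinearI) (simp_all add: linear_simps)
    from contract_sandwich12[OF comm_group_T this R e(2) n(1), of X]
    show "?c (\<lambda>x y z. pure k A [x \<cdot> X \<cdot> y, Y, Z \<cdot> z]) = pure k A [\<one>\<^bsub>A\<^esub>, Y, Z \<cdot> X]" by simp
  qed
  finally show ?thesis .
qed

section \<open>Canonical R-matrices are the normalized elements\<close>

text \<open>In either identity two exchanges bring two factors of one copy of \<open>R\<close> next to each other, where a
  normalization removes that copy.\<close>

lemma normalized_hexagons:
  assumes R: "R \<in> carrier (T 3)" and e: "exchange12 R" "exchange23 R" and n: "normal12 R" "normal23 R"
  shows "sweedler k A 4 R (\<lambda>R1 R2 R3. [R1, R2, \<one>\<^bsub>A\<^esub>, R3]) =
       sweedler2 k A 4 R R (\<lambda>r1 r2 r3 R1 R2 R3. [r1 \<cdot> R1, r2, r3 \<cdot> R2, R3])" (is ?A)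
    and "sweedler k A 4 R (\<lambda>R1 R2 R3. [R1, \<one>\<^bsub>A\<^esub>, R2, R3]) =
       sweedler2 k A 4 R R (\<lambda>r1 r2 r3 R1 R2 R3. [R1, R2 \<cdot> r1, r2, R3 \<cdot> r3])" (is ?B)
proof -
  let ?c = "\<lambda>f. contract (T 4) f R"
  note swap = contract_swap[OF comm_group_T _ _ R R]
  have "?c (\<lambda>x y z. ?c (\<lambda>X Y Z. pure k A [x \<cdot> X, y, z \<cdot> Y, Z])) =
      ?c (\<lambda>X Y Z. ?c (\<lambda>x y z. pure k A [x \<cdot> X, y, z \<cdot> Y, Z]))"
    by (rule swap; rule trilinearI) (simp_all add: linear_simps)
  also have "\<dots> = ?c (\<lambda>X Y Z. ?c (\<lambda>x y z. pure k A [x \<cdot> X, Y \<cdot> y, z, Z]))"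
    by (rule contract_cong, rule contract_exchange23[OF comm_group_T _ _ R e(2), symmetric], rule trilinearI)
       (simp_all add: linear_simps)
  also have "\<dots> = ?c (\<lambda>x y z. ?c (\<lambda>X Y Z. pure k A [x \<cdot> X, Y \<cdot> y, z, Z]))"
    by (rule swap; rule trilinearI) (simp_all add: linear_simps)
  also have "\<dots> = ?c (\<lambda>x y z. ?c (\<lambda>X Y Z. pure k A [x \<cdot> (y \<cdot> X), Y, z, Z]))"
    by (rule contract_cong, rule contract_exchange12[OF comm_group_T _ _ R e(1), symmetric], rule trilinearI)
       (simp_all add: linear_simps)
  also have "\<dots> = ?c (\<lambda>X Y Z. ?c (\<lambda>x y z. pure k A [x \<cdot> (y \<cdot> X), Y, z, Z]))"
    by (rule swap; rule trilinearI) (simp_all add: linear_simps)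
  also have "\<dots> = ?c (\<lambda>X Y Z. pure k A [X, Y, \<one>\<^bsub>A\<^esub>, Z])"
  proof (rule contract_cong)
    fix X Y Z assume [simp]: "X \<in> carrier A" "Y \<in> carrier A" "Z \<in> carrier A"
    have "bilinear (T 4) (\<lambda>p q. pure k A [p \<cdot> X, Y, q, Z])"
      by (rule bilinearI) (simp_all add: linear_simps)
    from contract_normal12[OF comm_group_T this R n(1)]
    show "?c (\<lambda>x y z. pure k A [x \<cdot> (y \<cdot> X), Y, z, Z]) = pure k A [X, Y, \<one>\<^bsub>A\<^esub>, Z]"
      by (simp add: A.m_assoc cong: contract_cong)
  qed
  finally show ?A unfolding sweedler_eq_contract by (rule sym)
  have "?c (\<lambda>x y z. ?c (\<lambda>X Y Z. pure k A [X, Y \<cdot> x, y, Z \<cdot> z])) =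
      ?c (\<lambda>X Y Z. ?c (\<lambda>x y z. pure k A [X, Y \<cdot> x, y, Z \<cdot> z]))"
    by (rule swap; rule trilinearI) (simp_all add: linear_simps)
  also have "\<dots> = ?c (\<lambda>X Y Z. ?c (\<lambda>x y z. pure k A [X, x, y \<cdot> Y, Z \<cdot> z]))"
    by (rule contract_cong, rule contract_exchange12[OF comm_group_T _ _ R e(1)], rule trilinearI)
       (simp_all add: linear_simps)
  also have "\<dots> = ?c (\<lambda>x y z. ?c (\<lambda>X Y Z. pure k A [X, x, y \<cdot> Y, Z \<cdot> z]))"
    by (rule swap; rule trilinearI) (simp_all add: linear_simps)
  also have "\<dots> = ?c (\<lambda>x y z. ?c (\<lambda>X Y Z. pure k A [X, x, Y, Z \<cdot> y \<cdot> z]))"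
    by (rule contract_cong, rule contract_exchange23[OF comm_group_T _ _ R e(2)], rule trilinearI)
       (simp_all add: linear_simps)
  also have "\<dots> = ?c (\<lambda>X Y Z. ?c (\<lambda>x y z. pure k A [X, x, Y, Z \<cdot> y \<cdot> z]))"
    by (rule swap; rule trilinearI) (simp_all add: linear_simps)
  also have "\<dots> = ?c (\<lambda>X Y Z. pure k A [X, \<one>\<^bsub>A\<^esub>, Y, Z])"
  proof (rule contract_cong)
    fix X Y Z assume [simp]: "X \<in> carrier A" "Y \<in> carrier A" "Z \<in> carrier A"
    have "bilinear (T 4) (\<lambda>p q. pure k A [X, p, Y, Z \<cdot> q])"
      by (rule bilinearI) (simp_all add: linear_simps)
    from contract_normal23[OF comm_group_T this R n(2)]
    show "?c (\<lambda>x y z. pure k A [X, x, Y, Z \<cdot> y \<cdot> z]) = pure k A [X, \<one>\<^bsub>A\<^esub>, Y, Z]"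
      by (simp add: A.m_assoc cong: contract_cong)
  qed
  finally show ?B unfolding sweedler_eq_contract by (rule sym)
qed

lemma canonical_iff:
  "canonical_R_matrix k A R \<longleftrightarrow> R \<in> Units T3_ring \<and> exchange31 R \<and> exchange12 R \<and> exchange23 R \<and>
     sweedler k A 4 R (\<lambda>R1 R2 R3. [R1, R2, \<one>\<^bsub>A\<^esub>, R3]) =
       sweedler2 k A 4 R R (\<lambda>r1 r2 r3 R1 R2 R3. [r1 \<cdot> R1, r2, r3 \<cdot> R2, R3]) \<and>
     sweedler k A 4 R (\<lambda>R1 R2 R3. [R1, \<one>\<^bsub>A\<^esub>, R2, R3]) =
       sweedler2 k A 4 R R (\<lambda>r1 r2 r3 R1 R2 R3. [R1, R2 \<cdot> r1, r2, R3 \<cdot> r3])"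
  unfolding canonical_R_matrix_def exchange31_def exchange12_def exchange23_def by blast

lemma normalized_iff:
  "R \<in> normalized_elements k A \<longleftrightarrow> R \<in> carrier (T 3) \<and> exchange23 R \<and> normal12 R \<and> normal31 R"
  unfolding normalized_elements_def exchange23_def normal12_def normal31_def
  by (simp add: T3_ring_simps(1))

lemma normalized_imp_canonical:
  assumes "R \<in> normalized_elements k A"
  shows "canonical_R_matrix k A R"
proof -
  have R: "R \<in> carrier (T 3)" and e: "exchange23 R" and n: "normal12 R" "normal31 R"
    using assms by (simp_all add: normalized_iff)
  note e' = normalized_exchange[OF R e n]
  have "R \<otimes>\<^bsub>T3_ring\<^esub> flip R = \<one>\<^bsub>T3_ring\<^esub>"
    unfolding mult_flip[OF R e'(2) e n(1)] unfolding T3_ring_simps(2)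
    by (rule contract_normal31[OF comm_group_T _ R n(2)], rule bilinearI) (simp_all add: linear_simps)
  then have "R \<in> Units T3_ring"
    using flip_mult[OF R e'(2) e n(1) e'(3)] R flip_closed[OF R]
    by (auto simp: Units_def T3_ring_simps(1))
  then show ?thesis
    using e e' normalized_hexagons[OF R e'(2) e n(1) e'(3)] by (simp add: canonical_iff)
qed

text \<open>Multiplying the two middle factors is a homomorphism from \<open>A\<^sup>(\<^sup>4\<^sup>)\<close> to \<open>A\<^sup>(\<^sup>3\<^sup>)\<close>. Stated for general
  components, so that it covers both four-fold identities.\<close>

lemma contract_middle_hexagon:
  assumes R: "R \<in> carrier (T 3)"
    and F: "trilinear (T 4) (\<lambda>x y z. pure k A [a x y z, b x y z, c x y z, d x y z])"
    and F': "\<And>X Y Z. \<lbrakk>X \<in> carrier A; Y \<in> carrier A; Z \<in> carrier A\<rbrakk> \<Longrightarrow>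
      trilinear (T 4) (\<lambda>x y z. pure k A [a' X Y Z x y z, b' X Y Z x y z, c' X Y Z x y z, d' X Y Z x y z])"
    and F'': "\<And>X Y Z. \<lbrakk>X \<in> carrier A; Y \<in> carrier A; Z \<in> carrier A\<rbrakk> \<Longrightarrow>
      trilinear (T 4) (\<lambda>x y z. pure k A [a' x y z X Y Z, b' x y z X Y Z, c' x y z X Y Z, d' x y z X Y Z])"
    and cl: "\<And>x y z. \<lbrakk>x \<in> carrier A; y \<in> carrier A; z \<in> carrier A\<rbrakk> \<Longrightarrow>
      {a x y z, b x y z, c x y z, d x y z} \<subseteq> carrier A"
    and cl': "\<And>x y z X Y Z. \<lbrakk>x \<in> carrier A; y \<in> carrier A; z \<in> carrier A;
        X \<in> carrier A; Y \<in> carrier A; Z \<in> carrier A\<rbrakk> \<Longrightarrow>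
      {a' X Y Z x y z, b' X Y Z x y z, c' X Y Z x y z, d' X Y Z x y z} \<subseteq> carrier A"
    and eq: "sweedler k A 4 R (\<lambda>x y z. [a x y z, b x y z, c x y z, d x y z]) =
      sweedler2 k A 4 R R (\<lambda>X Y Z x y z. [a' X Y Z x y z, b' X Y Z x y z, c' X Y Z x y z, d' X Y Z x y z])"
  shows "contract (T 3) (\<lambda>x y z. pure k A [a x y z, b x y z \<cdot> c x y z, d x y z]) R =
    contract (T 3) (\<lambda>X Y Z. contract (T 3) (\<lambda>x y z.
      pure k A [a' X Y Z x y z, b' X Y Z x y z \<cdot> c' X Y Z x y z, d' X Y Z x y z]) R) R"
proof -
  have multi: "multilinear 4 (T 3) (\<lambda>as. pure k A [as ! 0, as ! 1 \<cdot> as ! 2, as ! 3])"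
  proof -
    have less4: "i < 4 \<longleftrightarrow> i = 0 \<or> i = Suc 0 \<or> i = Suc (Suc 0) \<or> i = Suc (Suc (Suc 0))" for i :: nat
      by auto
    have tuples4: "as \<in> tuples A 4 \<longleftrightarrow>
        (\<exists>p\<in>carrier A. \<exists>q\<in>carrier A. \<exists>s\<in>carrier A. \<exists>t\<in>carrier A. as = [p, q, s, t])" for as
      by (auto simp: tuples_simps)
    show ?thesis
      unfolding multilinear_def by (auto simp: tuples4 less4 linear_simps)
  qed
  define h where "h = tpow_lift k A 4 (T 3) (\<lambda>as. pure k A [as ! 0, as ! 1 \<cdot> as ! 2, as ! 3])"
  have h: "h \<in> hom (T 4) (T 3)"
    and hp: "\<And>p q s t. {p, q, s, t} \<subseteq> carrier A \<Longrightarrow> h (pure k A [p, q, s, t]) = pure k A [p, q \<cdot> s, t]"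
    unfolding h_def using tpow_lift[OF comm_group_T multi] by (simp_all add: tuples_simps)
  note comp = contract_comp[OF comm_group_T comm_group_T h _ _ R]
  have "contract (T 3) (\<lambda>x y z. pure k A [a x y z, b x y z \<cdot> c x y z, d x y z]) R =
      h (sweedler k A 4 R (\<lambda>x y z. [a x y z, b x y z, c x y z, d x y z]))"
    unfolding sweedler_eq_contract by (rule comp[symmetric, OF F]) (rule hp[OF cl])
  also have "\<dots> = h (contract (T 4) (\<lambda>X Y Z. contract (T 4) (\<lambda>x y z.
      pure k A [a' X Y Z x y z, b' X Y Z x y z, c' X Y Z x y z, d' X Y Z x y z]) R) R)"
    using eq unfolding sweedler_eq_contract by (rule arg_cong)
  also have "\<dots> = contract (T 3) (\<lambda>X Y Z. contract (T 3) (\<lambda>x y z.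
      pure k A [a' X Y Z x y z, b' X Y Z x y z \<cdot> c' X Y Z x y z, d' X Y Z x y z]) R) R"
    by (rule comp[OF trilinear_contract[OF comm_group_T F' F'' R] comp[OF F' hp[OF cl']]])
  finally show ?thesis .
qed

text \<open>Invertibility of \<open>R\<close> enters in two ways: it cancels \<open>R\<close> in the contracted four-fold identities, and
  it makes the left inverse \<open>flip R\<close> a right inverse.\<close>

lemma canonical_imp_normalized:
  assumes "canonical_R_matrix k A R"
  shows "R \<in> normalized_elements k A"
proof -
  have U: "R \<in> Units T3_ring" and e: "exchange12 R" "exchange23 R"
    and hex: "sweedler k A 4 R (\<lambda>R1 R2 R3. [R1, R2, \<one>\<^bsub>A\<^esub>, R3]) =
       sweedler2 k A 4 R R (\<lambda>r1 r2 r3 R1 R2 R3. [r1 \<cdot> R1, r2, r3 \<cdot> R2, R3])"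
     "sweedler k A 4 R (\<lambda>R1 R2 R3. [R1, \<one>\<^bsub>A\<^esub>, R2, R3]) =
       sweedler2 k A 4 R R (\<lambda>r1 r2 r3 R1 R2 R3. [R1, R2 \<cdot> r1, r2, R3 \<cdot> r3])"
    using assms by (simp_all add: canonical_iff)
  interpret M3: monoid T3_ring by (rule monoid_T3_ring)
  have R': "R \<in> carrier T3_ring" using U by (rule M3.Units_closed)
  then have R: "R \<in> carrier (T 3)" by (simp add: T3_ring_simps)
  obtain S where S: "S \<in> carrier T3_ring" "S \<otimes>\<^bsub>T3_ring\<^esub> R = \<one>\<^bsub>T3_ring\<^esub>" "R \<otimes>\<^bsub>T3_ring\<^esub> S = \<one>\<^bsub>T3_ring\<^esub>"
    using U by (auto simp: Units_def)
  let ?c = "\<lambda>f. contract (T 3) f R"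

  \<comment> \<open>Multiplying the middle factors of the first four-fold identity gives \<open>R = N R\<close>.\<close>
  define N where "N = ?c (\<lambda>x y z. pure k A [x, y \<cdot> z, \<one>\<^bsub>A\<^esub>])"
  have tN: "trilinear (T 3) (\<lambda>x y z. pure k A [x, y \<cdot> z, \<one>\<^bsub>A\<^esub>])"
    by (rule trilinearI) (simp_all add: linear_simps)
  have N: "N \<in> carrier T3_ring"
    unfolding N_def T3_ring_simps by (rule contract_closed[OF comm_group_T tN R])
  have "R = ?c (\<lambda>x y z. pure k A [x, y \<cdot> \<one>\<^bsub>A\<^esub>, z])"
    by (simp add: contract_id[OF R] cong: contract_cong)
  also have "\<dots> = ?c (\<lambda>x y z. ?c (\<lambda>X Y Z. pure k A [x \<cdot> X, y \<cdot> (z \<cdot> Y), Z]))"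
    by (rule contract_middle_hexagon[OF R _ _ _ _ _ hex(1)]; (rule trilinearI)?)
       (simp_all add: linear_simps)
  also have "\<dots> = ?c (\<lambda>x y z. ?c (\<lambda>X Y Z. pure k A [x \<cdot> X, y \<cdot> z \<cdot> Y, \<one>\<^bsub>A\<^esub> \<cdot> Z]))"
    by (simp add: A.m_assoc cong: contract_cong)
  also have "\<dots> = N \<otimes>\<^bsub>T3_ring\<^esub> R"
    unfolding N_def T3_ring_simps(3)
    by (rule contract_contract[OF comm_group_T trilinear_contract[OF comm_group_T _ _ R] R tN, symmetric];
        (rule trilinearI)?) (simp_all add: linear_simps)
  finally have "N \<otimes>\<^bsub>T3_ring\<^esub> R = R" ..
  then have N1: "N = \<one>\<^bsub>T3_ring\<^esub>"
    using M3.m_assoc[OF N R' S(1)] S N by simp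
  have "contract (T 2) (\<lambda>p q s. pure k A [p, q \<cdot> s]) N = contract (T 2) (\<lambda>x y z. pure k A [x, y \<cdot> z \<cdot> \<one>\<^bsub>A\<^esub>]) R"
    unfolding N_def
    by (rule contract_contract[OF comm_group_T _ R tN]; (rule trilinearI)?) (simp_all add: linear_simps)
  moreover have "contract (T 2) (\<lambda>p q s. pure k A [p, q \<cdot> s]) N = pure k A [\<one>\<^bsub>A\<^esub>, \<one>\<^bsub>A\<^esub> \<cdot> \<one>\<^bsub>A\<^esub>]"
    unfolding N1 T3_ring_simps(2)
    by (rule contract_pure[OF comm_group_T]; (rule trilinearI)?) (simp_all add: linear_simps)
  ultimately have n23: "normal23 R"
    by (simp add: normal23_def sweedler_eq_contract cong: contract_cong)

  \<comment> \<open>Multiplying the middle factors of the second four-fold identity gives \<open>R = R N'\<close>.\<close>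
  define N' where "N' = ?c (\<lambda>x y z. pure k A [\<one>\<^bsub>A\<^esub>, x \<cdot> y, z])"
  have tN': "trilinear (T 3) (\<lambda>x y z. pure k A [\<one>\<^bsub>A\<^esub>, x \<cdot> y, z])"
    by (rule trilinearI) (simp_all add: linear_simps)
  have N': "N' \<in> carrier T3_ring"
    unfolding N'_def T3_ring_simps by (rule contract_closed[OF comm_group_T tN' R])
  have "R = ?c (\<lambda>x y z. pure k A [x, \<one>\<^bsub>A\<^esub> \<cdot> y, z])"
    by (simp add: contract_id[OF R] cong: contract_cong)
  also have "\<dots> = ?c (\<lambda>x y z. ?c (\<lambda>X Y Z. pure k A [X, Y \<cdot> x \<cdot> y, Z \<cdot> z]))"
    by (rule contract_middle_hexagon[OF R _ _ _ _ _ hex(2)]; (rule trilinearI)?)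
       (simp_all add: linear_simps)
  also have "\<dots> = ?c (\<lambda>X Y Z. ?c (\<lambda>x y z. pure k A [X, Y \<cdot> x \<cdot> y, Z \<cdot> z]))"
    by (rule contract_swap[OF comm_group_T _ _ R R]; rule trilinearI) (simp_all add: linear_simps)
  also have "\<dots> = ?c (\<lambda>X Y Z. ?c (\<lambda>x y z. pure k A [X \<cdot> \<one>\<^bsub>A\<^esub>, Y \<cdot> (x \<cdot> y), Z \<cdot> z]))"
    by (simp add: A.m_assoc cong: contract_cong)
  also have "\<dots> = R \<otimes>\<^bsub>T3_ring\<^esub> N'"
    unfolding N'_def T3_ring_simps(3)
    by (rule contract_cong, rule contract_contract[OF comm_group_T _ R tN', symmetric]; (rule trilinearI)?)
       (simp_all add: linear_simps)
  finally have "R \<otimes>\<^bsub>T3_ring\<^esub> N' = R" ..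
  then have N1': "N' = \<one>\<^bsub>T3_ring\<^esub>"
    using M3.m_assoc[OF S(1) R' N'] S N' by simp
  have "contract (T 2) (\<lambda>p q s. pure k A [p \<cdot> q, s]) N' = contract (T 2) (\<lambda>x y z. pure k A [\<one>\<^bsub>A\<^esub> \<cdot> (x \<cdot> y), z]) R"
    unfolding N'_def
    by (rule contract_contract[OF comm_group_T _ R tN']; (rule trilinearI)?) (simp_all add: linear_simps)
  moreover have "contract (T 2) (\<lambda>p q s. pure k A [p \<cdot> q, s]) N' = pure k A [\<one>\<^bsub>A\<^esub> \<cdot> \<one>\<^bsub>A\<^esub>, \<one>\<^bsub>A\<^esub>]"
    unfolding N1' T3_ring_simps(2)
    by (rule contract_pure[OF comm_group_T]; (rule trilinearI)?) (simp_all add: linear_simps)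
  ultimately have n12: "normal12 R"
    by (simp add: normal12_def sweedler_eq_contract cong: contract_cong)

  \<comment> \<open>The product \<open>R (flip R)\<close> is \<open>1 \<otimes> R\<^sup>2 \<otimes> R\<^sup>3 R\<^sup>1\<close>, so this element equals \<open>1\<close>.\<close>
  have "flip R \<in> carrier T3_ring" using flip_closed[OF R] by (simp add: T3_ring_simps)
  then have "flip R = S"
    using M3.inv_unique[of "flip R" R S] flip_mult[OF R e n12 n23] S R' by simp
  then have flip1: "?c (\<lambda>x y z. pure k A [\<one>\<^bsub>A\<^esub>, y, z \<cdot> x]) = \<one>\<^bsub>T3_ring\<^esub>"
    using mult_flip[OF R e n12] S(3) by simp
  have t31: "trilinear (T 3) (\<lambda>x y z. pure k A [\<one>\<^bsub>A\<^esub>, y, z \<cdot> x])"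
    by (rule trilinearI) (simp_all add: linear_simps)
  have "contract (T 2) (\<lambda>x y z. pure k A [\<one>\<^bsub>A\<^esub> \<cdot> y, z \<cdot> x]) R =
      contract (T 2) (\<lambda>p q s. pure k A [p \<cdot> q, s]) (?c (\<lambda>x y z. pure k A [\<one>\<^bsub>A\<^esub>, y, z \<cdot> x]))"
    by (rule contract_contract[OF comm_group_T _ R t31, symmetric]; (rule trilinearI)?)
       (simp_all add: linear_simps)
  also have "\<dots> = pure k A [\<one>\<^bsub>A\<^esub> \<cdot> \<one>\<^bsub>A\<^esub>, \<one>\<^bsub>A\<^esub>]"
    unfolding flip1 T3_ring_simps(2)
    by (rule contract_pure[OF comm_group_T]; (rule trilinearI)?) (simp_all add: linear_simps)
  finally have "normal31 R"
    by (simp add: normal31_def sweedler_eq_contract cong: contract_cong)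
  then show ?thesis using R e n12 by (simp add: normalized_iff)
qed

lemma canonical_eq_normalized: "{R. canonical_R_matrix k A R} = normalized_elements k A"
  using canonical_imp_normalized normalized_imp_canonical by blast

end

section \<open>Bimodules and their tensor products\<close>

context assoc_algebra
begin

lemma bimoduleI:
  assumes "comm_group U"
    and "\<And>a u. \<lbrakk>a \<in> carrier A; u \<in> carrier U\<rbrakk> \<Longrightarrow> lact U a u \<in> carrier U"
    and "\<And>a u. \<lbrakk>a \<in> carrier A; u \<in> carrier U\<rbrakk> \<Longrightarrow> ract U u a \<in> carrier U"
    and "\<And>a u v. \<lbrakk>a \<in> carrier A; u \<in> carrier U; v \<in> carrier U\<rbrakk>
           \<Longrightarrow> lact U a (u \<otimes>\<^bsub>U\<^esub> v) = lact U a u \<otimes>\<^bsub>U\<^esub> lact U a v"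
    and "\<And>a u v. \<lbrakk>a \<in> carrier A; u \<in> carrier U; v \<in> carrier U\<rbrakk>
           \<Longrightarrow> ract U (u \<otimes>\<^bsub>U\<^esub> v) a = ract U u a \<otimes>\<^bsub>U\<^esub> ract U v a"
    and "\<And>u. u \<in> carrier U \<Longrightarrow> lact U \<one>\<^bsub>A\<^esub> u = u"
    and "\<And>u. u \<in> carrier U \<Longrightarrow> ract U u \<one>\<^bsub>A\<^esub> = u"
    and "\<And>a b u. \<lbrakk>a \<in> carrier A; b \<in> carrier A; u \<in> carrier U\<rbrakk>
           \<Longrightarrow> lact U (a \<oplus>\<^bsub>A\<^esub> b) u = lact U a u \<otimes>\<^bsub>U\<^esub> lact U b u"
    and "\<And>a b u. \<lbrakk>a \<in> carrier A; b \<in> carrier A; u \<in> carrier U\<rbrakk>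
           \<Longrightarrow> ract U u (a \<oplus>\<^bsub>A\<^esub> b) = ract U u a \<otimes>\<^bsub>U\<^esub> ract U u b"
    and "\<And>a b u. \<lbrakk>a \<in> carrier A; b \<in> carrier A; u \<in> carrier U\<rbrakk>
           \<Longrightarrow> lact U (a \<otimes>\<^bsub>A\<^esub> b) u = lact U a (lact U b u)"
    and "\<And>a b u. \<lbrakk>a \<in> carrier A; b \<in> carrier A; u \<in> carrier U\<rbrakk>
           \<Longrightarrow> ract U u (a \<otimes>\<^bsub>A\<^esub> b) = ract U (ract U u a) b"
    and "\<And>a b u. \<lbrakk>a \<in> carrier A; b \<in> carrier A; u \<in> carrier U\<rbrakk>
           \<Longrightarrow> ract U (lact U a u) b = lact U a (ract U u b)"
    and "\<And>c u. \<lbrakk>c \<in> carrier k; u \<in> carrier U\<rbrakk>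
           \<Longrightarrow> lact U (c \<odot>\<^bsub>A\<^esub> \<one>\<^bsub>A\<^esub>) u = ract U u (c \<odot>\<^bsub>A\<^esub> \<one>\<^bsub>A\<^esub>)"
  shows "bimodule k A U"
  unfolding bimodule_def by (intro conjI ballI homI assms)

lemma bimoduleD:
  assumes "bimodule k A U"
  shows "comm_group U"
    and "\<And>a u. \<lbrakk>a \<in> carrier A; u \<in> carrier U\<rbrakk> \<Longrightarrow> lact U a u \<in> carrier U"
    and "\<And>a u. \<lbrakk>a \<in> carrier A; u \<in> carrier U\<rbrakk> \<Longrightarrow> ract U u a \<in> carrier U"
    and "\<And>a u v. \<lbrakk>a \<in> carrier A; u \<in> carrier U; v \<in> carrier U\<rbrakk>
           \<Longrightarrow> lact U a (u \<otimes>\<^bsub>U\<^esub> v) = lact U a u \<otimes>\<^bsub>U\<^esub> lact U a v"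
    and "\<And>a u v. \<lbrakk>a \<in> carrier A; u \<in> carrier U; v \<in> carrier U\<rbrakk>
           \<Longrightarrow> ract U (u \<otimes>\<^bsub>U\<^esub> v) a = ract U u a \<otimes>\<^bsub>U\<^esub> ract U v a"
    and "\<And>u. u \<in> carrier U \<Longrightarrow> lact U \<one>\<^bsub>A\<^esub> u = u"
    and "\<And>u. u \<in> carrier U \<Longrightarrow> ract U u \<one>\<^bsub>A\<^esub> = u"
    and "\<And>a b u. \<lbrakk>a \<in> carrier A; b \<in> carrier A; u \<in> carrier U\<rbrakk>
           \<Longrightarrow> lact U (a \<oplus>\<^bsub>A\<^esub> b) u = lact U a u \<otimes>\<^bsub>U\<^esub> lact U b u"
    and "\<And>a b u. \<lbrakk>a \<in> carrier A; b \<in> carrier A; u \<in> carrier U\<rbrakk>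
           \<Longrightarrow> ract U u (a \<oplus>\<^bsub>A\<^esub> b) = ract U u a \<otimes>\<^bsub>U\<^esub> ract U u b"
    and "\<And>a b u. \<lbrakk>a \<in> carrier A; b \<in> carrier A; u \<in> carrier U\<rbrakk>
           \<Longrightarrow> lact U (a \<otimes>\<^bsub>A\<^esub> b) u = lact U a (lact U b u)"
    and "\<And>a b u. \<lbrakk>a \<in> carrier A; b \<in> carrier A; u \<in> carrier U\<rbrakk>
           \<Longrightarrow> ract U u (a \<otimes>\<^bsub>A\<^esub> b) = ract U (ract U u a) b"
    and "\<And>a b u. \<lbrakk>a \<in> carrier A; b \<in> carrier A; u \<in> carrier U\<rbrakk>
           \<Longrightarrow> ract U (lact U a u) b = lact U a (ract U u b)"
    and "\<And>c u. \<lbrakk>c \<in> carrier k; u \<in> carrier U\<rbrakk>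
           \<Longrightarrow> lact U (c \<odot>\<^bsub>A\<^esub> \<one>\<^bsub>A\<^esub>) u = ract U u (c \<odot>\<^bsub>A\<^esub> \<one>\<^bsub>A\<^esub>)"
  using assms unfolding bimodule_def hom_def by auto

text \<open>The maps out of \<open>U \<otimes>\<^sub>A V\<close>, as functions of two arguments.\<close>

definition balanced ::
  "('a, 'u) bimod \<Rightarrow> ('a, 'u) bimod \<Rightarrow> ('g, 'n) monoid_scheme \<Rightarrow> ('u \<Rightarrow> 'u \<Rightarrow> 'g) \<Rightarrow> bool" where
  "balanced U V G f \<longleftrightarrow>
     (\<forall>u\<in>carrier U. \<forall>v\<in>carrier V. f u v \<in> carrier G) \<and>
     (\<forall>u\<in>carrier U. \<forall>u'\<in>carrier U. \<forall>v\<in>carrier V. f (u \<otimes>\<^bsub>U\<^esub> u') v = f u v \<otimes>\<^bsub>G\<^esub> f u' v) \<and>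
     (\<forall>u\<in>carrier U. \<forall>v\<in>carrier V. \<forall>v'\<in>carrier V. f u (v \<otimes>\<^bsub>V\<^esub> v') = f u v \<otimes>\<^bsub>G\<^esub> f u v') \<and>
     (\<forall>u\<in>carrier U. \<forall>a\<in>carrier A. \<forall>v\<in>carrier V. f (ract U u a) v = f u (lact V a v))"

lemma balancedI:
  assumes "\<And>u v. \<lbrakk>u \<in> carrier U; v \<in> carrier V\<rbrakk> \<Longrightarrow> f u v \<in> carrier G"
    and "\<And>u u' v. \<lbrakk>u \<in> carrier U; u' \<in> carrier U; v \<in> carrier V\<rbrakk>
           \<Longrightarrow> f (u \<otimes>\<^bsub>U\<^esub> u') v = f u v \<otimes>\<^bsub>G\<^esub> f u' v"
    and "\<And>u v v'. \<lbrakk>u \<in> carrier U; v \<in> carrier V; v' \<in> carrier V\<rbrakk>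
           \<Longrightarrow> f u (v \<otimes>\<^bsub>V\<^esub> v') = f u v \<otimes>\<^bsub>G\<^esub> f u v'"
    and "\<And>u a v. \<lbrakk>u \<in> carrier U; a \<in> carrier A; v \<in> carrier V\<rbrakk>
           \<Longrightarrow> f (ract U u a) v = f u (lact V a v)"
  shows "balanced U V G f"
  unfolding balanced_def by (intro conjI ballI assms)

lemma balancedD:
  assumes "balanced U V G f"
  shows "\<And>u v. \<lbrakk>u \<in> carrier U; v \<in> carrier V\<rbrakk> \<Longrightarrow> f u v \<in> carrier G"
    and "\<And>u u' v. \<lbrakk>u \<in> carrier U; u' \<in> carrier U; v \<in> carrier V\<rbrakk>
           \<Longrightarrow> f (u \<otimes>\<^bsub>U\<^esub> u') v = f u v \<otimes>\<^bsub>G\<^esub> f u' v"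
    and "\<And>u v v'. \<lbrakk>u \<in> carrier U; v \<in> carrier V; v' \<in> carrier V\<rbrakk>
           \<Longrightarrow> f u (v \<otimes>\<^bsub>V\<^esub> v') = f u v \<otimes>\<^bsub>G\<^esub> f u v'"
    and "\<And>u a v. \<lbrakk>u \<in> carrier U; a \<in> carrier A; v \<in> carrier V\<rbrakk>
           \<Longrightarrow> f (ract U u a) v = f u (lact V a v)"
  using assms unfolding balanced_def by auto

lemma balanced_rels_closed:
  assumes "bimodule k A U" "bimodule k A V"
  shows "balanced_rels A U V \<subseteq> carrier (free_Abelian_group (carrier U \<times> carrier V))"
proof -
  interpret U: comm_group U by (rule bimoduleD(1)[OF assms(1)])
  interpret V: comm_group V by (rule bimoduleD(1)[OF assms(2)])
  show ?thesis
    unfolding balanced_rels_def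
    by (rule subsetI; elim UnE CollectE exE conjE; hypsubst;
        unfold carrier_free_Abelian_group_iff; intro order_trans[OF keys_diff] Un_least)
       (simp_all add: bimoduleD[OF assms(1)] bimoduleD[OF assms(2)])
qed

end

text \<open>Bimodules with carrier in a fixed infinite type, so that tensor products stay inside this type.\<close>

locale bimodule_category = assoc_algebra k A
  for k :: "('k, 'r) ring_scheme" and A :: "('k, 'a, 's) module_scheme" +
  fixes univ :: "'u itself"
  assumes infinite_univ: "infinite (UNIV :: 'u set)"
begin

abbreviation bimod_prod :: "('a, 'u) bimod \<Rightarrow> ('a, 'u) bimod \<Rightarrow> ('a, 'u) bimod" (infixr "\<otimes>\<^sub>A" 75)
  where "U \<otimes>\<^sub>A V \<equiv> bimod_tensor A U V"

lemma tensor_group_simps: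
  fixes U V :: "('a, 'u) bimod"
  shows "carrier (U \<otimes>\<^sub>A V) = carrier (tensor_group A U V)"
    "monoid.mult (U \<otimes>\<^sub>A V) = monoid.mult (tensor_group A U V)"
  by (simp_all add: bimod_tensor_def monoid.defs)

lemma comm_group_iso:
  assumes "comm_group G" "h \<in> iso G H" "\<one>\<^bsub>H\<^esub> = h \<one>\<^bsub>G\<^esub>"
  shows "comm_group H"
  using comm_group.iso_imp_img_comm_group[OF assms(1,2)] by (simp add: assms(3)[symmetric])

context
  fixes U V :: "('a, 'u) bimod"
  assumes U: "bimodule k A U" and V: "bimodule k A V"
begin

lemma comm_group_tensor_quotient: "comm_group (tensor_quotient A U V)"
  unfolding tensor_quotient_def by (rule relation_group[OF balanced_rels_closed[OF U V]])

lemma tensor_embedding_iso: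
  shows "tensor_embedding A U V \<in> iso (tensor_quotient A U V) (tensor_group A U V)"
    "tensor_embedding A U V \<in> iso (tensor_quotient A U V) (U \<otimes>\<^sub>A V)"
proof -
  interpret Q: comm_group "tensor_quotient A U V" by (rule comm_group_tensor_quotient)
  note inj = inj_on_tensor_embedding[OF infinite_univ, of A U V]
  have "tensor_embedding A U V \<in> hom (tensor_quotient A U V) (tensor_group A U V)"
    unfolding tensor_group_def by (rule flatten_set_group_hom[OF Q.group_axioms inj])
  moreover have "carrier (tensor_group A U V) = tensor_embedding A U V ` carrier (tensor_quotient A U V)"
    by (simp add: tensor_group_def flatten_def)
  ultimately show "tensor_embedding A U V \<in> iso (tensor_quotient A U V) (tensor_group A U V)"
    "tensor_embedding A U V \<in> iso (tensor_quotient A U V) (U \<otimes>\<^sub>A V)"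
    using inj by (auto simp: iso_def bij_betw_def hom_def tensor_group_simps)
qed

lemma comm_group_tensor: "comm_group (tensor_group A U V)" "comm_group (U \<otimes>\<^sub>A V)"
  by (rule comm_group_iso[OF comm_group_tensor_quotient tensor_embedding_iso(1)],
      simp add: tensor_group_def flatten_def)
     (rule comm_group_iso[OF comm_group_tensor_quotient tensor_embedding_iso(2)],
      simp add: bimod_tensor_def monoid.defs tensor_group_def flatten_def)

lemma balanced_ptensor: "balanced U V (U \<otimes>\<^sub>A V) (ptensor A U V)"
proof -
  let ?S = "carrier U \<times> carrier V" and ?r = "balanced_rels A U V"
  let ?gen = "\<lambda>u v. presented_gen ?S ?r (u, v)" and ?e = "tensor_embedding A U V"
  interpret U: comm_group U by (rule bimoduleD(1)[OF U])
  interpret V: comm_group V by (rule bimoduleD(1)[OF V])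
  note rc = balanced_rels_closed[OF U V]
  note [simp] = bimoduleD[OF U] bimoduleD[OF V]
  have e: "?e \<in> hom (presented_group ?S ?r) (U \<otimes>\<^sub>A V)"
    using tensor_embedding_iso(2) by (simp add: tensor_quotient_def iso_def)
  have gen: "?gen u v \<in> carrier (presented_group ?S ?r)" if "u \<in> carrier U" "v \<in> carrier V" for u v
    using that by (intro relation_group(2)[OF rc]) simp
  have add: "?gen s t = ?gen u v \<otimes>\<^bsub>presented_group ?S ?r\<^esub> ?gen u' v'"
    if "{s, u, u'} \<subseteq> carrier U" "{t, v, v'} \<subseteq> carrier V"
      and rel: "frag_of (s, t) - frag_of (u, v) - frag_of (u', v') \<in> ?r" for s t u v u' v'
  proof -
    have keys: "Poly_Mapping.keys (frag_of (u, v) + frag_of (u', v')) \<subseteq> ?S"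
      using that by (intro order_trans[OF keys_add] Un_least) simp_all
    have "?gen s t = generate (free_Abelian_group ?S) ?r
        #>\<^bsub>free_Abelian_group ?S\<^esub> (frag_of (u, v) + frag_of (u', v'))"
      unfolding presented_gen_def
      by (rule relation_holds[OF rc _ keys]) (use that in \<open>simp_all add: diff_diff_add\<close>)
    then show ?thesis using that by (simp add: relation_mult[OF rc])
  qed
  show ?thesis
  proof (rule balancedI)
    fix u v assume "u \<in> carrier U" "v \<in> carrier V"
    then show "ptensor A U V u v \<in> carrier (U \<otimes>\<^sub>A V)"
      unfolding ptensor_def by (intro hom_in_carrier[OF e] gen)
  next
    fix u u' v assume *: "u \<in> carrier U" "u' \<in> carrier U" "v \<in> carrier V"
    have "?gen (u \<otimes>\<^bsub>U\<^esub> u') v = ?gen u v \<otimes>\<^bsub>presented_group ?S ?r\<^esub> ?gen u' v"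
      by (rule add) (use * in \<open>auto simp: balanced_rels_def\<close>)
    then show "ptensor A U V (u \<otimes>\<^bsub>U\<^esub> u') v = ptensor A U V u v \<otimes>\<^bsub>U \<otimes>\<^sub>A V\<^esub> ptensor A U V u' v"
      using * by (simp add: ptensor_def hom_mult[OF e] gen)
  next
    fix u v v' assume *: "u \<in> carrier U" "v \<in> carrier V" "v' \<in> carrier V"
    have "?gen u (v \<otimes>\<^bsub>V\<^esub> v') = ?gen u v \<otimes>\<^bsub>presented_group ?S ?r\<^esub> ?gen u v'"
      by (rule add) (use * in \<open>auto simp: balanced_rels_def\<close>)
    then show "ptensor A U V u (v \<otimes>\<^bsub>V\<^esub> v') = ptensor A U V u v \<otimes>\<^bsub>U \<otimes>\<^sub>A V\<^esub> ptensor A U V u v'"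
      using * by (simp add: ptensor_def hom_mult[OF e] gen)
  next
    fix u a v assume *: "u \<in> carrier U" "a \<in> carrier A" "v \<in> carrier V"
    then have rel: "frag_of (ract U u a, v) - frag_of (u, lact V a v) \<in> ?r"
      unfolding balanced_rels_def by blast
    have "?gen (ract U u a) v = ?gen u (lact V a v)"
      unfolding presented_gen_def
      by (rule relation_holds[OF rc _ _ rel]) (use * in simp_all)
    then show "ptensor A U V (ract U u a) v = ptensor A U V u (lact V a v)"
      by (simp add: ptensor_def)
  qed
qed

lemmas ptensor = balancedD[OF balanced_ptensor]

lemma tensor_lift:
  assumes G: "comm_group G" and f: "balanced U V G f"
  shows "tensor_lift A U V G f \<in> hom (U \<otimes>\<^sub>A V) G"
    and "\<lbrakk>u \<in> carrier U; v \<in> carrier V\<rbrakk> \<Longrightarrow> tensor_lift A U V G f (ptensor A U V u v) = f u v"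
proof -
  interpret G: comm_group G by fact
  interpret U: comm_group U by (rule bimoduleD(1)[OF U])
  interpret V: comm_group V by (rule bimoduleD(1)[OF V])
  let ?S = "carrier U \<times> carrier V"
  note [simp] = bimoduleD[OF U] bimoduleD[OF V]
  have fc: "(\<lambda>(u, v). f u v) \<in> ?S \<rightarrow> carrier G" using balancedD(1)[OF f] by auto
  have kill: "h r = \<one>\<^bsub>G\<^esub>"
    if h: "h \<in> hom (free_Abelian_group ?S) G"
        "\<And>s. s \<in> ?S \<Longrightarrow> h (frag_of s) = (case s of (u, v) \<Rightarrow> f u v)"
      and r: "r \<in> balanced_rels A U V" for h r
  proof -
    note minus = hom_free_Abelian_group_minus[OF G.group_axioms h(1)]
    have keys: "Poly_Mapping.keys (frag_of s - frag_of t) \<subseteq> ?S" if "s \<in> ?S" "t \<in> ?S" for s t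
      using that by (intro order_trans[OF keys_diff] Un_least) simp_all
    have hf: "h (frag_of (u, v)) = f u v" if "u \<in> carrier U" "v \<in> carrier V" for u v
      using h(2)[of "(u, v)"] that by simp
    show ?thesis
      using r unfolding balanced_rels_def
      by (elim UnE CollectE exE conjE; hypsubst)
         (simp_all add: minus keys hf balancedD[OF f] G.m_comm G.m_assoc[symmetric])
  qed
  have \<pi>: "(case s of (u, v) \<Rightarrow> ptensor A U V u v) =
      tensor_embedding A U V (presented_gen ?S (balanced_rels A U V) s)" for s
    by (simp add: ptensor_def split: prod.split)
  note * = induced_hom[OF balanced_rels_closed[OF U V]
      tensor_embedding_iso(1)[unfolded tensor_quotient_def] comm_group_tensor(1) \<pi> G fc]
  have "tensor_lift A U V G f \<in> hom (tensor_group A U V) G"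
    unfolding tensor_lift_def by (rule *(1)) (erule kill, blast, assumption)
  then show "tensor_lift A U V G f \<in> hom (U \<otimes>\<^sub>A V) G"
    by (simp add: hom_def tensor_group_simps)
  show "tensor_lift A U V G f (ptensor A U V u v) = f u v" if "u \<in> carrier U" "v \<in> carrier V"
  proof -
    have "tensor_lift A U V G f (case (u, v) of (u, v) \<Rightarrow> ptensor A U V u v) = (case (u, v) of (u, v) \<Rightarrow> f u v)"
      unfolding tensor_lift_def by (rule *(2)) (erule kill, blast, assumption, use that in simp)
    then show ?thesis by simp
  qed
qed

text \<open>The neutral element and inverses are covered by the first case: \<open>1 = 1 \<otimes> v\<close> and \<open>(u \<otimes> v)\<^sup>-\<^sup>1 = u\<^sup>-\<^sup>1 \<otimes> v\<close> are themselves
  pure tensors (the additive groups being written multiplicatively).\<close>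

lemma tensor_induct [consumes 1, case_names ptensor mult]:
  assumes x: "x \<in> carrier (U \<otimes>\<^sub>A V)"
    and p: "\<And>u v. \<lbrakk>u \<in> carrier U; v \<in> carrier V\<rbrakk> \<Longrightarrow> P (ptensor A U V u v)"
    and m: "\<And>x y. \<lbrakk>x \<in> carrier (U \<otimes>\<^sub>A V); y \<in> carrier (U \<otimes>\<^sub>A V); P x; P y\<rbrakk> \<Longrightarrow> P (x \<otimes>\<^bsub>U \<otimes>\<^sub>A V\<^esub> y)"
  shows "P x"
proof -
  let ?Q = "tensor_quotient A U V" and ?S = "carrier U \<times> carrier V"
  let ?gen = "presented_gen ?S (balanced_rels A U V)" and ?e = "tensor_embedding A U V"
  interpret U: comm_group U by (rule bimoduleD(1)[OF U])
  interpret V: comm_group V by (rule bimoduleD(1)[OF V])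
  interpret W: comm_group "U \<otimes>\<^sub>A V" by (rule comm_group_tensor)
  interpret Q: comm_group ?Q by (rule comm_group_tensor_quotient)
  note e = tensor_embedding_iso(2)
  interpret e: group_hom ?Q "U \<otimes>\<^sub>A V" ?e using e by unfold_locales (simp add: iso_def)
  note rg = relation_group[OF balanced_rels_closed[OF U V]]
  have img: "?e ` ?gen ` ?S = (\<lambda>(u, v). ptensor A U V u v) ` ?S"
    by (auto simp: ptensor_def image_image intro!: image_cong)
  have span: "generate (U \<otimes>\<^sub>A V) ((\<lambda>(u, v). ptensor A U V u v) ` ?S) = carrier (U \<otimes>\<^sub>A V)"
  proof -
    have "generate (U \<otimes>\<^sub>A V) (?e ` ?gen ` ?S) = ?e ` generate ?Q (?gen ` ?S)"
      by (rule e.generate_img) (use rg(2) in \<open>auto simp: tensor_quotient_def\<close>)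
    also have "\<dots> = carrier (U \<otimes>\<^sub>A V)"
      using e rg(3) by (simp add: tensor_quotient_def iso_def bij_betw_def)
    finally show ?thesis by (simp only: img)
  qed
  have ptensor_one: "ptensor A U V \<one>\<^bsub>U\<^esub> v = \<one>\<^bsub>U \<otimes>\<^sub>A V\<^esub>" if "v \<in> carrier V" for v
    using ptensor(2)[of "\<one>\<^bsub>U\<^esub>" "\<one>\<^bsub>U\<^esub>" v] ptensor(1)[of "\<one>\<^bsub>U\<^esub>" v] that by (simp add: W.l_cancel_one')
  have inv_ptensor: "inv\<^bsub>U \<otimes>\<^sub>A V\<^esub> ptensor A U V u v = ptensor A U V (inv\<^bsub>U\<^esub> u) v"
    if "u \<in> carrier U" "v \<in> carrier V" for u v
    by (rule W.inv_equality) (use that ptensor(1) in \<open>simp_all add: ptensor(2)[symmetric] ptensor_one\<close>)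
  have "x \<in> generate (U \<otimes>\<^sub>A V) ((\<lambda>(u, v). ptensor A U V u v) ` ?S)" using x span by simp
  then show ?thesis
  proof (induction rule: generate.induct)
    case one
    show ?case using p[of "\<one>\<^bsub>U\<^esub>" "\<one>\<^bsub>V\<^esub>"] ptensor_one[of "\<one>\<^bsub>V\<^esub>"] by simp
  next
    case (incl h)
    then show ?case using p by auto
  next
    case (inv h)
    then show ?case using p by (auto simp: inv_ptensor)
  next
    case (eng h1 h2)
    then show ?case using m span by blast
  qed
qed

lemma tensor_hom_eq:
  assumes "h \<in> hom (U \<otimes>\<^sub>A V) G" "h' \<in> hom (U \<otimes>\<^sub>A V) G"
    and "\<And>u v. \<lbrakk>u \<in> carrier U; v \<in> carrier V\<rbrakk> \<Longrightarrow> h (ptensor A U V u v) = h' (ptensor A U V u v)"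
    and "x \<in> carrier (U \<otimes>\<^sub>A V)"
  shows "h x = h' x"
  using assms(4) by (induction rule: tensor_induct) (simp_all add: assms(3) hom_mult[OF assms(1)] hom_mult[OF assms(2)])

lemma tensor_actions:
  assumes a: "a \<in> carrier A"
  shows "lact (U \<otimes>\<^sub>A V) a \<in> hom (U \<otimes>\<^sub>A V) (U \<otimes>\<^sub>A V)"
    and "\<lbrakk>u \<in> carrier U; v \<in> carrier V\<rbrakk> \<Longrightarrow>
      lact (U \<otimes>\<^sub>A V) a (ptensor A U V u v) = ptensor A U V (lact U a u) v"
    and "(\<lambda>x. ract (U \<otimes>\<^sub>A V) x a) \<in> hom (U \<otimes>\<^sub>A V) (U \<otimes>\<^sub>A V)"
    and "\<lbrakk>u \<in> carrier U; v \<in> carrier V\<rbrakk> \<Longrightarrow>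
      ract (U \<otimes>\<^sub>A V) (ptensor A U V u v) a = ptensor A U V u (ract V v a)"
proof -
  note [simp] = bimoduleD[OF U] bimoduleD[OF V] ptensor
  have l: "balanced U V (tensor_group A U V) (\<lambda>u v. ptensor A U V (lact U a u) v)"
    using a by (intro balancedI)
      (simp_all flip: tensor_group_simps, simp only: bimoduleD(2)[OF U] ptensor(4) flip: bimoduleD(12)[OF U])
  have r: "balanced U V (tensor_group A U V) (\<lambda>u v. ptensor A U V u (ract V v a))"
    using a by (intro balancedI) (simp_all flip: tensor_group_simps)
  note lift = tensor_lift[OF comm_group_tensor(1)]
  show "lact (U \<otimes>\<^sub>A V) a \<in> hom (U \<otimes>\<^sub>A V) (U \<otimes>\<^sub>A V)"
    "(\<lambda>x. ract (U \<otimes>\<^sub>A V) x a) \<in> hom (U \<otimes>\<^sub>A V) (U \<otimes>\<^sub>A V)"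
    using lift(1)[OF l] lift(1)[OF r]
    by (simp_all add: hom_def tensor_group_simps) (simp_all add: bimod_tensor_def monoid.defs)
  show "lact (U \<otimes>\<^sub>A V) a (ptensor A U V u v) = ptensor A U V (lact U a u) v"
    "ract (U \<otimes>\<^sub>A V) (ptensor A U V u v) a = ptensor A U V u (ract V v a)"
    if "u \<in> carrier U" "v \<in> carrier V"
    using lift(2)[OF l that] lift(2)[OF r that] by (simp_all add: bimod_tensor_def monoid.defs)
qed

lemma bimodule_tensor: "bimodule k A (U \<otimes>\<^sub>A V)"
proof -
  interpret W: comm_group "U \<otimes>\<^sub>A V" by (rule comm_group_tensor)
  note [simp] = bimoduleD[OF U] bimoduleD[OF V] ptensor tensor_actions(2,4)
    hom_in_carrier[OF tensor_actions(1)] hom_in_carrier[OF tensor_actions(3)]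
    hom_mult[OF tensor_actions(1)] hom_mult[OF tensor_actions(3)]
  show ?thesis
  proof (rule bimoduleI)
    fix u assume u: "u \<in> carrier (U \<otimes>\<^sub>A V)"
    show "lact (U \<otimes>\<^sub>A V) \<one>\<^bsub>A\<^esub> u = u" "ract (U \<otimes>\<^sub>A V) u \<one>\<^bsub>A\<^esub> = u"
      using u by (induction rule: tensor_induct) simp_all
    show "lact (U \<otimes>\<^sub>A V) (c \<odot>\<^bsub>A\<^esub> \<one>\<^bsub>A\<^esub>) u = ract (U \<otimes>\<^sub>A V) u (c \<odot>\<^bsub>A\<^esub> \<one>\<^bsub>A\<^esub>)" if c: "c \<in> carrier k" for c
      using u by (induction rule: tensor_induct)
        (simp_all add: c)
    fix a b assume [simp]: "a \<in> carrier A" "b \<in> carrier A"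
    show "lact (U \<otimes>\<^sub>A V) (a \<oplus>\<^bsub>A\<^esub> b) u = lact (U \<otimes>\<^sub>A V) a u \<otimes>\<^bsub>U \<otimes>\<^sub>A V\<^esub> lact (U \<otimes>\<^sub>A V) b u"
      "ract (U \<otimes>\<^sub>A V) u (a \<oplus>\<^bsub>A\<^esub> b) = ract (U \<otimes>\<^sub>A V) u a \<otimes>\<^bsub>U \<otimes>\<^sub>A V\<^esub> ract (U \<otimes>\<^sub>A V) u b"
      "lact (U \<otimes>\<^sub>A V) (a \<otimes>\<^bsub>A\<^esub> b) u = lact (U \<otimes>\<^sub>A V) a (lact (U \<otimes>\<^sub>A V) b u)"
      "ract (U \<otimes>\<^sub>A V) u (a \<otimes>\<^bsub>A\<^esub> b) = ract (U \<otimes>\<^sub>A V) (ract (U \<otimes>\<^sub>A V) u a) b"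
      "ract (U \<otimes>\<^sub>A V) (lact (U \<otimes>\<^sub>A V) a u) b = lact (U \<otimes>\<^sub>A V) a (ract (U \<otimes>\<^sub>A V) u b)"
      using u by (induction rule: tensor_induct) (simp_all add: W.m_ac)
  qed (simp_all add: W.comm_group_axioms)
qed

end

lemma bimod_homD:
  assumes "f \<in> bimod_hom A U V"
  shows "f \<in> hom U V" "\<And>u. u \<in> carrier U \<Longrightarrow> f u \<in> carrier V"
    and "\<And>u u'. \<lbrakk>u \<in> carrier U; u' \<in> carrier U\<rbrakk> \<Longrightarrow> f (u \<otimes>\<^bsub>U\<^esub> u') = f u \<otimes>\<^bsub>V\<^esub> f u'"
    and "\<And>a u. \<lbrakk>a \<in> carrier A; u \<in> carrier U\<rbrakk> \<Longrightarrow> f (lact U a u) = lact V a (f u)"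
    and "\<And>a u. \<lbrakk>a \<in> carrier A; u \<in> carrier U\<rbrakk> \<Longrightarrow> f (ract U u a) = ract V (f u) a"
  using assms unfolding bimod_hom_def hom_def by auto

lemma bimod_hom_id: "(\<lambda>u. u) \<in> bimod_hom A U U"
  by (simp add: bimod_hom_def hom_def)

lemma tensor_map:
  assumes B: "bimodule k A U" "bimodule k A V" "bimodule k A U'" "bimodule k A V'"
    and f: "f \<in> bimod_hom A U U'" and g: "g \<in> bimod_hom A V V'"
  shows "tensor_map A U V U' V' f g \<in> hom (U \<otimes>\<^sub>A V) (U' \<otimes>\<^sub>A V')"
    and "\<lbrakk>u \<in> carrier U; v \<in> carrier V\<rbrakk> \<Longrightarrow>
      tensor_map A U V U' V' f g (ptensor A U V u v) = ptensor A U' V' (f u) (g v)"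
proof -
  have bal: "balanced U V (U' \<otimes>\<^sub>A V') (\<lambda>u v. ptensor A U' V' (f u) (g v))"
    by (rule balancedI) (simp_all add: bimod_homD[OF f] bimod_homD[OF g] ptensor[OF B(3,4)])
  show "tensor_map A U V U' V' f g \<in> hom (U \<otimes>\<^sub>A V) (U' \<otimes>\<^sub>A V')"
    "\<lbrakk>u \<in> carrier U; v \<in> carrier V\<rbrakk> \<Longrightarrow>
      tensor_map A U V U' V' f g (ptensor A U V u v) = ptensor A U' V' (f u) (g v)"
    unfolding tensor_map_def
    using tensor_lift[OF B(1,2) comm_group_tensor(2)[OF B(3,4)] bal] by simp_all
qed

lemma associator_ptensor:
  assumes U: "bimodule k A U" and V: "bimodule k A V" and W: "bimodule k A W"
    and uvw: "u \<in> carrier U" "v \<in> carrier V" "w \<in> carrier W"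
  shows "associator A U V W (ptensor A (U \<otimes>\<^sub>A V) W (ptensor A U V u v) w) =
    ptensor A U (V \<otimes>\<^sub>A W) u (ptensor A V W v w)"
proof -
  note UV = bimodule_tensor[OF U V] and VW = bimodule_tensor[OF V W]
  let ?G = "U \<otimes>\<^sub>A V \<otimes>\<^sub>A W"
  interpret G: comm_group ?G by (rule comm_group_tensor(2)[OF U VW])
  interpret W: comm_group W by (rule bimoduleD(1)[OF W])
  define h where "h w = tensor_lift A U V ?G (\<lambda>u v. ptensor A U (V \<otimes>\<^sub>A W) u (ptensor A V W v w))" for w
  note [simp] = bimoduleD[OF U] bimoduleD[OF V] bimoduleD[OF W] bimoduleD[OF UV] bimoduleD[OF VW]
    ptensor[OF U V] ptensor[OF V W] ptensor[OF U VW]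
    tensor_actions(2,4)[OF U V] tensor_actions(2,4)[OF V W]
  have bal: "balanced U V ?G (\<lambda>u v. ptensor A U (V \<otimes>\<^sub>A W) u (ptensor A V W v w))"
    if "w \<in> carrier W" for w
    by (rule balancedI) (simp_all add: that)
  note h = tensor_lift[OF U V G.comm_group_axioms bal, folded h_def]
  note [simp] = h(2) hom_in_carrier[OF h(1)] hom_mult[OF h(1)]
  have bal': "balanced (U \<otimes>\<^sub>A V) W ?G (\<lambda>t w. h w t)"
  proof (rule balancedI)
    fix t w w' assume t: "t \<in> carrier (U \<otimes>\<^sub>A V)" and [simp]: "w \<in> carrier W" "w' \<in> carrier W"
    show "h (w \<otimes>\<^bsub>W\<^esub> w') t = h w t \<otimes>\<^bsub>?G\<^esub> h w' t"
      using t by (induction rule: tensor_induct[OF U V, consumes 1])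
        (simp_all add: G.m_ac)
  next
    fix t a w assume t: "t \<in> carrier (U \<otimes>\<^sub>A V)" and [simp]: "a \<in> carrier A" "w \<in> carrier W"
    show "h w (ract (U \<otimes>\<^sub>A V) t a) = h (lact W a w) t"
      using t by (induction rule: tensor_induct[OF U V, consumes 1]) simp_all
  qed simp_all
  have "associator A U V W = tensor_lift A (U \<otimes>\<^sub>A V) W ?G (\<lambda>t w. h w t)"
    by (simp add: associator_def h_def)
  then show ?thesis
    using tensor_lift(2)[OF UV W G.comm_group_axioms bal'] uvw by simp
qed

end


section \<open>The unit object and a free bimodule\<close>

text \<open>If \<open>A\<close> embeds into the type of the bimodules, then \<open>A\<close> and \<open>A \<otimes> A\<close> are objects of the category.\<close>

locale small_bimodule_category = bimodule_category k A univ
  for k :: "('k, 'r) ring_scheme" and A :: "('k, 'a, 's) module_scheme" and univ :: "'u itself" +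
  assumes A_small: "carrier A \<lesssim> (UNIV :: 'u set)"
begin

definition emb :: "'a \<Rightarrow> 'u" where "emb = (SOME j. inj_on j (carrier A))"

definition proj :: "'u \<Rightarrow> 'a" where "proj = inv_into (carrier A) emb"

definition unit :: "('a, 'u) bimod" where
  "unit = \<lparr>carrier = emb ` carrier A, monoid.mult = (\<lambda>x y. emb (proj x \<oplus>\<^bsub>A\<^esub> proj y)),
     one = emb \<zero>\<^bsub>A\<^esub>, lact = (\<lambda>a x. emb (a \<otimes>\<^bsub>A\<^esub> proj x)), ract = (\<lambda>x a. emb (proj x \<otimes>\<^bsub>A\<^esub> a))\<rparr>"

lemma inj_emb: "inj_on emb (carrier A)"
proof -
  have "\<exists>j :: 'a \<Rightarrow> 'u. inj_on j (carrier A)" using A_small by (auto simp: lepoll_def)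
  then show ?thesis unfolding emb_def by (rule someI_ex)
qed

lemma proj_emb [simp]: "a \<in> carrier A \<Longrightarrow> proj (emb a) = a"
  unfolding proj_def by (rule inv_into_f_f[OF inj_emb])

lemma emb_unit [simp]: "a \<in> carrier A \<Longrightarrow> emb a \<in> carrier unit"
  by (simp add: unit_def)

lemma proj_unit:
  "x \<in> carrier unit \<Longrightarrow> proj x \<in> carrier A" "x \<in> carrier unit \<Longrightarrow> emb (proj x) = x"
  by (auto simp: unit_def)

lemma unit_simps:
  "x \<otimes>\<^bsub>unit\<^esub> y = emb (proj x \<oplus>\<^bsub>A\<^esub> proj y)"
  "lact unit a x = emb (a \<otimes>\<^bsub>A\<^esub> proj x)" "ract unit x a = emb (proj x \<otimes>\<^bsub>A\<^esub> a)"
  by (simp_all add: unit_def)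

lemma bimodule_unit: "bimodule k A unit"
proof (rule bimoduleI)
  have "emb \<in> iso (add_monoid A) unit"
    using inj_emb by (auto simp: iso_def hom_def bij_betw_def unit_def)
  then show "comm_group unit"
    by (rule comm_group_iso[OF M.a_comm_group]) (simp add: unit_def)
qed (auto simp: unit_simps proj_unit A.l_distr A.r_distr A.m_assoc smult_mult_left smult_mult_right)

context
  fixes U :: "('a, 'u) bimod"
  assumes U: "bimodule k A U"
begin

definition left_unit :: "'u \<Rightarrow> 'u" where
  "left_unit = tensor_lift A unit U U (\<lambda>x u. lact U (proj x) u)"

lemma left_unit:
  "left_unit \<in> hom (unit \<otimes>\<^sub>A U) U"
  "\<lbrakk>a \<in> carrier A; u \<in> carrier U\<rbrakk> \<Longrightarrow> left_unit (ptensor A unit U (emb a) u) = lact U a u"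
proof -
  have bal: "balanced unit U U (\<lambda>x u. lact U (proj x) u)"
    by (rule balancedI) (simp_all add: unit_simps proj_unit bimoduleD[OF U])
  note tensor_lift[OF bimodule_unit U bimoduleD(1)[OF U] bal, folded left_unit_def]
  then show "left_unit \<in> hom (unit \<otimes>\<^sub>A U) U"
    "\<lbrakk>a \<in> carrier A; u \<in> carrier U\<rbrakk> \<Longrightarrow> left_unit (ptensor A unit U (emb a) u) = lact U a u" by simp_all
qed

lemma ptensor_unit_inject:
  assumes "u \<in> carrier U" "v \<in> carrier U"
    and "ptensor A unit U (emb \<one>\<^bsub>A\<^esub>) u = ptensor A unit U (emb \<one>\<^bsub>A\<^esub>) v"
  shows "u = v"
  using arg_cong[OF assms(3), of left_unit] assms(1,2) by (simp add: left_unit(2) bimoduleD[OF U])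

lemma ptensor_unit_inject_right:
  assumes "u \<in> carrier U" "v \<in> carrier U"
    and eq: "ptensor A U unit u (emb \<one>\<^bsub>A\<^esub>) = ptensor A U unit v (emb \<one>\<^bsub>A\<^esub>)"
  shows "u = v"
proof -
  have bal: "balanced U unit U (\<lambda>u x. ract U u (proj x))"
    by (rule balancedI) (simp_all add: unit_simps proj_unit bimoduleD[OF U])
  note tensor_lift(2)[OF U bimodule_unit bimoduleD(1)[OF U] bal]
  from this[of _ "emb \<one>\<^bsub>A\<^esub>"] show ?thesis
    using arg_cong[OF eq, of "tensor_lift A U unit U (\<lambda>u x. ract U u (proj x))"] assms(1,2)
    by (simp add: bimoduleD[OF U])
qed

text \<open>Moving the coefficient across the tensor sign shows that \<open>A \<otimes>\<^sub>A U\<close> consists of the tensors \<open>1 \<otimes> u\<close>.\<close>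

lemma ptensor_unit_emb:
  assumes "a \<in> carrier A" "u \<in> carrier U"
  shows "ptensor A unit U (emb a) u = ptensor A unit U (emb \<one>\<^bsub>A\<^esub>) (lact U a u)"
  using ptensor(4)[OF bimodule_unit U, of "emb \<one>\<^bsub>A\<^esub>" a u] assms by (simp add: unit_simps)

lemma unit_tensor_cases:
  assumes "x \<in> carrier (unit \<otimes>\<^sub>A U)"
  obtains u where "u \<in> carrier U" "x = ptensor A unit U (emb \<one>\<^bsub>A\<^esub>) u"
proof -
  interpret U: comm_group U by (rule bimoduleD(1)[OF U])
  have "\<exists>u\<in>carrier U. x = ptensor A unit U (emb \<one>\<^bsub>A\<^esub>) u"
    using assms
  proof (induction rule: tensor_induct[OF bimodule_unit U, consumes 1])
    case (1 x u)
    then show ?case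
      using ptensor_unit_emb[of "proj x" u] bimoduleD(2)[OF U] by (auto simp: proj_unit)
  next
    case (2 x y)
    then show ?case
      using ptensor(3)[OF bimodule_unit U, of "emb \<one>\<^bsub>A\<^esub>"] by (metis A.one_closed U.m_closed emb_unit)
  qed
  with that show ?thesis by blast
qed

end


lemma unit_cyclic: "a \<in> carrier A \<Longrightarrow> lact unit a (emb \<one>\<^bsub>A\<^esub>) = emb a"
  "a \<in> carrier A \<Longrightarrow> ract unit (emb \<one>\<^bsub>A\<^esub>) a = emb a"
  by (simp_all add: unit_simps)

end

text \<open>The free bimodule \<open>A \<otimes>\<^sub>k A\<close> is obtained from the tensor product of bimodules over the base ring, viewed as
  an algebra over itself. In this way the universal property and the embedding into the type of the
  bimodules are shared with \<open>\<otimes>\<^sub>A\<close>.\<close>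

definition self_algebra :: "('k, 'r) ring_scheme \<Rightarrow> ('k, 'k) module" where
  "self_algebra k = \<lparr>carrier = carrier k, monoid.mult = monoid.mult k, one = \<one>\<^bsub>k\<^esub>,
     zero = \<zero>\<^bsub>k\<^esub>, add = add k, smult = monoid.mult k\<rparr>"

lemma assoc_algebra_self:
  assumes "cring k" shows "assoc_algebra k (self_algebra k)"
proof -
  interpret k: cring k by fact
  have ring: "ring (self_algebra k)"
  proof (rule ringI)
    show "abelian_group (self_algebra k)"
    proof (rule abelian_groupI)
      fix x assume "x \<in> carrier (self_algebra k)"
      then show "\<exists>y\<in>carrier (self_algebra k). y \<oplus>\<^bsub>self_algebra k\<^esub> x = \<zero>\<^bsub>self_algebra k\<^esub>"
        by (intro bexI[of _ "\<ominus>\<^bsub>k\<^esub> x"]) (auto simp: self_algebra_def k.l_neg)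
    qed (auto simp: self_algebra_def k.a_ac)
    show "monoid (self_algebra k)"
      by (rule monoidI) (auto simp: self_algebra_def k.m_assoc)
  qed (auto simp: self_algebra_def k.l_distr k.r_distr)
  show ?thesis
  proof (intro assoc_algebra.intro ring moduleI k.cring_axioms)
    show "abelian_group (self_algebra k)" using ring by (rule ring.is_abelian_group)
  qed (unfold_locales, auto simp: self_algebra_def k.l_distr k.r_distr k.m_ac)
qed

definition restrict_scalars ::
  "('k, 'a, 's) module_scheme \<Rightarrow> ('a, 'u) bimod \<Rightarrow> ('k, 'u) bimod" where
  "restrict_scalars A U = \<lparr>carrier = carrier U, monoid.mult = monoid.mult U, one = \<one>\<^bsub>U\<^esub>,
     lact = (\<lambda>c. lact U (c \<odot>\<^bsub>A\<^esub> \<one>\<^bsub>A\<^esub>)), ract = (\<lambda>u c. ract U u (c \<odot>\<^bsub>A\<^esub> \<one>\<^bsub>A\<^esub>))\<rparr>"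

context small_bimodule_category
begin

sublocale k: bimodule_category k "self_algebra k" univ
  by (intro bimodule_category.intro assoc_algebra_self bimodule_category_axioms.intro infinite_univ)
     (rule R.cring_axioms)

abbreviation unit_k :: "('k, 'u) bimod" where "unit_k \<equiv> restrict_scalars A unit"

lemma carrier_self: "carrier (self_algebra k) = carrier k"
  by (simp add: self_algebra_def)

lemma unit_k_simps:
  "carrier unit_k = carrier unit" "monoid.mult unit_k = monoid.mult unit"
  "lact unit_k c x = emb (c \<odot>\<^bsub>A\<^esub> \<one>\<^bsub>A\<^esub> \<otimes>\<^bsub>A\<^esub> proj x)"
  "ract unit_k x c = emb (proj x \<otimes>\<^bsub>A\<^esub> (c \<odot>\<^bsub>A\<^esub> \<one>\<^bsub>A\<^esub>))"
  by (simp_all add: restrict_scalars_def unit_simps)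

lemma smult_left_commute:
  "\<lbrakk>c \<in> carrier k; d \<in> carrier k; x \<in> carrier A\<rbrakk> \<Longrightarrow> c \<odot>\<^bsub>A\<^esub> (d \<odot>\<^bsub>A\<^esub> x) = d \<odot>\<^bsub>A\<^esub> (c \<odot>\<^bsub>A\<^esub> x)"
  using R.m_comm[of c d] by (simp flip: smult_assoc1)

lemma bimodule_unit_k: "bimodule k (self_algebra k) unit_k"
proof (rule k.bimoduleI)
  show "comm_group unit_k"
    by (rule comm_group_iso[OF bimoduleD(1)[OF bimodule_unit], of "\<lambda>x. x"])
       (auto simp: restrict_scalars_def iso_def hom_def bij_betw_def)
qed (auto simp: unit_k_simps self_algebra_def unit_simps proj_unit A.l_distr A.r_distr A.m_assoc
    smult_left_commute smult_mult_left smult_mult_right smult_l_distr smult_r_distr smult_assoc1)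

abbreviation unit_square :: "('k, 'u) bimod" where
  "unit_square \<equiv> bimod_tensor (self_algebra k) unit_k unit_k"

abbreviation pair :: "'u \<Rightarrow> 'u \<Rightarrow> 'u" where
  "pair x y \<equiv> ptensor (self_algebra k) unit_k unit_k x y"

definition free_bimod :: "('a, 'u) bimod" where
  "free_bimod = monoid.extend (tensor_group (self_algebra k) unit_k unit_k)
     \<lparr>lact = (\<lambda>a. tensor_map (self_algebra k) unit_k unit_k unit_k unit_k (lact unit a) (\<lambda>y. y)),
      ract = (\<lambda>x a. tensor_map (self_algebra k) unit_k unit_k unit_k unit_k (\<lambda>x. x) (\<lambda>y. ract unit y a) x)\<rparr>"

definition free_gen :: 'u where "free_gen = pair (emb \<one>\<^bsub>A\<^esub>) (emb \<one>\<^bsub>A\<^esub>)"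

lemma free_bimod_simps:
  "carrier free_bimod = carrier unit_square" "monoid.mult free_bimod = monoid.mult unit_square"
  "\<one>\<^bsub>free_bimod\<^esub> = \<one>\<^bsub>unit_square\<^esub>"
  by (simp_all add: free_bimod_def bimod_tensor_def monoid.defs)

lemma unit_actions_hom:
  assumes "a \<in> carrier A"
  shows "lact unit a \<in> bimod_hom (self_algebra k) unit_k unit_k"
    and "(\<lambda>x. ract unit x a) \<in> bimod_hom (self_algebra k) unit_k unit_k"
  using assms by (auto simp: bimod_hom_def hom_def unit_k_simps unit_simps proj_unit carrier_self
      A.l_distr A.r_distr A.m_assoc smult_mult_left smult_mult_right)

lemma free_actions:
  assumes a: "a \<in> carrier A"
  shows "lact free_bimod a \<in> hom unit_square unit_square"
    and "\<lbrakk>x \<in> carrier unit; y \<in> carrier unit\<rbrakk> \<Longrightarrow> lact free_bimod a (pair x y) = pair (lact unit a x) y"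
    and "(\<lambda>t. ract free_bimod t a) \<in> hom unit_square unit_square"
    and "\<lbrakk>x \<in> carrier unit; y \<in> carrier unit\<rbrakk> \<Longrightarrow> ract free_bimod (pair x y) a = pair x (ract unit y a)"
proof -
  note B = bimodule_unit_k bimodule_unit_k bimodule_unit_k bimodule_unit_k
  note l = k.tensor_map[OF B unit_actions_hom(1)[OF a] k.bimod_hom_id]
  note r = k.tensor_map[OF B k.bimod_hom_id unit_actions_hom(2)[OF a]]
  show "lact free_bimod a \<in> hom unit_square unit_square"
    and "\<lbrakk>x \<in> carrier unit; y \<in> carrier unit\<rbrakk> \<Longrightarrow> lact free_bimod a (pair x y) = pair (lact unit a x) y"
    and "(\<lambda>t. ract free_bimod t a) \<in> hom unit_square unit_square"
    and "\<lbrakk>x \<in> carrier unit; y \<in> carrier unit\<rbrakk> \<Longrightarrow> ract free_bimod (pair x y) a = pair x (ract unit y a)"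
    using l r by (simp_all add: free_bimod_def monoid.defs unit_k_simps)
qed

lemmas pair = k.ptensor[OF bimodule_unit_k bimodule_unit_k, unfolded unit_k_simps carrier_self]

lemmas square_induct = k.tensor_induct[OF bimodule_unit_k bimodule_unit_k, unfolded unit_k_simps(1), consumes 1, case_names gen mult]

lemma bimodule_free: "bimodule k A free_bimod"
proof -
  note cg = k.comm_group_tensor(2)[OF bimodule_unit_k bimodule_unit_k]
  interpret W: comm_group unit_square by (rule cg)
  note [simp] = bimoduleD[OF bimodule_unit] pair(1-3) free_actions(2,4)
    hom_in_carrier[OF free_actions(1)] hom_in_carrier[OF free_actions(3)]
    hom_mult[OF free_actions(1)] hom_mult[OF free_actions(3)]
  have add: "pair (x \<otimes>\<^bsub>unit\<^esub> x') y = pair x y \<otimes>\<^bsub>unit_square\<^esub> pair x' y"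
    "pair y (x \<otimes>\<^bsub>unit\<^esub> x') = pair y x \<otimes>\<^bsub>unit_square\<^esub> pair y x'"
    if "x \<in> carrier unit" "x' \<in> carrier unit" "y \<in> carrier unit" for x x' y
    using pair(2,3) that by (simp_all add: unit_simps)
  show ?thesis
  proof (rule bimoduleI, unfold free_bimod_simps)
    show "comm_group free_bimod"
      by (rule comm_group_iso[OF cg, of "\<lambda>x. x"])
         (auto simp: free_bimod_simps iso_def hom_def bij_betw_def)
    fix u assume u: "u \<in> carrier unit_square"
    show "lact free_bimod \<one>\<^bsub>A\<^esub> u = u" "ract free_bimod u \<one>\<^bsub>A\<^esub> = u"
      using u by (induction rule: square_induct) simp_all
    show "lact free_bimod (c \<odot>\<^bsub>A\<^esub> \<one>\<^bsub>A\<^esub>) u = ract free_bimod u (c \<odot>\<^bsub>A\<^esub> \<one>\<^bsub>A\<^esub>)" if c: "c \<in> carrier k" for c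
      using u
    proof (induction rule: square_induct)
      case (gen x y)
      then show ?case
        using c pair(4)[of x c y]
        by (simp add: unit_simps proj_unit smult_mult_left smult_mult_right)
    qed (use c in simp_all)
    fix a b assume [simp]: "a \<in> carrier A" "b \<in> carrier A"
    show "lact free_bimod (a \<oplus>\<^bsub>A\<^esub> b) u = lact free_bimod a u \<otimes>\<^bsub>unit_square\<^esub> lact free_bimod b u"
      "ract free_bimod u (a \<oplus>\<^bsub>A\<^esub> b) = ract free_bimod u a \<otimes>\<^bsub>unit_square\<^esub> ract free_bimod u b"
      "lact free_bimod (a \<otimes>\<^bsub>A\<^esub> b) u = lact free_bimod a (lact free_bimod b u)"
      "ract free_bimod u (a \<otimes>\<^bsub>A\<^esub> b) = ract free_bimod (ract free_bimod u a) b"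
      "ract free_bimod (lact free_bimod a u) b = lact free_bimod a (ract free_bimod u b)"
      using u by (induction rule: square_induct) (simp_all add: add W.m_ac)
  qed simp_all
qed

lemma pair_eq_actions:
  "\<lbrakk>a \<in> carrier A; b \<in> carrier A\<rbrakk> \<Longrightarrow> pair (emb a) (emb b) = ract free_bimod (lact free_bimod a free_gen) b"
  by (simp add: free_gen_def free_actions unit_simps)

lemma free_gen_closed: "free_gen \<in> carrier free_bimod"
  unfolding free_gen_def free_bimod_simps by (rule pair(1)) simp_all

text \<open>The homomorphism \<open>a \<otimes> b \<mapsto> a v b\<close>. It respects the tensor product over \<open>k\<close> because the left and right
  actions of \<open>k\<close> on \<open>V\<close> agree.\<close>

lemma free_hom:
  assumes V: "bimodule k A V" and v: "v \<in> carrier V"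
  obtains h where "h \<in> bimod_hom A free_bimod V" "h free_gen = v"
proof -
  note [simp] = bimoduleD[OF V] v
  interpret V: comm_group V by (rule bimoduleD(1)[OF V])
  let ?f = "\<lambda>x y. ract V (lact V (proj x) v) (proj y)"
  have bal: "k.balanced unit_k unit_k V ?f"
    by (rule k.balancedI)
       (simp_all add: unit_k_simps unit_simps proj_unit carrier_self)
  define h where "h = tensor_lift (self_algebra k) unit_k unit_k V ?f"
  note h = k.tensor_lift[OF bimodule_unit_k bimodule_unit_k V.comm_group_axioms bal,
      folded h_def, unfolded unit_k_simps(1)]
  note [simp] = h(2) hom_in_carrier[OF h(1)] hom_mult[OF h(1)] free_actions(2,4)
    hom_in_carrier[OF free_actions(1)] hom_in_carrier[OF free_actions(3)]
    hom_mult[OF free_actions(1)] hom_mult[OF free_actions(3)]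
    bimoduleD[OF bimodule_unit] pair(1)
  have act: "h (lact free_bimod a t) = lact V a (h t)" "h (ract free_bimod t a) = ract V (h t) a"
    if "t \<in> carrier unit_square" and [simp]: "a \<in> carrier A" for t a
    using that(1) by (induction rule: square_induct) (simp_all add: unit_simps proj_unit)
  have "h \<in> bimod_hom A free_bimod V"
    using h(1) act by (auto simp: bimod_hom_def hom_def free_bimod_simps)
  moreover have "h free_gen = v" by (simp add: free_gen_def)
  ultimately show ?thesis by (rule that)
qed

end

section \<open>Braidings on the category of bimodules\<close>

text \<open>The coefficients of \<open>c(e \<otimes> e)\<close> are kept as a list of triples, so that the same coefficients can be used in
  every bimodule.\<close>

definition list_sum :: "('g, 'm) monoid_scheme \<Rightarrow> ('x \<Rightarrow> 'g) \<Rightarrow> 'x list \<Rightarrow> 'g" where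
  "list_sum G f xs = foldr (\<lambda>x s. f x \<otimes>\<^bsub>G\<^esub> s) xs \<one>\<^bsub>G\<^esub>"

lemma list_sum_simps [simp]:
  "list_sum G f [] = \<one>\<^bsub>G\<^esub>" "list_sum G f (x # xs) = f x \<otimes>\<^bsub>G\<^esub> list_sum G f xs"
  by (simp_all add: list_sum_def)

lemma (in group) list_sum_closed:
  "(\<And>x. x \<in> set xs \<Longrightarrow> f x \<in> carrier G) \<Longrightarrow> list_sum G f xs \<in> carrier G"
  by (induction xs) simp_all

lemma list_sum_cong:
  "(\<And>x. x \<in> set xs \<Longrightarrow> f x = g x) \<Longrightarrow> list_sum G f xs = list_sum G g xs"
  by (induction xs) simp_all

lemma (in group) list_sum_append:
  "(\<And>x. x \<in> set (xs @ ys) \<Longrightarrow> f x \<in> carrier G) \<Longrightarrow>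
    list_sum G f (xs @ ys) = list_sum G f xs \<otimes> list_sum G f ys"
  by (induction xs) (simp_all add: m_assoc list_sum_closed)

lemma hom_list_sum:
  assumes "group G" "group H" "h \<in> hom G H" "\<And>x. x \<in> set xs \<Longrightarrow> f x \<in> carrier G"
  shows "h (list_sum G f xs) = list_sum H (\<lambda>x. h (f x)) xs"
  using assms(4)
proof (induction xs)
  case Nil
  then show ?case using hom_one[OF assms(3,1,2)] by simp
next
  case (Cons x xs)
  then show ?case by (simp add: hom_mult[OF assms(3)] group.list_sum_closed[OF assms(1)])
qed

lemma (in comm_group) list_sum_mult:
  "(\<And>x. x \<in> set xs \<Longrightarrow> f x \<in> carrier G \<and> g x \<in> carrier G) \<Longrightarrow>
    list_sum G (\<lambda>x. f x \<otimes> g x) xs = list_sum G f xs \<otimes> list_sum G g xs"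
  by (induction xs) (simp_all add: m_ac list_sum_closed)

lemma (in comm_group) list_sum_swap:
  assumes "\<And>x y. \<lbrakk>x \<in> set xs; y \<in> set ys\<rbrakk> \<Longrightarrow> f x y \<in> carrier G"
  shows "list_sum G (\<lambda>x. list_sum G (f x) ys) xs = list_sum G (\<lambda>y. list_sum G (\<lambda>x. f x y) xs) ys"
  using assms
proof (induction xs)
  case Nil
  show ?case by (induction ys) simp_all
next
  case (Cons x xs)
  then show ?case by (simp add: list_sum_mult list_sum_closed)
qed

context small_bimodule_category
begin

abbreviation A3 :: "('a \<times> 'a \<times> 'a) set" where "A3 \<equiv> carrier A \<times> carrier A \<times> carrier A"

text \<open>The term of \<open>c(u \<otimes> v)\<close> that belongs to the coefficients \<open>(x, y, z)\<close>.\<close>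

definition summand :: "('a, 'u) bimod \<Rightarrow> ('a, 'u) bimod \<Rightarrow> 'u \<Rightarrow> 'u \<Rightarrow> 'a \<times> 'a \<times> 'a \<Rightarrow> 'u" where
  "summand V U v u = (\<lambda>(x, y, z). ptensor A V U (lact V x v) (ract U (lact U y u) z))"

text \<open>A pure tensor \<open>(a e b) \<otimes> (a' e b')\<close> equals \<open>a e \<otimes> (b a') e b'\<close>; general elements are sums of these, first
  in the second and then in the first factor.\<close>

lemma free_tensor_sum:
  assumes "t \<in> carrier (free_bimod \<otimes>\<^sub>A free_bimod)"
  shows "\<exists>xs. set xs \<subseteq> A3 \<and>
    t = list_sum (free_bimod \<otimes>\<^sub>A free_bimod) (summand free_bimod free_bimod free_gen free_gen) xs"
    (is "?S t")
proof -
  let ?F = free_bimod and ?e = free_gen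
  let ?T = "?F \<otimes>\<^sub>A ?F"
  note F = bimodule_free
  note [simp] = bimoduleD[OF F] ptensor(1)[OF F F] free_gen_closed
  interpret T: comm_group ?T by (rule comm_group_tensor(2)[OF F F])
  have closed: "summand ?F ?F ?e ?e x \<in> carrier ?T" if "x \<in> A3" for x
    using that by (auto simp: summand_def)
  have sum_closed: "?S (t \<otimes>\<^bsub>?T\<^esub> t')" if t: "?S t" and t': "?S t'" for t t'
  proof -
    from t obtain xs where xs: "set xs \<subseteq> A3" "t = list_sum ?T (summand ?F ?F ?e ?e) xs" by blast
    from t' obtain ys where ys: "set ys \<subseteq> A3" "t' = list_sum ?T (summand ?F ?F ?e ?e) ys" by blast
    have "t \<otimes>\<^bsub>?T\<^esub> t' = list_sum ?T (summand ?F ?F ?e ?e) (xs @ ys)"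
      unfolding xs(2) ys(2) by (rule T.list_sum_append[symmetric]) (use xs(1) ys(1) closed in auto)
    then show ?thesis using xs(1) ys(1) by (intro exI[of _ "xs @ ys"]) simp
  qed
  have gen: "?S (ptensor A ?F ?F (pair x y) (pair x' y'))"
    if xy: "x \<in> carrier unit" "y \<in> carrier unit" "x' \<in> carrier unit" "y' \<in> carrier unit" for x y x' y'
  proof -
    have pq: "pair x y = ract ?F (lact ?F (proj x) ?e) (proj y)"
      "pair x' y' = ract ?F (lact ?F (proj x') ?e) (proj y')"
      using pair_eq_actions[of "proj x" "proj y"] pair_eq_actions[of "proj x'" "proj y'"] xy
      by (simp_all add: proj_unit)
    have "ptensor A ?F ?F (pair x y) (pair x' y') =
        summand ?F ?F ?e ?e (proj x, proj y \<otimes>\<^bsub>A\<^esub> proj x', proj y')"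
      unfolding pq using xy by (simp add: summand_def ptensor(4)[OF F F] proj_unit bimoduleD(12)[OF F, symmetric] del: bimoduleD(12)[OF F])
    then show ?thesis
      using xy closed[of "(proj x, proj y \<otimes>\<^bsub>A\<^esub> proj x', proj y')"]
      by (intro exI[of _ "[(proj x, proj y \<otimes>\<^bsub>A\<^esub> proj x', proj y')]"]) (simp add: proj_unit)
  qed
  have sq: "carrier unit_square = carrier ?F" "monoid.mult unit_square = monoid.mult ?F"
    by (simp_all add: free_bimod_simps)
  note square_induct' = square_induct[unfolded sq, consumes 1, case_names gen mult]
  have half: "?S (ptensor A ?F ?F (pair x y) v)"
    if "x \<in> carrier unit" "y \<in> carrier unit" and v: "v \<in> carrier ?F" for x y v
    using v
  proof (induction rule: square_induct')
    case (mult v v')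
    have "pair x y \<in> carrier ?F" using that by (simp add: free_bimod_simps pair(1))
    then show ?case using mult by (simp add: ptensor(3)[OF F F] sum_closed)
  qed (use gen that in auto)
  have "?S (ptensor A ?F ?F u v)" if "u \<in> carrier ?F" and v: "v \<in> carrier ?F" for u v
    using that(1)
  proof (induction rule: square_induct')
    case (mult u u')
    then show ?case using v by (simp add: ptensor(2)[OF F F] sum_closed)
  qed (use half v in auto)
  with assms show ?thesis
    by (induction rule: tensor_induct[OF F F, consumes 1]) (use sum_closed in auto)
qed

end

locale braided_bimodules = small_bimodule_category k A univ
  for k :: "('k, 'r) ring_scheme" and A :: "('k, 'a, 's) module_scheme" and univ :: "'u itself" +
  fixes c :: "('a, 'u) bimod \<Rightarrow> ('a, 'u) bimod \<Rightarrow> 'u \<Rightarrow> 'u"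
  assumes braiding: "braiding k A c"
begin

context
  fixes U V :: "('a, 'u) bimod"
  assumes U: "bimodule k A U" and V: "bimodule k A V"
begin

lemma c_hom: "c U V \<in> bimod_hom A (U \<otimes>\<^sub>A V) (V \<otimes>\<^sub>A U)"
  and c_bij: "bij_betw (c U V) (carrier (U \<otimes>\<^sub>A V)) (carrier (V \<otimes>\<^sub>A U))"
  using braiding U V unfolding braiding_def by auto

lemma c_natural:
  assumes "bimodule k A U'" "bimodule k A V'" "f \<in> bimod_hom A U U'" "g \<in> bimod_hom A V V'"
    and "x \<in> carrier (U \<otimes>\<^sub>A V)"
  shows "c U' V' (tensor_map A U V U' V' f g x) = tensor_map A V U V' U' g f (c U V x)"
  using braiding[unfolded braiding_def, THEN conjunct2, THEN conjunct1, rule_format, of U V U' V' f g x]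
    U V assms by simp

lemma c_hexagon:
  assumes "bimodule k A W" "x \<in> carrier ((U \<otimes>\<^sub>A V) \<otimes>\<^sub>A W)"
  shows "associator A V W U (c U (V \<otimes>\<^sub>A W) (associator A U V W x)) =
    tensor_map A V (U \<otimes>\<^sub>A W) V (W \<otimes>\<^sub>A U) (\<lambda>v. v) (c U W)
      (associator A V U W (tensor_map A (U \<otimes>\<^sub>A V) W (V \<otimes>\<^sub>A U) W (c U V) (\<lambda>w. w) x))"
  using braiding[unfolded braiding_def, THEN conjunct2, THEN conjunct2, THEN conjunct1, rule_format, of U V W x]
    U V assms by simp

end

text \<open>Write \<open>c(u \<otimes> 1) = 1 \<otimes> z\<close> and \<open>c(z \<otimes> 1) = 1 \<otimes> w\<close>. In the first hexagon for \<open>U, A, A\<close>, one side sends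
  \<open>(u \<otimes> 1) \<otimes> 1\<close> to \<open>1 \<otimes> (1 \<otimes> w)\<close> by using the braiding twice. The other side uses the braiding of \<open>U\<close> with
  \<open>A \<otimes>\<^sub>A A\<close>, which by naturality along the homomorphism \<open>A \<rightarrow> A \<otimes>\<^sub>A A\<close> with \<open>1 \<mapsto> 1 \<otimes> 1\<close> yields
  \<open>1 \<otimes> (1 \<otimes> z)\<close>. Hence \<open>w = z\<close>, and injectivity of the braiding gives \<open>z = u\<close>.\<close>

lemma c_unit:
  assumes U: "bimodule k A U" and u: "u \<in> carrier U"
  shows "c U unit (ptensor A U unit u (emb \<one>\<^bsub>A\<^esub>)) = ptensor A unit U (emb \<one>\<^bsub>A\<^esub>) u"
proof -
  let ?I = unit and ?i = "emb \<one>\<^bsub>A\<^esub>"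
  note I = bimodule_unit
  note UI = bimodule_tensor[OF U I] and IU = bimodule_tensor[OF I U] and II = bimodule_tensor[OF I I]
  have i [simp]: "?i \<in> carrier ?I" by simp
  have ex: "\<exists>z\<in>carrier U. c U ?I (ptensor A U ?I u ?i) = ptensor A ?I U ?i z" if u: "u \<in> carrier U" for u
    using bimod_homD(2)[OF c_hom[OF U I] ptensor(1)[OF U I u i]]
    by (elim unit_tensor_cases[OF U]) blast
  then obtain z where z: "z \<in> carrier U" "c U ?I (ptensor A U ?I u ?i) = ptensor A ?I U ?i z"
    using u by blast
  obtain w where w: "w \<in> carrier U" "c U ?I (ptensor A U ?I z ?i) = ptensor A ?I U ?i w"
    using ex z(1) by blast
  define d where "d x = lact (?I \<otimes>\<^sub>A ?I) (proj x) (ptensor A ?I ?I ?i ?i)" for x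
  have ii: "ptensor A ?I ?I ?i ?i \<in> carrier (?I \<otimes>\<^sub>A ?I)" by (rule ptensor(1)[OF I I]) simp_all
  have central: "lact (?I \<otimes>\<^sub>A ?I) a (ptensor A ?I ?I ?i ?i) = ract (?I \<otimes>\<^sub>A ?I) (ptensor A ?I ?I ?i ?i) a"
    if "a \<in> carrier A" for a
    using that ptensor(4)[OF I I i that i]
    by (simp add: tensor_actions(2,4)[OF I I] unit_cyclic)
  have central': "lact (?I \<otimes>\<^sub>A ?I) a (ract (?I \<otimes>\<^sub>A ?I) (ptensor A ?I ?I ?i ?i) b) =
      ract (?I \<otimes>\<^sub>A ?I) (ract (?I \<otimes>\<^sub>A ?I) (ptensor A ?I ?I ?i ?i) a) b"
    if "a \<in> carrier A" "b \<in> carrier A" for a b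
    using bimoduleD(12)[OF II that ii] central[OF that(1)] by simp
  have d: "d \<in> bimod_hom A ?I (?I \<otimes>\<^sub>A ?I)"
    using ii by (auto simp: bimod_hom_def hom_def d_def unit_simps proj_unit bimoduleD[OF II] central central')
  have d1: "d ?i = ptensor A ?I ?I ?i ?i"
    using ii by (simp add: d_def bimoduleD[OF II])
  note map1 = tensor_map[OF U I U II bimod_hom_id d] and map2 = tensor_map[OF I U II U d bimod_hom_id]
  have nat: "c U (?I \<otimes>\<^sub>A ?I) (ptensor A U (?I \<otimes>\<^sub>A ?I) u (ptensor A ?I ?I ?i ?i)) =
      ptensor A (?I \<otimes>\<^sub>A ?I) U (ptensor A ?I ?I ?i ?i) z"
    using c_natural[OF U I U II bimod_hom_id d ptensor(1)[OF U I u i]] map1(2)[OF u i] map2(2)[OF i z(1)]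
    by (simp add: z d1)
  have x: "ptensor A (U \<otimes>\<^sub>A ?I) ?I (ptensor A U ?I u ?i) ?i \<in> carrier ((U \<otimes>\<^sub>A ?I) \<otimes>\<^sub>A ?I)"
    by (rule ptensor(1)[OF UI I]) (simp_all add: ptensor(1)[OF U I] u)
  have "ptensor A ?I (?I \<otimes>\<^sub>A U) ?i (ptensor A ?I U ?i z) = ptensor A ?I (?I \<otimes>\<^sub>A U) ?i (ptensor A ?I U ?i w)"
    using c_hexagon[OF U I I x]
    by (simp add: associator_ptensor[OF U I I u i i] nat associator_ptensor[OF I I U i i z(1)]
        tensor_map(2)[OF UI I IU I c_hom[OF U I] bimod_hom_id] ptensor(1)[OF U I u i] z
        associator_ptensor[OF I U I i z(1) i]
        tensor_map(2)[OF I UI I IU bimod_hom_id c_hom[OF U I]] ptensor(1)[OF U I z(1) i] w)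
  then have "ptensor A ?I U ?i z = ptensor A ?I U ?i w"
    by (rule ptensor_unit_inject[OF IU, rotated 2]) (simp_all add: ptensor(1)[OF I U] z w)
  then have "z = w" by (rule ptensor_unit_inject[OF U z(1) w(1)])
  then have "c U ?I (ptensor A U ?I z ?i) = c U ?I (ptensor A U ?I u ?i)"
    unfolding w(2) z(2) by simp
  then have "ptensor A U ?I z ?i = ptensor A U ?I u ?i"
    using c_bij[OF U I] ptensor(1)[OF U I z(1) i] ptensor(1)[OF U I u i]
    by (auto simp: bij_betw_def dest: inj_onD)
  then have "z = u" by (rule ptensor_unit_inject_right[OF U z(1) u])
  then show ?thesis using z by simp
qed

text \<open>The computation of \<open>c\<^sup>2(u \<otimes> v)\<close> from the explicit form of the braiding.\<close>

theorem c_involutive: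
  assumes U: "bimodule k A U" and V: "bimodule k A V" and t: "t \<in> carrier (U \<otimes>\<^sub>A V)"
  shows "c V U (c U V t) = t"
proof -
  let ?F = free_bimod and ?e = free_gen and ?I = unit and ?i = "emb \<one>\<^bsub>A\<^esub>"
  note F = bimodule_free and I = bimodule_unit
  obtain R where R: "set R \<subseteq> A3"
      "c ?F ?F (ptensor A ?F ?F ?e ?e) = list_sum (?F \<otimes>\<^sub>A ?F) (summand ?F ?F ?e ?e) R"
    using free_tensor_sum[OF bimod_homD(2)[OF c_hom[OF F F] ptensor(1)[OF F F free_gen_closed free_gen_closed]]]
    by blast
  have R3: "x \<in> carrier A" "y \<in> carrier A" "z \<in> carrier A" if "(x, y, z) \<in> set R" for x y z
    using that R(1) by auto
  have grp: "group (U \<otimes>\<^sub>A V)" if "bimodule k A U" "bimodule k A V" for U V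
    using comm_group_tensor(2)[OF that] by (simp add: comm_group_def)
  have grp': "group U" if "bimodule k A U" for U
    using bimoduleD(1)[OF that] by (simp add: comm_group_def)
  have summand_closed: "summand V U v u r \<in> carrier (V \<otimes>\<^sub>A U)"
    if "bimodule k A U" "bimodule k A V" "u \<in> carrier U" "v \<in> carrier V" "r \<in> set R" for U V u v r
    using that(3-) R3 by (cases r)
      (auto simp: summand_def bimoduleD[OF that(1)] bimoduleD[OF that(2)] ptensor(1)[OF that(2,1)])

  \<comment> \<open>Naturality transports the value at the generators to arbitrary elements.\<close>
  have c_sum: "c U V (ptensor A U V u v) = list_sum (V \<otimes>\<^sub>A U) (summand V U v u) R"
    if U: "bimodule k A U" and V: "bimodule k A V" and u: "u \<in> carrier U" and v: "v \<in> carrier V" for U V u v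
  proof -
    obtain f where f: "f \<in> bimod_hom A ?F U" "f ?e = u" using free_hom[OF U u] .
    obtain g where g: "g \<in> bimod_hom A ?F V" "g ?e = v" using free_hom[OF V v] .
    note map = tensor_map[OF F F V U g(1) f(1)]
    have "c U V (ptensor A U V u v) = c U V (tensor_map A ?F ?F U V f g (ptensor A ?F ?F ?e ?e))"
      by (simp add: tensor_map(2)[OF F F U V f(1) g(1)] free_gen_closed f g)
    also have "\<dots> = tensor_map A ?F ?F V U g f (list_sum (?F \<otimes>\<^sub>A ?F) (summand ?F ?F ?e ?e) R)"
      unfolding R(2)[symmetric]
      by (rule c_natural[OF F F U V f(1) g(1)]) (simp add: ptensor(1)[OF F F] free_gen_closed)
    also have "\<dots> = list_sum (V \<otimes>\<^sub>A U) (\<lambda>r. tensor_map A ?F ?F V U g f (summand ?F ?F ?e ?e r)) R"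
      by (rule hom_list_sum[OF grp[OF F F] grp[OF V U] map(1)])
         (rule summand_closed[OF F F free_gen_closed free_gen_closed])
    also have "\<dots> = list_sum (V \<otimes>\<^sub>A U) (summand V U v u) R"
    proof (rule list_sum_cong)
      fix r assume r: "r \<in> set R"
      obtain x y z where xyz: "r = (x, y, z)" by (cases r)
      show "tensor_map A ?F ?F V U g f (summand ?F ?F ?e ?e r) = summand V U v u r"
        using R3[OF r[unfolded xyz]] by (simp add: xyz summand_def map(2) bimoduleD[OF F] bimoduleD[OF U] bimoduleD[OF V] u v free_gen_closed
          bimod_homD(4,5)[OF f(1)] bimod_homD(4,5)[OF g(1)] f g)
    qed
    finally show ?thesis .
  qed

  \<comment> \<open>Both expressions are \<open>c(u a \<otimes> 1) = c(u \<otimes> a)\<close>, read in \<open>A \<otimes>\<^sub>A U = U\<close>.\<close>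
  have sandwich: "list_sum U (\<lambda>(x, y, z). lact U x (lact U a (ract U (lact U y u) z))) R = ract U u a"
    if U: "bimodule k A U" and u: "u \<in> carrier U" and a: "a \<in> carrier A"
    for U :: "('a, 'u) bimod" and u a
  proof -
    note [simp] = bimoduleD[OF U]
    have ua: "ract U u a \<in> carrier U" and ia: "emb a \<in> carrier ?I" and i: "?i \<in> carrier ?I"
      using u a by simp_all
    have "ract U u a = left_unit U (ptensor A ?I U ?i (ract U u a))"
      using ua by (simp add: left_unit(2)[OF U])
    also have "ptensor A ?I U ?i (ract U u a) = c U ?I (ptensor A U ?I u (emb a))"
      using c_unit[OF U ua] ptensor(4)[OF U I u a i] by (simp add: unit_cyclic a)
    also have "left_unit U \<dots> = list_sum U (\<lambda>r. left_unit U (summand ?I U (emb a) u r)) R"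
      unfolding c_sum[OF U I u ia]
      by (rule hom_list_sum[OF grp[OF I U] grp'[OF U] left_unit(1)[OF U]])
         (rule summand_closed[OF U I u ia])
    also have "\<dots> = list_sum U (\<lambda>(x, y, z). lact U x (lact U a (ract U (lact U y u) z))) R"
      by (rule list_sum_cong)
         (use R3 u a in \<open>auto simp: summand_def unit_simps left_unit(2)[OF U]\<close>)
    finally show ?thesis by (rule sym)
  qed

  have inv: "c V U (c U V (ptensor A U V u v)) = ptensor A U V u v"
    if u: "u \<in> carrier U" and v: "v \<in> carrier V" for u v
  proof -
    note [simp] = bimoduleD[OF U] bimoduleD[OF V] u v
    note cVU = bimod_homD[OF c_hom[OF V U]]
    let ?T = "U \<otimes>\<^sub>A V"
    interpret T: comm_group ?T by (rule comm_group_tensor(2)[OF U V])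
    \<comment> \<open>The braiding is left linear, so \<open>c(x v \<otimes> y u z) = \<Sum> x x' y u z \<otimes> y' v z'\<close>.\<close>
    let ?p = "\<lambda>(x, y, z) (x', y', z'). lact U x (lact U x' (ract U (lact U y u) z))"
    let ?q = "\<lambda>(x', y', z'). ract V (lact V y' v) z'"
    have step: "c V U (summand V U v u r) = list_sum ?T (\<lambda>s. ptensor A U V (?p r s) (?q s)) R"
      if r: "r \<in> set R" for r
    proof -
      obtain x y z where xyz: "r = (x, y, z)" by (cases r)
      have [simp]: "x \<in> carrier A" "y \<in> carrier A" "z \<in> carrier A" using R3 r xyz by auto
      let ?w = "ract U (lact U y u) z"
      have w: "?w \<in> carrier U" by simp
      have "c V U (summand V U v u r) = c V U (lact (V \<otimes>\<^sub>A U) x (ptensor A V U v ?w))"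
        by (simp add: xyz summand_def tensor_actions(2)[OF V U])
      also have "\<dots> = lact ?T x (list_sum ?T (summand U V ?w v) R)"
        unfolding c_sum[OF V U v w, symmetric]
        by (rule cVU(4)) (simp_all add: ptensor(1)[OF V U])
      also have "\<dots> = list_sum ?T (\<lambda>s. lact ?T x (summand U V ?w v s)) R"
        by (rule hom_list_sum[OF T.group_axioms T.group_axioms tensor_actions(1)[OF U V]])
           (simp, rule summand_closed[OF V U v w])
      also have "\<dots> = list_sum ?T (\<lambda>s. ptensor A U V (?p r s) (?q s)) R"
        by (rule list_sum_cong) (use R3 in \<open>auto simp: xyz summand_def tensor_actions(2)[OF U V]\<close>)
      finally show ?thesis .
    qed
    have pq: "?p r s \<in> carrier U" "?q s \<in> carrier V" if "r \<in> set R" "s \<in> set R" for r s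
      using that R3 by (auto split: prod.splits)
    have "c V U (c U V (ptensor A U V u v)) = list_sum ?T (\<lambda>r. c V U (summand V U v u r)) R"
      unfolding c_sum[OF U V u v]
      by (rule hom_list_sum[OF grp[OF V U] T.group_axioms cVU(1)]) (rule summand_closed[OF U V u v])
    also have "\<dots> = list_sum ?T (\<lambda>r. list_sum ?T (\<lambda>s. ptensor A U V (?p r s) (?q s)) R) R"
      by (rule list_sum_cong) (rule step)
    also have "\<dots> = list_sum ?T (\<lambda>s. list_sum ?T (\<lambda>r. ptensor A U V (?p r s) (?q s)) R) R"
      by (rule T.list_sum_swap) (rule ptensor(1)[OF U V pq])
    \<comment> \<open>For fixed \<open>s\<close>, the inner sum is a sandwich of \<open>x'\<close>, which then moves across the tensor sign.\<close>
    also have "\<dots> = list_sum ?T (\<lambda>s. ptensor A U V u (lact V (fst s) (?q s))) R"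
    proof (rule list_sum_cong)
      fix s assume s: "s \<in> set R"
      obtain x' y' z' where xyz: "s = (x', y', z')" by (cases s)
      have [simp]: "x' \<in> carrier A" "y' \<in> carrier A" "z' \<in> carrier A" using R3 s xyz by auto
      have q: "?q s \<in> carrier V" by (rule pq(2)[OF s s])
      have h: "(\<lambda>t. ptensor A U V t (?q s)) \<in> hom U ?T"
        using q by (intro homI) (simp_all add: ptensor[OF U V])
      have "list_sum ?T (\<lambda>r. ptensor A U V (?p r s) (?q s)) R =
          ptensor A U V (list_sum U (\<lambda>r. ?p r s) R) (?q s)"
        by (rule hom_list_sum[OF grp'[OF U] T.group_axioms h, symmetric]) (rule pq(1)[OF _ s])
      also have "list_sum U (\<lambda>r. ?p r s) R = ract U u x'"
        using sandwich[OF U u, of x'] by (simp add: xyz case_prod_unfold)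
      also have "ptensor A U V (ract U u x') (?q s) = ptensor A U V u (lact V (fst s) (?q s))"
        using ptensor(4)[OF U V u _ q, of x'] by (simp add: xyz)
      finally show "list_sum ?T (\<lambda>r. ptensor A U V (?p r s) (?q s)) R =
          ptensor A U V u (lact V (fst s) (?q s))" .
    qed
    also have "\<dots> = ptensor A U V u (list_sum V (\<lambda>s. lact V (fst s) (?q s)) R)"
    proof (rule hom_list_sum[symmetric, OF grp'[OF V] T.group_axioms])
      show "ptensor A U V u \<in> hom V ?T" by (intro homI) (simp_all add: ptensor[OF U V])
      show "lact V (fst s) (?q s) \<in> carrier V" if "s \<in> set R" for s
        using that R3 by (auto split: prod.splits)
    qed
    also have "list_sum V (\<lambda>s. lact V (fst s) (?q s)) R =
        list_sum V (\<lambda>(x, y, z). lact V x (lact V \<one>\<^bsub>A\<^esub> (ract V (lact V y v) z))) R"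
      by (rule list_sum_cong) (use R3 in \<open>auto\<close>)
    also have "\<dots> = v" using sandwich[OF V v A.one_closed] by simp
    finally show ?thesis .
  qed
  show ?thesis
    using tensor_hom_eq[OF U V hom_compose[OF bimod_homD(1)[OF c_hom[OF U V]] bimod_homD(1)[OF c_hom[OF V U]]]
        iso_imp_homomorphism[OF iso_set_refl] _ t] inv by simp
qed

end

lemma braiding_is_symmetry:
  fixes k :: "('k, 'r) ring_scheme" and A :: "('k, 'a, 's) module_scheme"
    and c :: "('a, 'u) bimod \<Rightarrow> ('a, 'u) bimod \<Rightarrow> 'u \<Rightarrow> 'u"
  assumes "assoc_algebra k A" and inf: "infinite (UNIV :: 'u set)" and small: "carrier A \<lesssim> (UNIV :: 'u set)"
    and c: "braiding k A c"
  shows "symmetry k A c"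
proof -
  interpret assoc_algebra k A by fact
  interpret braided_bimodules k A "TYPE('u)" c
    by unfold_locales (use inf small c in auto)
  have "inv_into (carrier (U \<otimes>\<^sub>A V)) (c U V) y = c V U y"
    if U: "bimodule k A U" and V: "bimodule k A V" and y: "y \<in> carrier (V \<otimes>\<^sub>A U)" for U V y
    using c_bij[OF U V] c_involutive[OF V U y] bimod_homD(2)[OF c_hom[OF V U] y]
    by (metis bij_betw_inv_into_left)
  then show ?thesis unfolding symmetry_def using c by blast
qed


theorem theorem2p2:
  fixes k :: "('k, 'r) ring_scheme" and A :: "('k, 'a, 's) module_scheme"
  assumes "assoc_algebra k A"
  shows "bij_betw (\<lambda>R. R) {R. canonical_R_matrix k A R} (normalized_elements k A) \<and>
    (\<forall>R\<in>normalized_elements k A.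
       R = sweedler k A 3 R (\<lambda>R1 R2 R3. [R2, R3, R1]) \<and>
       R = sweedler k A 3 R (\<lambda>R1 R2 R3. [R3, R1, R2]) \<and>
       sweedler k A 2 R (\<lambda>R1 R2 R3. [R1, R2 \<otimes>\<^bsub>A\<^esub> R3]) = pure k A [\<one>\<^bsub>A\<^esub>, \<one>\<^bsub>A\<^esub>]) \<and>
    (infinite (UNIV :: 'u set) \<and> carrier A \<lesssim> (UNIV :: 'u set) \<longrightarrow>
       (\<forall>c :: ('a, 'u) bimod \<Rightarrow> ('a, 'u) bimod \<Rightarrow> 'u \<Rightarrow> 'u.
          braiding k A c \<longrightarrow> symmetry k A c))"
proof (intro conjI ballI impI allI)
  interpret assoc_algebra k A by fact
  show "bij_betw (\<lambda>R. R) {R. canonical_R_matrix k A R} (normalized_elements k A)"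
    unfolding canonical_eq_normalized by (simp add: bij_betw_def)
  fix R assume "R \<in> normalized_elements k A"
  then have R: "R \<in> carrier (T 3)" "exchange23 R" "normal12 R" "normal31 R"
    by (simp_all add: normalized_iff)
  show "R = sweedler k A 3 R (\<lambda>R1 R2 R3. [R2, R3, R1])"
    "R = sweedler k A 3 R (\<lambda>R1 R2 R3. [R3, R1, R2])"
    using normalized_invariant[OF R] by simp_all
  show "sweedler k A 2 R (\<lambda>R1 R2 R3. [R1, R2 \<otimes>\<^bsub>A\<^esub> R3]) = pure k A [\<one>\<^bsub>A\<^esub>, \<one>\<^bsub>A\<^esub>]"
    using normalized_exchange(3)[OF R] by (simp add: normal23_def)
qed (auto intro: braiding_is_symmetry[OF assms])

end
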